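(* Let $\mathcal{M}$ be a von Neumann algebra. Then the following statements hold: (1) $\tau_o(\mathcal{M}_{sa},\preceq)|_{\mathcal{M}_+}=\tau_o(\mathcal{M}_+,\preceq)$. (2) $\tau_o(\mathcal{M}_{sa},\preceq)|_{B_1(\mathcal{M}_{sa})}=\tau_o(B_1(\mathcal{M}_{sa}),\preceq)$. (3) $\tau_o(\mathcal{M}_{sa},\preceq)|_{\mathcal{E}(\mathcal{M})}=\tau_o(\mathcal{M}_+,\preceq)|_{\mathcal{E}(\mathcal{M})}=\tau_o(B_1(\mathcal{M}_{sa}),\preceq)|_{\mathcal{E}(\mathcal{M})}=\tau_o(\mathcal{E}(\mathcal{M}),\preceq)$. (4) $\tau_o(\mathcal{M}_{sa},\preceq)|_{P(\mathcal{M})}=\tau_o(\mathcal{M}_+,\preceq)|_{P(\mathcal{M})}=\tau_o(B_1(\mathcal{M}_{sa}),\preceq)|_{P(\mathcal{M})}=\tau_o(\mathcal{E}(\mathcal{M}),\preceq)|_{P(\mathcal{M})}=\tau_o(P(\mathcal{M}),\preceq)$.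
   Context: A von Neumann algebra $\mathcal{M}$ is a strongly operator closed C*-subalgebra of $\mathcal{B}(\mathcal{H})$, $\mathcal{H}$ a complex Hilbert space. $\mathcal{M}_{sa}$ is its self-adjoint part, $\mathcal{M}_+$ its positive part, $B_1(\mathcal{M}_{sa})$ the (closed, norm) unit ball of $\mathcal{M}_{sa}$, $\mathcal{E}(\mathcal{M})=\mathcal{M}_+\cap B_1(\mathcal{M}_{sa})$ the set of effects, and $P(\mathcal{M})$ the set of projections in $\mathcal{M}$. For $x\in\mathcal{M}_{sa}$, $(E^x_\lambda)_{\lambda\in\mathbb{R}}$ is its (right-continuous) spectral family: $E^x_\lambda$ is the spectral projection of $x$ for $(-\infty,\lambda]$. The spectral order $\preceq$ on $\mathcal{M}_{sa}$ is defined by: $x\preceq y$ iff $E^y_\lambda\le E^x_\lambda$ for every $\lambda\in\mathbb{R}$; subsets of $\mathcal{M}_{sa}$ carry the restricted order, also denoted $\preceq$. A net $(x_\alpha)_{\alpha\in\Lambda}$ in a poset $(P,\leq)$ is order convergent to $x\in P$ if there are an increasing net $(y_\alpha)_{\alpha\in\Lambda}$ and a decreasing net $(z_\alpha)_{\alpha\in\Lambda}$ in $P$ (with the same index set) such that $y_\alpha\le x_\alpha\le z_\alpha$ for all $\alpha$ and $\sup_\alpha y_\alpha=\inf_\alpha z_\alpha=x$ (supremum and infimum in $P$). A set $M\subseteq P$ is order closed if no net in $M$ is order convergent to a point in $P\setminus M$. The complements of the order closed sets form the order topology $\tau_o(P,\leq)$. $\tau|_X$ is the subspace topology on $X$ induced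 by $\tau$. *)

theory Defs
  imports "HOL-Analysis.Analysis" "HOL-Algebra.Order"
begin

section \<open>Complex Hilbert spaces and their bounded operators\<close>

text \<open>
  The complex structure sits on top of \<^class>\<open>real_inner\<close>, whose inner product is the real part of
  the complex one; hence the norm is \<open>sqrt (Re (cinner x x))\<close> and positive definiteness is inherited.
  The complex inner product is linear in its first argument.
\<close>

class complex_hilbert = real_inner + complete_space +
  fixes scaleC :: "complex \<Rightarrow> 'a \<Rightarrow> 'a"  (infixr \<open>*\<^sub>C\<close> 75)
    and cinner :: "'a \<Rightarrow> 'a \<Rightarrow> complex"
  assumes scaleC_add_right: "c *\<^sub>C (x + y) = c *\<^sub>C x + c *\<^sub>C y"
    and scaleC_add_left: "(c + d) *\<^sub>C x = c *\<^sub>C x + d *\<^sub>C x"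
    and scaleC_scaleC: "c *\<^sub>C d *\<^sub>C x = (c * d) *\<^sub>C x"
    and scaleC_of_real: "complex_of_real r *\<^sub>C x = r *\<^sub>R x"
    and cinner_commute: "cinner x y = cnj (cinner y x)"
    and cinner_add_left: "cinner (x + y) z = cinner x z + cinner y z"
    and cinner_scaleC_left: "cinner (c *\<^sub>C x) y = c * cinner x y"
    and inner_eq_Re_cinner: "inner x y = Re (cinner x y)"

lemma cinner_scaleC_right:
  "cinner x (c *\<^sub>C y) = cnj c * cinner (x::'a::complex_hilbert) y"
  by (metis cinner_commute cinner_scaleC_left complex_cnj_mult)

lemma norm_scaleC: "norm (c *\<^sub>C x) = cmod c * norm (x::'a::complex_hilbert)"
proof -
  have "cnj c * c = complex_of_real ((cmod c)\<^sup>2)"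
    using complex_norm_square[of c] by (simp add: mult.commute)
  then have "cinner (c *\<^sub>C x) (c *\<^sub>C x) = complex_of_real ((cmod c)\<^sup>2) * cinner x x"
    by (simp add: cinner_scaleC_left cinner_scaleC_right mult.assoc[symmetric] mult.commute)
  then have "inner (c *\<^sub>C x) (c *\<^sub>C x) = (cmod c)\<^sup>2 * inner x x"
    by (simp only: inner_eq_Re_cinner Re_complex_of_real Im_complex_of_real times_complex.sel)
  then show ?thesis
    by (simp add: norm_eq_sqrt_inner real_sqrt_mult)
qed

lemma bounded_linear_scaleC: "bounded_linear ((*\<^sub>C) c :: 'a::complex_hilbert \<Rightarrow> 'a)"
proof (rule bounded_linear_intro[where K = "cmod c"])
  show "c *\<^sub>C (r *\<^sub>R x) = r *\<^sub>R (c *\<^sub>C x)" for r and x :: 'a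
    by (simp add: scaleC_of_real[symmetric] scaleC_scaleC mult.commute)
qed (simp_all add: scaleC_add_right norm_scaleC mult.commute)

definition scaleC_op :: "complex \<Rightarrow> ('a::complex_hilbert \<Rightarrow>\<^sub>L 'a) \<Rightarrow> ('a \<Rightarrow>\<^sub>L 'a)" where
  "scaleC_op c a = Blinfun ((*\<^sub>C) c) o\<^sub>L a"

lemma scaleC_op_apply: "blinfun_apply (scaleC_op c a) \<xi> = c *\<^sub>C a \<xi>"
  by (simp add: scaleC_op_def bounded_linear_Blinfun_apply[OF bounded_linear_scaleC])

definition complex_linear_op :: "('a::complex_hilbert \<Rightarrow>\<^sub>L 'a) \<Rightarrow> bool" where
  "complex_linear_op a \<longleftrightarrow> (\<forall>c \<xi>. a (c *\<^sub>C \<xi>) = c *\<^sub>C a \<xi>)"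

definition is_adjoint :: "('a::complex_hilbert \<Rightarrow>\<^sub>L 'a) \<Rightarrow> ('a \<Rightarrow>\<^sub>L 'a) \<Rightarrow> bool" where
  "is_adjoint b a \<longleftrightarrow> (\<forall>\<xi> \<eta>. cinner (a \<xi>) \<eta> = cinner \<xi> (b \<eta>))"

definition selfadjoint_op :: "('a::complex_hilbert \<Rightarrow>\<^sub>L 'a) \<Rightarrow> bool" where
  "selfadjoint_op a \<longleftrightarrow> is_adjoint a a"

definition positive_op :: "('a::complex_hilbert \<Rightarrow>\<^sub>L 'a) \<Rightarrow> bool" where
  "positive_op a \<longleftrightarrow> selfadjoint_op a \<and> (\<forall>\<xi>. 0 \<le> Re (cinner (a \<xi>) \<xi>))"

definition projection_op :: "('a::complex_hilbert \<Rightarrow>\<^sub>L 'a) \<Rightarrow> bool" where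
  "projection_op p \<longleftrightarrow> selfadjoint_op p \<and> p o\<^sub>L p = p"

definition op_le :: "('a::complex_hilbert \<Rightarrow>\<^sub>L 'a) \<Rightarrow> ('a \<Rightarrow>\<^sub>L 'a) \<Rightarrow> bool" where
  "op_le a b \<longleftrightarrow> positive_op (b - a)"

section \<open>Von Neumann algebras\<close>

text \<open>
  A set \<open>M\<close> in \<^typ>\<open>'a \<Rightarrow>\<^sub>L 'a\<close> is a set of bounded real-linear operators; complex linearity
  is a separate requirement. The identity operator need not belong to \<open>M\<close>.
\<close>

definition cstar_subalgebra :: "('a::complex_hilbert \<Rightarrow>\<^sub>L 'a) set \<Rightarrow> bool" where
  "cstar_subalgebra M \<longleftrightarrow>
     (\<forall>a\<in>M. complex_linear_op a) \<and>
     0 \<in> M \<and> (\<forall>a\<in>M. \<forall>b\<in>M. a + b \<in> M) \<and> (\<forall>c. \<forall>a\<in>M. scaleC_op c a \<in> M) \<and>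
     (\<forall>a\<in>M. \<forall>b\<in>M. a o\<^sub>L b \<in> M) \<and>
     (\<forall>a\<in>M. \<exists>b\<in>M. is_adjoint b a) \<and>
     closed M"

definition von_neumann_algebra :: "('a::complex_hilbert \<Rightarrow>\<^sub>L 'a) set \<Rightarrow> bool" where
  "von_neumann_algebra M \<longleftrightarrow> cstar_subalgebra M \<and> closedin strong_operator_topology M"

definition sa_part :: "('a::complex_hilbert \<Rightarrow>\<^sub>L 'a) set \<Rightarrow> ('a \<Rightarrow>\<^sub>L 'a) set" where
  "sa_part M = {a \<in> M. selfadjoint_op a}"

definition pos_part :: "('a::complex_hilbert \<Rightarrow>\<^sub>L 'a) set \<Rightarrow> ('a \<Rightarrow>\<^sub>L 'a) set" where
  "pos_part M = {a \<in> M. positive_op a}"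

definition sa_unit_ball :: "('a::complex_hilbert \<Rightarrow>\<^sub>L 'a) set \<Rightarrow> ('a \<Rightarrow>\<^sub>L 'a) set" where
  "sa_unit_ball M = {a \<in> sa_part M. norm a \<le> 1}"

definition effects :: "('a::complex_hilbert \<Rightarrow>\<^sub>L 'a) set \<Rightarrow> ('a \<Rightarrow>\<^sub>L 'a) set" where
  "effects M = pos_part M \<inter> sa_unit_ball M"

definition projections :: "('a::complex_hilbert \<Rightarrow>\<^sub>L 'a) set \<Rightarrow> ('a \<Rightarrow>\<^sub>L 'a) set" where
  "projections M = {p \<in> M. projection_op p}"

section \<open>Spectral families and the spectral order\<close>

text \<open>
  \<open>E\<close> is the spectral family of \<open>x\<close>: an increasing, strongly right-continuous family of projections,
  equal to \<open>0\<close> below \<open>- norm x\<close> and to the identity from \<open>norm x\<close> on, such that \<open>x\<close> is the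
  Riemann--Stieltjes integral of \<open>\<mu>\<close> with respect to \<open>E\<close> in the operator norm. In the last clause,
  \<open>t 0 \<le> \<dots> \<le> t n\<close> is a partition with mesh below \<open>\<delta>\<close> of an interval containing
  \<open>[- norm x, norm x]\<close>, and \<open>s\<close> picks the intermediate points; \<open>t 0 < - norm x\<close> is strict because
  \<open>E\<close> may jump at \<open>- norm x\<close>.
\<close>

definition is_spectral_family ::
    "('a::complex_hilbert \<Rightarrow>\<^sub>L 'a) \<Rightarrow> (real \<Rightarrow> 'a \<Rightarrow>\<^sub>L 'a) \<Rightarrow> bool" where
  "is_spectral_family x E \<longleftrightarrow>
     (\<forall>\<mu>. projection_op (E \<mu>)) \<and>
     (\<forall>\<mu> \<nu>. \<mu> \<le> \<nu> \<longrightarrow> op_le (E \<mu>) (E \<nu>)) \<and>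
     (\<forall>\<mu> \<xi>. ((\<lambda>\<nu>. E \<nu> \<xi>) \<longlongrightarrow> E \<mu> \<xi>) (at_right \<mu>)) \<and>
     (\<forall>\<mu> < - norm x. E \<mu> = 0) \<and>
     (\<forall>\<mu> \<ge> norm x. E \<mu> = id_blinfun) \<and>
     (\<forall>\<epsilon>>0. \<exists>\<delta>>0. \<forall>n (t :: nat \<Rightarrow> real) (s :: nat \<Rightarrow> real).
        t 0 < - norm x \<and> norm x \<le> t n \<and>
        (\<forall>i<n. t i \<le> s i \<and> s i \<le> t (Suc i) \<and> t (Suc i) - t i < \<delta>) \<longrightarrow>
        norm (x - (\<Sum>i<n. s i *\<^sub>R (E (t (Suc i)) - E (t i)))) < \<epsilon>)"

text \<open>By the spectral theorem, a self-adjoint \<open>x\<close> has exactly one spectral family.\<close>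

definition spectral_family :: "('a::complex_hilbert \<Rightarrow>\<^sub>L 'a) \<Rightarrow> real \<Rightarrow> ('a \<Rightarrow>\<^sub>L 'a)" where
  "spectral_family x = (THE E. is_spectral_family x E)"

definition spectral_le :: "('a::complex_hilbert \<Rightarrow>\<^sub>L 'a) \<Rightarrow> ('a \<Rightarrow>\<^sub>L 'a) \<Rightarrow> bool" where
  "spectral_le x y \<longleftrightarrow> (\<forall>\<mu>. op_le (spectral_family y \<mu>) (spectral_family x \<mu>))"

definition spectral_poset :: "('a::complex_hilbert \<Rightarrow>\<^sub>L 'a) set \<Rightarrow> ('a \<Rightarrow>\<^sub>L 'a) gorder" where
  "spectral_poset S = \<lparr>carrier = S, eq = (=), le = spectral_le\<rparr>"

lemma op_le_refl: "op_le a a"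
proof -
  have "cinner 0 \<xi> = 0" for \<xi> :: 'a
    using cinner_add_left[of 0 0 \<xi>] by simp
  moreover from this have "cinner \<xi> 0 = 0" for \<xi> :: 'a
    using cinner_commute[of \<xi> 0] by simp
  ultimately show ?thesis
    by (simp add: op_le_def positive_op_def selfadjoint_op_def is_adjoint_def)
qed

lemma op_le_trans: "op_le a b \<Longrightarrow> op_le b c \<Longrightarrow> op_le a c"
proof -
  assume *: "op_le a b" "op_le b c"
  have eq: "(c - a) \<xi> = (c - b) \<xi> + (b - a) \<xi>" for \<xi>
    by (simp add: blinfun.diff_left)
  have add_right: "cinner \<xi> (\<eta> + \<zeta>) = cinner \<xi> \<eta> + cinner \<xi> \<zeta>" for \<xi> \<eta> \<zeta> :: 'a
    by (metis cinner_add_left cinner_commute complex_cnj_add)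
  have "cinner ((c - a) \<xi>) \<eta> = cinner \<xi> ((c - a) \<eta>)" for \<xi> \<eta>
    using * unfolding op_le_def positive_op_def selfadjoint_op_def is_adjoint_def
    by (simp only: eq cinner_add_left add_right)
  moreover have "0 \<le> Re (cinner ((c - a) \<xi>) \<xi>)" for \<xi>
    using * unfolding op_le_def positive_op_def
    by (simp only: eq cinner_add_left plus_complex.sel) (simp add: add_nonneg_nonneg)
  ultimately show ?thesis
    unfolding op_le_def positive_op_def selfadjoint_op_def is_adjoint_def by blast
qed

lemma spectral_le_refl: "spectral_le x x"
  by (simp add: spectral_le_def op_le_refl)

lemma spectral_le_trans: "spectral_le x y \<Longrightarrow> spectral_le y z \<Longrightarrow> spectral_le x z"
  unfolding spectral_le_def by (blast intro: op_le_trans)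

section \<open>Order convergence and the order topology\<close>

text \<open>Nets are functions on a nonempty set \<open>\<Lambda>\<close> directed by a preorder \<open>r\<close>.\<close>

definition directed_set :: "'i set \<Rightarrow> 'i rel \<Rightarrow> bool" where
  "directed_set \<Lambda> r \<longleftrightarrow> \<Lambda> \<noteq> {} \<and> preorder_on \<Lambda> r \<and>
     (\<forall>\<alpha>\<in>\<Lambda>. \<forall>\<beta>\<in>\<Lambda>. \<exists>\<gamma>\<in>\<Lambda>. (\<alpha>, \<gamma>) \<in> r \<and> (\<beta>, \<gamma>) \<in> r)"

lemma directed_setD:
  "directed_set \<Lambda> r \<Longrightarrow> \<alpha> \<in> \<Lambda> \<Longrightarrow> \<beta> \<in> \<Lambda> \<Longrightarrow> \<exists>\<gamma>\<in>\<Lambda>. (\<alpha>, \<gamma>) \<in> r \<and> (\<beta>, \<gamma>) \<in> r"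
  by (simp add: directed_set_def)

definition order_convergent ::
    "'p gorder \<Rightarrow> 'i set \<Rightarrow> 'i rel \<Rightarrow> ('i \<Rightarrow> 'p) \<Rightarrow> 'p \<Rightarrow> bool" where
  "order_convergent L \<Lambda> r x l \<longleftrightarrow>
     (\<exists>y z. (\<forall>\<alpha>\<in>\<Lambda>. y \<alpha> \<in> carrier L \<and> z \<alpha> \<in> carrier L) \<and>
        (\<forall>\<alpha>\<in>\<Lambda>. \<forall>\<beta>\<in>\<Lambda>. (\<alpha>, \<beta>) \<in> r \<longrightarrow> y \<alpha> \<sqsubseteq>\<^bsub>L\<^esub> y \<beta> \<and> z \<beta> \<sqsubseteq>\<^bsub>L\<^esub> z \<alpha>) \<and>
        (\<forall>\<alpha>\<in>\<Lambda>. y \<alpha> \<sqsubseteq>\<^bsub>L\<^esub> x \<alpha> \<and> x \<alpha> \<sqsubseteq>\<^bsub>L\<^esub> z \<alpha>) \<and>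
        is_lub L l (y ` \<Lambda>) \<and> is_glb L l (z ` \<Lambda>))"

text \<open>
  A definition cannot quantify over all index types, so nets are indexed by subsets of
  \<^typ>\<open>'p \<times> 'p \<times> 'p\<close>. This is no restriction: by \<open>order_closed_net\<close> below, an order closed set contains the
  order limits of its nets over arbitrary index types.
\<close>

definition order_closed :: "'p gorder \<Rightarrow> 'p set \<Rightarrow> bool" where
  "order_closed L M \<longleftrightarrow> M \<subseteq> carrier L \<and>
     \<not> (\<exists>(\<Lambda> :: ('p \<times> 'p \<times> 'p) set) r x l.
          directed_set \<Lambda> r \<and> x ` \<Lambda> \<subseteq> M \<and> l \<in> carrier L - M \<and> order_convergent L \<Lambda> r x l)"

lemma order_closedD:
  fixes \<Lambda> :: "('p \<times> 'p \<times> 'p) set" and L :: "'p gorder"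
  assumes "order_closed L M" "directed_set \<Lambda> r" "x ` \<Lambda> \<subseteq> M" "l \<in> carrier L"
    "order_convergent L \<Lambda> r x l"
  shows "l \<in> M"
  using assms unfolding order_closed_def by blast

lemma order_closed_net:
  fixes \<Lambda> :: "'i set" and L :: "'p gorder"
  assumes refl: "\<And>u. u \<in> carrier L \<Longrightarrow> u \<sqsubseteq>\<^bsub>L\<^esub> u"
    and trans: "\<And>u v w. u \<in> carrier L \<Longrightarrow> v \<in> carrier L \<Longrightarrow> w \<in> carrier L \<Longrightarrow>
                  u \<sqsubseteq>\<^bsub>L\<^esub> v \<Longrightarrow> v \<sqsubseteq>\<^bsub>L\<^esub> w \<Longrightarrow> u \<sqsubseteq>\<^bsub>L\<^esub> w"
    and M: "order_closed L M"
    and dir: "directed_set \<Lambda> r" and x: "x ` \<Lambda> \<subseteq> M"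
    and conv: "order_convergent L \<Lambda> r x l"
  shows "l \<in> M"
proof (rule ccontr)
  assume "l \<notin> M"
  from conv obtain y z where
    yz: "\<And>\<alpha>. \<alpha> \<in> \<Lambda> \<Longrightarrow> y \<alpha> \<in> carrier L \<and> z \<alpha> \<in> carrier L"
    and mono: "\<And>\<alpha> \<beta>. \<alpha> \<in> \<Lambda> \<Longrightarrow> \<beta> \<in> \<Lambda> \<Longrightarrow> (\<alpha>, \<beta>) \<in> r \<Longrightarrow> y \<alpha> \<sqsubseteq>\<^bsub>L\<^esub> y \<beta> \<and> z \<beta> \<sqsubseteq>\<^bsub>L\<^esub> z \<alpha>"
    and sandwich: "\<And>\<alpha>. \<alpha> \<in> \<Lambda> \<Longrightarrow> y \<alpha> \<sqsubseteq>\<^bsub>L\<^esub> x \<alpha> \<and> x \<alpha> \<sqsubseteq>\<^bsub>L\<^esub> z \<alpha>"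
    and sup: "is_lub L l (y ` \<Lambda>)" and inf: "is_glb L l (z ` \<Lambda>)"
    unfolding order_convergent_def by metis
  have l: "l \<in> carrier L"
    using sup by (auto simp: least_def Upper_def)
  define S where "S = (\<lambda>\<alpha>. (y \<alpha>, x \<alpha>, z \<alpha>)) ` \<Lambda>"
  define R where "R = {(p, q). p \<in> S \<and> q \<in> S \<and> fst p \<sqsubseteq>\<^bsub>L\<^esub> fst q \<and> snd (snd q) \<sqsubseteq>\<^bsub>L\<^esub> snd (snd p)}"
  have S_car: "fst p \<in> carrier L \<and> snd (snd p) \<in> carrier L" if "p \<in> S" for p
    using that yz by (auto simp: S_def)
  have "trans R"
  proof (rule transI)
    fix p q s assume "(p, q) \<in> R" "(q, s) \<in> R"
    then have "p \<in> S" "q \<in> S" "s \<in> S"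
      and 1: "fst p \<sqsubseteq>\<^bsub>L\<^esub> fst q" "fst q \<sqsubseteq>\<^bsub>L\<^esub> fst s"
      and 2: "snd (snd q) \<sqsubseteq>\<^bsub>L\<^esub> snd (snd p)" "snd (snd s) \<sqsubseteq>\<^bsub>L\<^esub> snd (snd q)"
      by (auto simp: R_def)
    with S_car trans[OF _ _ _ 1] trans[OF _ _ _ 2(2,1)] show "(p, s) \<in> R"
      by (auto simp: R_def)
  qed
  moreover have "refl_on S R"
    using S_car refl by (auto simp: refl_on_def R_def)
  moreover have "\<exists>c\<in>S. (a, c) \<in> R \<and> (b, c) \<in> R" if ab: "a \<in> S" "b \<in> S" for a b
  proof -
    obtain \<alpha> \<beta> where \<alpha>: "\<alpha> \<in> \<Lambda>" "a = (y \<alpha>, x \<alpha>, z \<alpha>)" and \<beta>: "\<beta> \<in> \<Lambda>" "b = (y \<beta>, x \<beta>, z \<beta>)"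
      using ab by (auto simp: S_def)
    obtain \<gamma> where \<gamma>: "\<gamma> \<in> \<Lambda>" "(\<alpha>, \<gamma>) \<in> r" "(\<beta>, \<gamma>) \<in> r"
      using dir \<alpha>(1) \<beta>(1) unfolding directed_set_def by blast
    have c: "(y \<gamma>, x \<gamma>, z \<gamma>) \<in> S"
      using \<gamma>(1) by (auto simp: S_def)
    show ?thesis
      by (rule bexI[OF _ c])
        (use c ab mono[OF \<alpha>(1) \<gamma>(1,2)] mono[OF \<beta>(1) \<gamma>(1,3)] \<alpha>(2) \<beta>(2) in \<open>auto simp: R_def\<close>)
  qed
  moreover have "S \<noteq> {}"
    using dir by (auto simp: S_def directed_set_def)
  moreover have "R \<subseteq> S \<times> S"
    by (auto simp: R_def)
  ultimately have "directed_set S R"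
    unfolding directed_set_def preorder_on_def by blast
  moreover have "(fst \<circ> snd) ` S \<subseteq> M"
    using x by (auto simp: S_def)
  moreover have "order_convergent L S R (fst \<circ> snd) l"
  proof -
    have "fst ` S = y ` \<Lambda>" "(snd \<circ> snd) ` S = z ` \<Lambda>"
      by (auto simp: S_def image_image)
    moreover have "fst p \<sqsubseteq>\<^bsub>L\<^esub> (fst \<circ> snd) p \<and> (fst \<circ> snd) p \<sqsubseteq>\<^bsub>L\<^esub> (snd \<circ> snd) p"
      if "p \<in> S" for p
      using that sandwich by (auto simp: S_def)
    moreover have "fst p \<sqsubseteq>\<^bsub>L\<^esub> fst q \<and> (snd \<circ> snd) q \<sqsubseteq>\<^bsub>L\<^esub> (snd \<circ> snd) p" if "(p, q) \<in> R" for p q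
      using that by (simp add: R_def)
    moreover have "fst p \<in> carrier L \<and> (snd \<circ> snd) p \<in> carrier L" if "p \<in> S" for p
      using S_car[OF that] by simp
    ultimately show ?thesis
      unfolding order_convergent_def using sup inf by metis
  qed
  ultimately show False
    using M l \<open>l \<notin> M\<close> unfolding order_closed_def by blast
qed

definition order_topology :: "'p gorder \<Rightarrow> 'p topology" where
  "order_topology L = topology (\<lambda>U. U \<subseteq> carrier L \<and> order_closed L (carrier L - U))"

lemma directed_set_cofinal:
  assumes dir: "directed_set \<Lambda> r" and A: "A \<subseteq> \<Lambda>"
    and cofinal: "\<And>\<alpha>. \<alpha> \<in> \<Lambda> \<Longrightarrow> \<exists>\<beta>\<in>A. (\<alpha>, \<beta>) \<in> r"
  shows "directed_set A (r \<inter> A \<times> A)"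
proof -
  have tr: "trans r" and rf: "refl_on \<Lambda> r" and ne: "\<Lambda> \<noteq> {}"
    using dir by (auto simp: directed_set_def preorder_on_def)
  have "\<exists>c\<in>A. (a, c) \<in> r \<and> (b, c) \<in> r" if ab: "a \<in> A" "b \<in> A" for a b
  proof -
    obtain \<gamma> where "\<gamma> \<in> \<Lambda>" "(a, \<gamma>) \<in> r" "(b, \<gamma>) \<in> r"
      using directed_setD[OF dir, of a b] ab A by blast
    moreover obtain c where "c \<in> A" "(\<gamma>, c) \<in> r"
      using cofinal \<open>\<gamma> \<in> \<Lambda>\<close> by blast
    ultimately show ?thesis
      using tr by (meson transD)
  qed
  moreover have "A \<noteq> {}"
    using ne cofinal by blast
  moreover have "refl_on A (r \<inter> A \<times> A)"
    using rf A by (auto simp: refl_on_def)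
  moreover have "trans (r \<inter> A \<times> A)"
    using tr by (auto simp: trans_def)
  ultimately show ?thesis
    unfolding directed_set_def preorder_on_def by blast
qed

lemma order_convergent_cofinal:
  assumes trans: "\<And>u v w. u \<in> carrier L \<Longrightarrow> v \<in> carrier L \<Longrightarrow> w \<in> carrier L \<Longrightarrow>
                  u \<sqsubseteq>\<^bsub>L\<^esub> v \<Longrightarrow> v \<sqsubseteq>\<^bsub>L\<^esub> w \<Longrightarrow> u \<sqsubseteq>\<^bsub>L\<^esub> w"
    and A: "A \<subseteq> \<Lambda>" and cofinal: "\<And>\<alpha>. \<alpha> \<in> \<Lambda> \<Longrightarrow> \<exists>\<beta>\<in>A. (\<alpha>, \<beta>) \<in> r"
    and conv: "order_convergent L \<Lambda> r x l"
  shows "order_convergent L A (r \<inter> A \<times> A) x l"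
proof -
  from conv obtain y z where
    yz: "\<And>\<alpha>. \<alpha> \<in> \<Lambda> \<Longrightarrow> y \<alpha> \<in> carrier L \<and> z \<alpha> \<in> carrier L"
    and mono: "\<And>\<alpha> \<beta>. \<alpha> \<in> \<Lambda> \<Longrightarrow> \<beta> \<in> \<Lambda> \<Longrightarrow> (\<alpha>, \<beta>) \<in> r \<Longrightarrow> y \<alpha> \<sqsubseteq>\<^bsub>L\<^esub> y \<beta> \<and> z \<beta> \<sqsubseteq>\<^bsub>L\<^esub> z \<alpha>"
    and sandwich: "\<And>\<alpha>. \<alpha> \<in> \<Lambda> \<Longrightarrow> y \<alpha> \<sqsubseteq>\<^bsub>L\<^esub> x \<alpha> \<and> x \<alpha> \<sqsubseteq>\<^bsub>L\<^esub> z \<alpha>"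
    and sup: "is_lub L l (y ` \<Lambda>)" and inf: "is_glb L l (z ` \<Lambda>)"
    unfolding order_convergent_def by metis
  have "Upper L (y ` A) \<subseteq> Upper L (y ` \<Lambda>)"
  proof
    fix u assume u: "u \<in> Upper L (y ` A)"
    have "y \<alpha> \<sqsubseteq>\<^bsub>L\<^esub> u" if \<alpha>: "\<alpha> \<in> \<Lambda>" for \<alpha>
    proof -
      obtain \<beta> where \<beta>: "\<beta> \<in> A" "(\<alpha>, \<beta>) \<in> r" using cofinal \<alpha> by blast
      then have "y \<alpha> \<sqsubseteq>\<^bsub>L\<^esub> y \<beta>" using mono \<alpha> A by blast
      moreover have "y \<beta> \<sqsubseteq>\<^bsub>L\<^esub> u" using u \<beta>(1) yz A by (auto simp: Upper_def)
      ultimately show ?thesis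
        using trans[of "y \<alpha>" "y \<beta>" u] yz \<alpha> \<beta>(1) A u by (auto simp: Upper_def)
    qed
    with u show "u \<in> Upper L (y ` \<Lambda>)" by (auto simp: Upper_def)
  qed
  moreover have "Upper L (y ` \<Lambda>) \<subseteq> Upper L (y ` A)"
    using A by (auto simp: Upper_def)
  moreover have "Lower L (z ` A) \<subseteq> Lower L (z ` \<Lambda>)"
  proof
    fix u assume u: "u \<in> Lower L (z ` A)"
    have "u \<sqsubseteq>\<^bsub>L\<^esub> z \<alpha>" if \<alpha>: "\<alpha> \<in> \<Lambda>" for \<alpha>
    proof -
      obtain \<beta> where \<beta>: "\<beta> \<in> A" "(\<alpha>, \<beta>) \<in> r" using cofinal \<alpha> by blast
      then have "z \<beta> \<sqsubseteq>\<^bsub>L\<^esub> z \<alpha>" using mono \<alpha> A by blast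
      moreover have "u \<sqsubseteq>\<^bsub>L\<^esub> z \<beta>" using u \<beta>(1) yz A by (auto simp: Lower_def)
      ultimately show ?thesis
        using trans[of u "z \<beta>" "z \<alpha>"] yz \<alpha> \<beta>(1) A u by (auto simp: Lower_def)
    qed
    with u show "u \<in> Lower L (z ` \<Lambda>)" by (auto simp: Lower_def)
  qed
  moreover have "Lower L (z ` \<Lambda>) \<subseteq> Lower L (z ` A)"
    using A by (auto simp: Lower_def)
  ultimately have "Upper L (y ` A) = Upper L (y ` \<Lambda>)" "Lower L (z ` A) = Lower L (z ` \<Lambda>)"
    by auto
  moreover have "\<alpha> \<in> \<Lambda>" if "\<alpha> \<in> A" for \<alpha>
    using that A by blast
  ultimately have "(\<forall>\<alpha>\<in>A. y \<alpha> \<in> carrier L \<and> z \<alpha> \<in> carrier L) \<and>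
      (\<forall>\<alpha>\<in>A. \<forall>\<beta>\<in>A. (\<alpha>, \<beta>) \<in> r \<inter> A \<times> A \<longrightarrow> y \<alpha> \<sqsubseteq>\<^bsub>L\<^esub> y \<beta> \<and> z \<beta> \<sqsubseteq>\<^bsub>L\<^esub> z \<alpha>) \<and>
      (\<forall>\<alpha>\<in>A. y \<alpha> \<sqsubseteq>\<^bsub>L\<^esub> x \<alpha> \<and> x \<alpha> \<sqsubseteq>\<^bsub>L\<^esub> z \<alpha>) \<and>
      is_lub L l (y ` A) \<and> is_glb L l (z ` A)"
    using yz mono sandwich sup inf by simp
  then show ?thesis
    unfolding order_convergent_def by blast
qed

lemma istopology_order:
  fixes L :: "'p gorder"
  assumes trans: "\<And>u v w. u \<in> carrier L \<Longrightarrow> v \<in> carrier L \<Longrightarrow> w \<in> carrier L \<Longrightarrow>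
                  u \<sqsubseteq>\<^bsub>L\<^esub> v \<Longrightarrow> v \<sqsubseteq>\<^bsub>L\<^esub> w \<Longrightarrow> u \<sqsubseteq>\<^bsub>L\<^esub> w"
  shows "istopology (\<lambda>U. U \<subseteq> carrier L \<and> order_closed L (carrier L - U))"
  unfolding istopology_def
proof (intro conjI allI impI)
  fix S T :: "'p set"
  assume S: "S \<subseteq> carrier L \<and> order_closed L (carrier L - S)"
    and T: "T \<subseteq> carrier L \<and> order_closed L (carrier L - T)"
  then show "S \<inter> T \<subseteq> carrier L" by blast
  show "order_closed L (carrier L - S \<inter> T)"
    unfolding order_closed_def
  proof (intro conjI notI)
    assume "\<exists>(\<Lambda> :: ('p \<times> 'p \<times> 'p) set) r x l. directed_set \<Lambda> r \<and> x ` \<Lambda> \<subseteq> carrier L - S \<inter> T \<and>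
              l \<in> carrier L - (carrier L - S \<inter> T) \<and> order_convergent L \<Lambda> r x l"
    then obtain \<Lambda> :: "('p \<times> 'p \<times> 'p) set" and r x l where
      dir: "directed_set \<Lambda> r" and x: "x ` \<Lambda> \<subseteq> carrier L - S \<inter> T"
      and l: "l \<in> carrier L" "l \<in> S" "l \<in> T" and conv: "order_convergent L \<Lambda> r x l"
      by blast
    have step: False
      if V: "order_closed L (carrier L - V)" "l \<in> V"
        and cof: "\<And>\<alpha>. \<alpha> \<in> \<Lambda> \<Longrightarrow> \<exists>\<beta>\<in>{\<beta> \<in> \<Lambda>. x \<beta> \<notin> V}. (\<alpha>, \<beta>) \<in> r" for V
    proof -
      let ?A = "{\<beta> \<in> \<Lambda>. x \<beta> \<notin> V}"
      have "directed_set ?A (r \<inter> ?A \<times> ?A)"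
        by (rule directed_set_cofinal[OF dir]) (use cof in auto)
      moreover have "order_convergent L ?A (r \<inter> ?A \<times> ?A) x l"
        by (rule order_convergent_cofinal[OF trans _ _ conv]) (use cof in auto)
      moreover have "x ` ?A \<subseteq> carrier L - V"
        using x by auto
      ultimately show False
        using V l(1) unfolding order_closed_def by blast
    qed
    show False
    proof (cases "\<forall>\<alpha>\<in>\<Lambda>. \<exists>\<beta>\<in>{\<beta> \<in> \<Lambda>. x \<beta> \<notin> S}. (\<alpha>, \<beta>) \<in> r")
      case True
      with step[of S] S l(2) show False by simp
    next
      case False
      then obtain \<alpha>0 where \<alpha>0: "\<alpha>0 \<in> \<Lambda>" "\<And>\<beta>. \<beta> \<in> \<Lambda> \<Longrightarrow> (\<alpha>0, \<beta>) \<in> r \<Longrightarrow> x \<beta> \<in> S"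
        by blast
      have "\<exists>\<beta>\<in>{\<beta> \<in> \<Lambda>. x \<beta> \<notin> T}. (\<alpha>, \<beta>) \<in> r" if \<alpha>: "\<alpha> \<in> \<Lambda>" for \<alpha>
      proof -
        obtain \<gamma> where "\<gamma> \<in> \<Lambda>" "(\<alpha>0, \<gamma>) \<in> r" "(\<alpha>, \<gamma>) \<in> r"
          using directed_setD[OF dir \<alpha>0(1) \<alpha>] by blast
        moreover from this have "x \<gamma> \<in> S" "x \<gamma> \<in> carrier L - S \<inter> T"
          using \<alpha>0(2) x by (simp, blast)
        ultimately show ?thesis by (intro bexI[of _ \<gamma>]) simp_all
      qed
      with step[of T] T l(3) show False by simp
    qed
  qed auto
next
  fix K :: "'p set set"
  assume K: "\<forall>U\<in>K. U \<subseteq> carrier L \<and> order_closed L (carrier L - U)"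
  then show "\<Union>K \<subseteq> carrier L" by blast
  show "order_closed L (carrier L - \<Union>K)"
    unfolding order_closed_def
  proof (intro conjI notI)
    assume "\<exists>(\<Lambda> :: ('p \<times> 'p \<times> 'p) set) r x l. directed_set \<Lambda> r \<and> x ` \<Lambda> \<subseteq> carrier L - \<Union>K \<and>
              l \<in> carrier L - (carrier L - \<Union>K) \<and> order_convergent L \<Lambda> r x l"
    then obtain \<Lambda> :: "('p \<times> 'p \<times> 'p) set" and r x l U where
      dir: "directed_set \<Lambda> r" and x: "x ` \<Lambda> \<subseteq> carrier L - \<Union>K" and l: "l \<in> carrier L"
      and U: "U \<in> K" "l \<in> U" and conv: "order_convergent L \<Lambda> r x l"
      by blast
    have "order_closed L (carrier L - U)"
      using K U(1) by simp
    moreover have "x ` \<Lambda> \<subseteq> carrier L - U"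
      using x U(1) by (meson Diff_mono Union_upper order_refl subset_trans)
    ultimately have "l \<in> carrier L - U"
      by (rule order_closedD[OF _ dir _ l conv])
    with U(2) show False by simp
  qed auto
qed

lemma openin_order_topology_spectral:
  "openin (order_topology (spectral_poset S)) U \<longleftrightarrow>
     U \<subseteq> S \<and> order_closed (spectral_poset S) (S - U)"
proof -
  have "istopology (\<lambda>U. U \<subseteq> carrier (spectral_poset S) \<and>
          order_closed (spectral_poset S) (carrier (spectral_poset S) - U))"
    by (rule istopology_order) (auto simp: spectral_poset_def intro: spectral_le_trans)
  from topology_inverse'[OF this] show ?thesis
    by (simp add: order_topology_def) (simp add: spectral_poset_def)
qed

abbreviation spectral_order_topology ::
    "('a::complex_hilbert \<Rightarrow>\<^sub>L 'a) set \<Rightarrow> ('a \<Rightarrow>\<^sub>L 'a) topology"  (\<open>\<tau>\<^sub>o\<close>) where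
  "\<tau>\<^sub>o S \<equiv> order_topology (spectral_poset S)"

end

theory Submission
  imports Defs
begin

text \<open>
  All the equalities come from one order-theoretic principle. Let \<open>X \<subseteq> S\<close> be sets of operators
  with the spectral order. Suppose that every element of \<open>S\<close> lying below some element of \<open>X\<close> has a
  least element of \<open>X\<close> above it, and dually. Then \<open>X\<close> inherits its own order topology from \<open>S\<close>. For
  the nets that enclose an order convergent net of \<open>X\<close> keep their supremum and infimum in \<open>S\<close>, because
  bounds in \<open>S\<close> can be improved to bounds in \<open>X\<close>; and if a net of \<open>X\<close> is squeezed in \<open>S\<close> between \<open>y\<close> and \<open>z\<close>, then it
  is also squeezed between the approximations of \<open>y\<close> from above and of \<open>z\<close> from below in \<open>X\<close>, which
  meet at the same limit. The limit coincides with its own least approximation, so it lies in \<open>X\<close>.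
  This is \<open>subtopology_spectral_order\<close>.

  The approximations are explicit. The positive part, the unit ball and the effects are cut out of
  \<open>sa_part M\<close> by inequalities \<open>a \<le> x\<close> and \<open>x \<le> b\<close> with \<open>a \<le> 0 \<le> b\<close>. The least \<open>v\<close> with \<open>a \<le> v\<close>
  above \<open>u\<close> is the truncation \<open>max u a\<close> in the sense of functional calculus, whose spectral family
  is that of \<open>u\<close> replaced by \<open>0\<close> to the left of \<open>a\<close>; dually for \<open>min u b\<close>. Between the projections
  and the effects, the least projection above an effect \<open>u\<close> is its range projection, and the greatest
  projection below \<open>u\<close> is the projection onto the eigenspace for the eigenvalue \<open>1\<close>. The remaining
  equalities in the theorem follow since a subspace of a subspace is a subspace.

  To make this precise one needs the spectral theorem, and one needs that the truncations and
  projections above belong to \<open>M\<close>. A symmetric operator \<open>c\<close> has an absolute value, the limit of an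
  iteration for the square root of \<open>c\<^sup>2\<close>, and the projection onto its kernel is a strong limit of powers
  of a contraction. Applied to \<open>\<bar>x - \<mu>\<bar> + (x - \<mu>)\<close> this produces the spectral projections \<open>E \<mu>\<close>. They lie
  in the strongly closed unital algebra generated by \<open>x\<close>, so they commute with everything that
  commutes with \<open>x\<close>, which gives uniqueness of the spectral family, and they multiply \<open>M\<close> into itself.
  As \<open>M\<close> may lack the identity, \<open>E \<mu>\<close> itself is in \<open>M\<close> for \<open>\<mu> < 0\<close>, but for \<open>\<mu> > 0\<close> it is only
  \<open>1 - E \<mu>\<close> that must be; this is where the conditions \<open>a \<le> 0 \<le> b\<close> enter.

  The family \<open>E\<close> is handled through the predicate \<open>resolves x E\<close>: the projections \<open>E \<mu>\<close> commute with
  \<open>x\<close>, increase right-continuously, and split the quadratic form of \<open>x\<close> at the level \<open>\<mu>\<close>. For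
  self-adjoint \<open>x\<close> exactly one family satisfies this, namely \<open>spectral_family x\<close>. Once this is
  known, the Riemann sums are used only to recover \<open>x\<close> from its family, which makes the spectral order
  antisymmetric.
  The operator theory uses only the real inner product; complex linearity is added at the end, as it
  is commutation with the complex scalars.
\<close>

section \<open>The order topology on a subset with least upper and greatest lower approximations\<close>

definition least_above :: "('a::complex_hilbert \<Rightarrow>\<^sub>L 'a) set \<Rightarrow> ('a \<Rightarrow>\<^sub>L 'a) \<Rightarrow> ('a \<Rightarrow>\<^sub>L 'a) \<Rightarrow> bool" where
  "least_above X u v \<longleftrightarrow> v \<in> X \<and> spectral_le u v \<and> (\<forall>x\<in>X. spectral_le u x \<longrightarrow> spectral_le v x)"

definition greatest_below :: "('a::complex_hilbert \<Rightarrow>\<^sub>L 'a) set \<Rightarrow> ('a \<Rightarrow>\<^sub>L 'a) \<Rightarrow> ('a \<Rightarrow>\<^sub>L 'a) \<Rightarrow> bool" where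
  "greatest_below X u v \<longleftrightarrow> v \<in> X \<and> spectral_le v u \<and> (\<forall>x\<in>X. spectral_le x u \<longrightarrow> spectral_le x v)"

text \<open>
  The two bounding nets \<open>y\<close> and \<open>z\<close> witnessing order convergence, written without order records.
\<close>

definition squeezes :: "('a::complex_hilbert \<Rightarrow>\<^sub>L 'a) set \<Rightarrow> 'i set \<Rightarrow> 'i rel \<Rightarrow> ('i \<Rightarrow> 'a \<Rightarrow>\<^sub>L 'a) \<Rightarrow>
    ('a \<Rightarrow>\<^sub>L 'a) \<Rightarrow> ('i \<Rightarrow> 'a \<Rightarrow>\<^sub>L 'a) \<Rightarrow> ('i \<Rightarrow> 'a \<Rightarrow>\<^sub>L 'a) \<Rightarrow> bool" where
  "squeezes S \<Lambda> r x l y z \<longleftrightarrow> l \<in> S \<and> (\<forall>\<alpha>\<in>\<Lambda>. y \<alpha> \<in> S \<and> z \<alpha> \<in> S) \<and>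
     (\<forall>\<alpha>\<in>\<Lambda>. \<forall>\<beta>\<in>\<Lambda>. (\<alpha>, \<beta>) \<in> r \<longrightarrow> spectral_le (y \<alpha>) (y \<beta>) \<and> spectral_le (z \<beta>) (z \<alpha>)) \<and>
     (\<forall>\<alpha>\<in>\<Lambda>. spectral_le (y \<alpha>) (x \<alpha>) \<and> spectral_le (x \<alpha>) (z \<alpha>)) \<and>
     (\<forall>\<alpha>\<in>\<Lambda>. spectral_le (y \<alpha>) l \<and> spectral_le l (z \<alpha>)) \<and>
     (\<forall>u\<in>S. (\<forall>\<alpha>\<in>\<Lambda>. spectral_le (y \<alpha>) u) \<longrightarrow> spectral_le l u) \<and>
     (\<forall>u\<in>S. (\<forall>\<alpha>\<in>\<Lambda>. spectral_le u (z \<alpha>)) \<longrightarrow> spectral_le u l)"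

lemma
  assumes "squeezes S \<Lambda> r x l y z"
  shows squeezes_limit: "l \<in> S"
    and squeezes_in: "\<alpha> \<in> \<Lambda> \<Longrightarrow> y \<alpha> \<in> S" "\<alpha> \<in> \<Lambda> \<Longrightarrow> z \<alpha> \<in> S"
    and squeezes_mono: "\<alpha> \<in> \<Lambda> \<Longrightarrow> \<beta> \<in> \<Lambda> \<Longrightarrow> (\<alpha>, \<beta>) \<in> r \<Longrightarrow> spectral_le (y \<alpha>) (y \<beta>)"
      "\<alpha> \<in> \<Lambda> \<Longrightarrow> \<beta> \<in> \<Lambda> \<Longrightarrow> (\<alpha>, \<beta>) \<in> r \<Longrightarrow> spectral_le (z \<beta>) (z \<alpha>)"
    and squeezes_net: "\<alpha> \<in> \<Lambda> \<Longrightarrow> spectral_le (y \<alpha>) (x \<alpha>)" "\<alpha> \<in> \<Lambda> \<Longrightarrow> spectral_le (x \<alpha>) (z \<alpha>)"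
    and squeezes_bound: "\<alpha> \<in> \<Lambda> \<Longrightarrow> spectral_le (y \<alpha>) l" "\<alpha> \<in> \<Lambda> \<Longrightarrow> spectral_le l (z \<alpha>)"
    and squeezes_sup: "u \<in> S \<Longrightarrow> (\<And>\<alpha>. \<alpha> \<in> \<Lambda> \<Longrightarrow> spectral_le (y \<alpha>) u) \<Longrightarrow> spectral_le l u"
    and squeezes_inf: "u \<in> S \<Longrightarrow> (\<And>\<alpha>. \<alpha> \<in> \<Lambda> \<Longrightarrow> spectral_le u (z \<alpha>)) \<Longrightarrow> spectral_le u l"
  using assms by (simp_all add: squeezes_def)

lemma squeezesI:
  assumes "l \<in> S" "\<And>\<alpha>. \<alpha> \<in> \<Lambda> \<Longrightarrow> y \<alpha> \<in> S" "\<And>\<alpha>. \<alpha> \<in> \<Lambda> \<Longrightarrow> z \<alpha> \<in> S"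
    and "\<And>\<alpha> \<beta>. \<alpha> \<in> \<Lambda> \<Longrightarrow> \<beta> \<in> \<Lambda> \<Longrightarrow> (\<alpha>, \<beta>) \<in> r \<Longrightarrow> spectral_le (y \<alpha>) (y \<beta>)"
    and "\<And>\<alpha> \<beta>. \<alpha> \<in> \<Lambda> \<Longrightarrow> \<beta> \<in> \<Lambda> \<Longrightarrow> (\<alpha>, \<beta>) \<in> r \<Longrightarrow> spectral_le (z \<beta>) (z \<alpha>)"
    and "\<And>\<alpha>. \<alpha> \<in> \<Lambda> \<Longrightarrow> spectral_le (y \<alpha>) (x \<alpha>)" "\<And>\<alpha>. \<alpha> \<in> \<Lambda> \<Longrightarrow> spectral_le (x \<alpha>) (z \<alpha>)"
    and "\<And>\<alpha>. \<alpha> \<in> \<Lambda> \<Longrightarrow> spectral_le (y \<alpha>) l" "\<And>\<alpha>. \<alpha> \<in> \<Lambda> \<Longrightarrow> spectral_le l (z \<alpha>)"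
    and "\<And>u. u \<in> S \<Longrightarrow> (\<And>\<alpha>. \<alpha> \<in> \<Lambda> \<Longrightarrow> spectral_le (y \<alpha>) u) \<Longrightarrow> spectral_le l u"
    and "\<And>u. u \<in> S \<Longrightarrow> (\<And>\<alpha>. \<alpha> \<in> \<Lambda> \<Longrightarrow> spectral_le u (z \<alpha>)) \<Longrightarrow> spectral_le u l"
  shows "squeezes S \<Lambda> r x l y z"
  using assms by (simp add: squeezes_def)

lemma order_convergent_spectral:
  "order_convergent (spectral_poset S) \<Lambda> r x l \<longleftrightarrow> (\<exists>y z. squeezes S \<Lambda> r x l y z)"
proof -
  have lub: "is_lub (spectral_poset S) l (f ` \<Lambda>) \<longleftrightarrow> l \<in> S \<and> (\<forall>\<alpha>\<in>\<Lambda>. spectral_le (f \<alpha>) l) \<and>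
      (\<forall>u\<in>S. (\<forall>\<alpha>\<in>\<Lambda>. spectral_le (f \<alpha>) u) \<longrightarrow> spectral_le l u)"
    and glb: "is_glb (spectral_poset S) l (f ` \<Lambda>) \<longleftrightarrow> l \<in> S \<and> (\<forall>\<alpha>\<in>\<Lambda>. spectral_le l (f \<alpha>)) \<and>
      (\<forall>u\<in>S. (\<forall>\<alpha>\<in>\<Lambda>. spectral_le u (f \<alpha>)) \<longrightarrow> spectral_le u l)"
    if "\<forall>\<alpha>\<in>\<Lambda>. f \<alpha> \<in> S" for f
    using that by (auto simp: least_def greatest_def Upper_def Lower_def spectral_poset_def)
  have car: "carrier (spectral_poset S) = S" and le: "le (spectral_poset S) = spectral_le"
    by (simp_all add: spectral_poset_def)
  show ?thesis
    unfolding order_convergent_def car le squeezes_def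
  proof (intro iff_exI)
    fix y z
    show "(\<forall>\<alpha>\<in>\<Lambda>. y \<alpha> \<in> S \<and> z \<alpha> \<in> S) \<and>
        (\<forall>\<alpha>\<in>\<Lambda>. \<forall>\<beta>\<in>\<Lambda>. (\<alpha>, \<beta>) \<in> r \<longrightarrow> spectral_le (y \<alpha>) (y \<beta>) \<and> spectral_le (z \<beta>) (z \<alpha>)) \<and>
        (\<forall>\<alpha>\<in>\<Lambda>. spectral_le (y \<alpha>) (x \<alpha>) \<and> spectral_le (x \<alpha>) (z \<alpha>)) \<and>
        is_lub (spectral_poset S) l (y ` \<Lambda>) \<and> is_glb (spectral_poset S) l (z ` \<Lambda>) \<longleftrightarrow>
      l \<in> S \<and> (\<forall>\<alpha>\<in>\<Lambda>. y \<alpha> \<in> S \<and> z \<alpha> \<in> S) \<and>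
        (\<forall>\<alpha>\<in>\<Lambda>. \<forall>\<beta>\<in>\<Lambda>. (\<alpha>, \<beta>) \<in> r \<longrightarrow> spectral_le (y \<alpha>) (y \<beta>) \<and> spectral_le (z \<beta>) (z \<alpha>)) \<and>
        (\<forall>\<alpha>\<in>\<Lambda>. spectral_le (y \<alpha>) (x \<alpha>) \<and> spectral_le (x \<alpha>) (z \<alpha>)) \<and>
        (\<forall>\<alpha>\<in>\<Lambda>. spectral_le (y \<alpha>) l \<and> spectral_le l (z \<alpha>)) \<and>
        (\<forall>u\<in>S. (\<forall>\<alpha>\<in>\<Lambda>. spectral_le (y \<alpha>) u) \<longrightarrow> spectral_le l u) \<and>
        (\<forall>u\<in>S. (\<forall>\<alpha>\<in>\<Lambda>. spectral_le u (z \<alpha>)) \<longrightarrow> spectral_le u l)"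
    proof (cases "\<forall>\<alpha>\<in>\<Lambda>. y \<alpha> \<in> S \<and> z \<alpha> \<in> S")
      case True
      then have "\<forall>\<alpha>\<in>\<Lambda>. y \<alpha> \<in> S" "\<forall>\<alpha>\<in>\<Lambda>. z \<alpha> \<in> S" by blast+
      with True show ?thesis
        unfolding lub[OF \<open>\<forall>\<alpha>\<in>\<Lambda>. y \<alpha> \<in> S\<close>] glb[OF \<open>\<forall>\<alpha>\<in>\<Lambda>. z \<alpha> \<in> S\<close>] ball_conj_distrib
        by argo
    qed argo
  qed
qed

text \<open>
  An upper bound \<open>u\<close> of the net \<open>y\<close> in \<open>S\<close> can be replaced by the greatest element of \<open>X\<close> below
  \<open>u\<close>, which is still an upper bound. So suprema and infima computed in \<open>X\<close> stay correct in \<open>S\<close>.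
\<close>

lemma order_convergent_mono:
  assumes sub: "X \<subseteq> S" and ne: "\<Lambda> \<noteq> {}"
    and up: "\<And>u x. u \<in> S \<Longrightarrow> x \<in> X \<Longrightarrow> spectral_le u x \<Longrightarrow> \<exists>v. least_above X u v"
    and down: "\<And>u x. u \<in> S \<Longrightarrow> x \<in> X \<Longrightarrow> spectral_le x u \<Longrightarrow> \<exists>v. greatest_below X u v"
    and conv: "order_convergent (spectral_poset X) \<Lambda> r x l"
  shows "order_convergent (spectral_poset S) \<Lambda> r x l"
proof -
  obtain y z where sq: "squeezes X \<Lambda> r x l y z"
    using conv unfolding order_convergent_spectral by blast
  note in_X = squeezes_limit[OF sq] squeezes_in[OF sq]
  have "squeezes S \<Lambda> r x l y z"
  proof (rule squeezesI)
    fix u assume u: "u \<in> S" and yu: "\<And>\<alpha>. \<alpha> \<in> \<Lambda> \<Longrightarrow> spectral_le (y \<alpha>) u"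
    obtain \<alpha> where \<alpha>: "\<alpha> \<in> \<Lambda>" using ne by blast
    obtain v where v: "greatest_below X u v"
      using down[OF u in_X(2)[OF \<alpha>] yu[OF \<alpha>]] by blast
    have "spectral_le l v"
    proof (rule squeezes_sup[OF sq])
      show "v \<in> X" using v by (simp add: greatest_below_def)
      show "spectral_le (y \<alpha>) v" if "\<alpha> \<in> \<Lambda>" for \<alpha>
        using v yu[OF that] in_X(2)[OF that] by (simp add: greatest_below_def)
    qed
    then show "spectral_le l u"
      using v spectral_le_trans unfolding greatest_below_def by blast
  next
    fix u assume u: "u \<in> S" and uz: "\<And>\<alpha>. \<alpha> \<in> \<Lambda> \<Longrightarrow> spectral_le u (z \<alpha>)"
    obtain \<alpha> where \<alpha>: "\<alpha> \<in> \<Lambda>" using ne by blast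
    obtain v where v: "least_above X u v"
      using up[OF u in_X(3)[OF \<alpha>] uz[OF \<alpha>]] by blast
    have "spectral_le v l"
    proof (rule squeezes_inf[OF sq])
      show "v \<in> X" using v by (simp add: least_above_def)
      show "spectral_le v (z \<alpha>)" if "\<alpha> \<in> \<Lambda>" for \<alpha>
        using v uz[OF that] in_X(3)[OF that] by (simp add: least_above_def)
    qed
    then show "spectral_le u l"
      using v spectral_le_trans unfolding least_above_def by blast
  qed (use in_X sub in \<open>simp_all add: squeezes_mono[OF sq] squeezes_net[OF sq]
      squeezes_bound[OF sq] subset_iff\<close>)
  then show ?thesis
    unfolding order_convergent_spectral by blast
qed

text \<open>
  The nets \<open>y\<close> and \<open>z\<close> are replaced by their approximations \<open>Y\<close> (from above) and \<open>Z\<close> (from below)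
  in \<open>X\<close>, which still enclose \<open>x\<close>. Since the index set is directed, every \<open>Y \<alpha>\<close> is below every
  \<open>Z \<beta>\<close>, which forces the limit into \<open>X\<close>.
\<close>

lemma order_convergent_restrict:
  assumes sub: "X \<subseteq> S" and dir: "directed_set \<Lambda> r"
    and antisym: "\<And>u v. u \<in> S \<Longrightarrow> v \<in> S \<Longrightarrow> spectral_le u v \<Longrightarrow> spectral_le v u \<Longrightarrow> u = v"
    and up: "\<And>u x. u \<in> S \<Longrightarrow> x \<in> X \<Longrightarrow> spectral_le u x \<Longrightarrow> \<exists>v. least_above X u v"
    and down: "\<And>u x. u \<in> S \<Longrightarrow> x \<in> X \<Longrightarrow> spectral_le x u \<Longrightarrow> \<exists>v. greatest_below X u v"
    and x: "x ` \<Lambda> \<subseteq> X" and conv: "order_convergent (spectral_poset S) \<Lambda> r x l"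
  shows "order_convergent (spectral_poset X) \<Lambda> r x l"
proof -
  note trans = spectral_le_trans
  obtain y z where sq: "squeezes S \<Lambda> r x l y z"
    using conv unfolding order_convergent_spectral by blast
  note l = squeezes_limit[OF sq]
  note mono = squeezes_mono[OF sq]
  note net = squeezes_net[OF sq]
  have x_in: "x \<alpha> \<in> X" if "\<alpha> \<in> \<Lambda>" for \<alpha>
    using x that by blast
  have "\<exists>v. least_above X (y \<alpha>) v" "\<exists>v. greatest_below X (z \<alpha>) v" if "\<alpha> \<in> \<Lambda>" for \<alpha>
    using up[OF squeezes_in(1)[OF sq] x_in net(1)] down[OF squeezes_in(2)[OF sq] x_in net(2)] that
    by blast+
  then obtain Y Z where YZ: "\<And>\<alpha>. \<alpha> \<in> \<Lambda> \<Longrightarrow> least_above X (y \<alpha>) (Y \<alpha>)"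
    "\<And>\<alpha>. \<alpha> \<in> \<Lambda> \<Longrightarrow> greatest_below X (z \<alpha>) (Z \<alpha>)"
    by metis
  have Y: "Y \<alpha> \<in> X" "spectral_le (y \<alpha>) (Y \<alpha>)" and Z: "Z \<alpha> \<in> X" "spectral_le (Z \<alpha>) (z \<alpha>)"
    if "\<alpha> \<in> \<Lambda>" for \<alpha>
    using YZ[OF that] by (auto simp: least_above_def greatest_below_def)
  have Y_least: "spectral_le (Y \<alpha>) v" if "\<alpha> \<in> \<Lambda>" "v \<in> X" "spectral_le (y \<alpha>) v" for \<alpha> v
    using YZ(1)[OF that(1)] that unfolding least_above_def by blast
  have Z_greatest: "spectral_le v (Z \<alpha>)" if "\<alpha> \<in> \<Lambda>" "v \<in> X" "spectral_le v (z \<alpha>)" for \<alpha> v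
    using YZ(2)[OF that(1)] that unfolding greatest_below_def by blast
  have Yx: "spectral_le (Y \<alpha>) (x \<alpha>)" and xZ: "spectral_le (x \<alpha>) (Z \<alpha>)" if "\<alpha> \<in> \<Lambda>" for \<alpha>
    using Y_least[OF that x_in[OF that] net(1)[OF that]]
      Z_greatest[OF that x_in[OF that] net(2)[OF that]] .
  have Y_mono: "spectral_le (Y \<alpha>) (Y \<beta>)" and Z_mono: "spectral_le (Z \<beta>) (Z \<alpha>)"
    if "\<alpha> \<in> \<Lambda>" "\<beta> \<in> \<Lambda>" "(\<alpha>, \<beta>) \<in> r" for \<alpha> \<beta>
    using Y_least[OF that(1) Y(1)[OF that(2)] trans[OF mono(1)[OF that] Y(2)[OF that(2)]]]
      Z_greatest[OF that(1) Z(1)[OF that(2)] trans[OF Z(2)[OF that(2)] mono(2)[OF that]]] .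
  have YZ_le: "spectral_le (Y \<alpha>) (Z \<beta>)" if \<alpha>\<beta>: "\<alpha> \<in> \<Lambda>" "\<beta> \<in> \<Lambda>" for \<alpha> \<beta>
  proof -
    obtain \<gamma> where \<gamma>: "\<gamma> \<in> \<Lambda>" "(\<alpha>, \<gamma>) \<in> r" "(\<beta>, \<gamma>) \<in> r"
      using directed_setD[OF dir \<alpha>\<beta>] by blast
    show ?thesis
      by (rule trans[OF trans[OF Y_mono[OF \<alpha>\<beta>(1) \<gamma>(1,2)] Yx[OF \<gamma>(1)]]
            trans[OF xZ[OF \<gamma>(1)] Z_mono[OF \<alpha>\<beta>(2) \<gamma>(1,3)]]])
  qed
  have sup: "spectral_le l v" if "v \<in> X" "\<And>\<alpha>. \<alpha> \<in> \<Lambda> \<Longrightarrow> spectral_le (Y \<alpha>) v" for v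
    using squeezes_sup[OF sq, of v] that sub trans[OF Y(2) that(2)] by blast
  have inf: "spectral_le v l" if "v \<in> X" "\<And>\<alpha>. \<alpha> \<in> \<Lambda> \<Longrightarrow> spectral_le v (Z \<alpha>)" for v
    using squeezes_inf[OF sq, of v] that sub trans[OF that(2) Z(2)] by blast
  \<comment> \<open>\<open>l\<close> lies below every \<open>Z \<beta>\<close>, so it has a least approximation \<open>m\<close> in \<open>X\<close> from above, and
    \<open>m\<close> is still below every \<open>Z \<beta>\<close>, hence below \<open>l\<close>.\<close>
  have lZ: "spectral_le l (Z \<beta>)" if "\<beta> \<in> \<Lambda>" for \<beta>
    using sup[OF Z(1)[OF that] YZ_le[OF _ that]] .
  obtain \<beta> where "\<beta> \<in> \<Lambda>"
    using dir by (auto simp: directed_set_def)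
  then obtain m where m: "least_above X l m"
    using up[OF l Z(1) lZ] by blast
  have "spectral_le m l"
  proof (rule inf)
    show "m \<in> X" using m by (simp add: least_above_def)
    show "spectral_le m (Z \<alpha>)" if "\<alpha> \<in> \<Lambda>" for \<alpha>
      using m Z(1)[OF that] lZ[OF that] by (simp add: least_above_def)
  qed
  then have "l = m"
    using antisym[of l m] m l sub unfolding least_above_def by blast
  then have lX: "l \<in> X"
    using m by (simp add: least_above_def)
  have Yl: "spectral_le (Y \<alpha>) l" if "\<alpha> \<in> \<Lambda>" for \<alpha>
    using Y_least[OF that lX squeezes_bound(1)[OF sq that]] .
  have "squeezes X \<Lambda> r x l Y Z"
    by (rule squeezesI; fact lX Y(1) Z(1) Y_mono Z_mono Yx xZ Yl lZ sup inf)
  then show ?thesis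
    unfolding order_convergent_spectral by blast
qed

theorem subtopology_spectral_order:
  assumes sub: "X \<subseteq> S"
    and antisym: "\<And>u v. u \<in> S \<Longrightarrow> v \<in> S \<Longrightarrow> spectral_le u v \<Longrightarrow> spectral_le v u \<Longrightarrow> u = v"
    and up: "\<And>u x. u \<in> S \<Longrightarrow> x \<in> X \<Longrightarrow> spectral_le u x \<Longrightarrow> \<exists>v. least_above X u v"
    and down: "\<And>u x. u \<in> S \<Longrightarrow> x \<in> X \<Longrightarrow> spectral_le x u \<Longrightarrow> \<exists>v. greatest_below X u v"
  shows "subtopology (\<tau>\<^sub>o S) X = \<tau>\<^sub>o X"
proof (rule topology_eq[THEN iffD2, rule_format])
  fix U
  have car: "carrier (spectral_poset T) = T" for T :: "('a \<Rightarrow>\<^sub>L 'a) set"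
    by (simp add: spectral_poset_def)
  have into_X: "order_closed (spectral_poset X) (F \<inter> X)" if F: "order_closed (spectral_poset S) F" for F
    unfolding order_closed_def
  proof (intro conjI notI)
    assume "\<exists>(\<Lambda> :: (('a \<Rightarrow>\<^sub>L 'a) \<times> ('a \<Rightarrow>\<^sub>L 'a) \<times> ('a \<Rightarrow>\<^sub>L 'a)) set) r x l. directed_set \<Lambda> r \<and>
      x ` \<Lambda> \<subseteq> F \<inter> X \<and> l \<in> carrier (spectral_poset X) - F \<inter> X \<and>
      order_convergent (spectral_poset X) \<Lambda> r x l"
    then obtain \<Lambda> :: "(('a \<Rightarrow>\<^sub>L 'a) \<times> ('a \<Rightarrow>\<^sub>L 'a) \<times> ('a \<Rightarrow>\<^sub>L 'a)) set" and r x l where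
      dir: "directed_set \<Lambda> r" and x: "x ` \<Lambda> \<subseteq> F" and l: "l \<in> X" "l \<notin> F"
      and conv: "order_convergent (spectral_poset X) \<Lambda> r x l"
      by (auto simp: car)
    have ne: "\<Lambda> \<noteq> {}"
      using dir by (simp add: directed_set_def)
    have "order_convergent (spectral_poset S) \<Lambda> r x l"
      by (rule order_convergent_mono[OF sub ne _ _ conv]; fact up down)
    then have "l \<in> F"
      using order_closedD[OF F dir x] l(1) sub by (auto simp: car)
    with l(2) show False by blast
  qed (simp add: car)
  have from_X: "order_closed (spectral_poset S) F" if F: "order_closed (spectral_poset X) F" for F
    unfolding order_closed_def
  proof (intro conjI notI)
    have FX: "F \<subseteq> X"
      using F by (simp add: order_closed_def car)
    then show "F \<subseteq> carrier (spectral_poset S)"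
      using sub by (simp add: car)
    assume "\<exists>(\<Lambda> :: (('a \<Rightarrow>\<^sub>L 'a) \<times> ('a \<Rightarrow>\<^sub>L 'a) \<times> ('a \<Rightarrow>\<^sub>L 'a)) set) r x l. directed_set \<Lambda> r \<and>
      x ` \<Lambda> \<subseteq> F \<and> l \<in> carrier (spectral_poset S) - F \<and> order_convergent (spectral_poset S) \<Lambda> r x l"
    then obtain \<Lambda> :: "(('a \<Rightarrow>\<^sub>L 'a) \<times> ('a \<Rightarrow>\<^sub>L 'a) \<times> ('a \<Rightarrow>\<^sub>L 'a)) set" and r x l where
      dir: "directed_set \<Lambda> r" and x: "x ` \<Lambda> \<subseteq> F" and l: "l \<notin> F"
      and conv: "order_convergent (spectral_poset S) \<Lambda> r x l"
      by blast
    have xX: "x ` \<Lambda> \<subseteq> X"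
      using x FX by blast
    have *: "order_convergent (spectral_poset X) \<Lambda> r x l"
      by (rule order_convergent_restrict[OF sub dir _ _ _ xX conv]; fact antisym up down)
    then have "l \<in> X"
      by (auto simp: order_convergent_spectral squeezes_def)
    then have "l \<in> F"
      using order_closedD[OF F dir x _ *] by (simp add: car)
    with l show False by blast
  qed
  show "openin (subtopology (\<tau>\<^sub>o S) X) U \<longleftrightarrow> openin (\<tau>\<^sub>o X) U"
  proof
    assume "openin (subtopology (\<tau>\<^sub>o S) X) U"
    then obtain T where T: "order_closed (spectral_poset S) (S - T)" "U = T \<inter> X"
      by (auto simp: openin_subtopology openin_order_topology_spectral)
    moreover have "(S - T) \<inter> X = X - U"
      using T(2) sub by blast
    ultimately show "openin (\<tau>\<^sub>o X) U"
      using into_X[OF T(1)] by (simp add: openin_order_topology_spectral)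
  next
    assume "openin (\<tau>\<^sub>o X) U"
    then have U: "U \<subseteq> X" "order_closed (spectral_poset X) (X - U)"
      by (simp_all add: openin_order_topology_spectral)
    have "S - (S - (X - U)) = X - U" "U = (S - (X - U)) \<inter> X"
      using U(1) sub by blast+
    then show "openin (subtopology (\<tau>\<^sub>o S) X) U"
      unfolding openin_subtopology openin_order_topology_spectral
      using from_X[OF U(2)] by (intro exI[of _ "S - (X - U)"]) auto
  qed
qed

section \<open>Symmetric operators on a real Hilbert space\<close>

definition symmetric_op :: "('a::real_inner \<Rightarrow>\<^sub>L 'a) \<Rightarrow> bool" where
  "symmetric_op a \<longleftrightarrow> (\<forall>\<xi> \<eta>. a \<xi> \<bullet> \<eta> = \<xi> \<bullet> a \<eta>)"

definition orth_projection :: "('a::real_inner \<Rightarrow>\<^sub>L 'a) \<Rightarrow> bool" where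
  "orth_projection p \<longleftrightarrow> symmetric_op p \<and> p o\<^sub>L p = p"

lemma symmetric_opD: "symmetric_op a \<Longrightarrow> a \<xi> \<bullet> \<eta> = \<xi> \<bullet> a \<eta>"
  by (simp add: symmetric_op_def)

lemma symmetric_op_id: "symmetric_op id_blinfun"
  by (simp add: symmetric_op_def)

lemma symmetric_op_0: "symmetric_op 0"
  by (simp add: symmetric_op_def)

lemma symmetric_op_add: "symmetric_op a \<Longrightarrow> symmetric_op b \<Longrightarrow> symmetric_op (a + b)"
  by (simp add: symmetric_op_def blinfun.add_left inner_add_left inner_add_right)

lemma symmetric_op_diff: "symmetric_op a \<Longrightarrow> symmetric_op b \<Longrightarrow> symmetric_op (a - b)"
  by (simp add: symmetric_op_def blinfun.diff_left inner_diff_left inner_diff_right)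

lemma symmetric_op_scaleR: "symmetric_op a \<Longrightarrow> symmetric_op (r *\<^sub>R a)"
  by (simp add: symmetric_op_def blinfun.scaleR_left)

lemma symmetric_op_compose:
  assumes "symmetric_op a" "symmetric_op b" "a o\<^sub>L b = b o\<^sub>L a"
  shows "symmetric_op (a o\<^sub>L b)"
  unfolding symmetric_op_def
proof (intro allI)
  fix \<xi> \<eta>
  have "(a o\<^sub>L b) \<xi> \<bullet> \<eta> = \<xi> \<bullet> (b o\<^sub>L a) \<eta>"
    using assms(1,2) by (simp add: symmetric_op_def)
  then show "(a o\<^sub>L b) \<xi> \<bullet> \<eta> = \<xi> \<bullet> (a o\<^sub>L b) \<eta>"
    by (simp only: assms(3))
qed

lemma commute_apply: "a o\<^sub>L b = b o\<^sub>L a \<Longrightarrow> a (b \<xi>) = b (a \<xi>)"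
  by (metis blinfun_apply_blinfun_compose)

lemma orth_projection_idem: "orth_projection p \<Longrightarrow> p (p \<xi>) = p \<xi>"
  unfolding orth_projection_def by (metis blinfun_apply_blinfun_compose)

lemma orth_projection_form: "orth_projection p \<Longrightarrow> p \<xi> \<bullet> \<xi> = p \<xi> \<bullet> p \<xi>"
  by (metis orth_projection_def orth_projection_idem symmetric_opD)

lemma orth_projection_norm: "orth_projection p \<Longrightarrow> norm (p \<xi>) \<le> norm \<xi>"
proof -
  assume "orth_projection p"
  then have "(norm (p \<xi>))\<^sup>2 \<le> norm (p \<xi>) * norm \<xi>"
    by (metis orth_projection_form norm_cauchy_schwarz power2_norm_eq_inner)
  then show ?thesis
    by (cases "p \<xi> = 0") (simp_all add: power2_eq_square)
qed

lemma orth_projection_form_le: "orth_projection p \<Longrightarrow> p \<xi> \<bullet> \<xi> \<le> \<xi> \<bullet> \<xi>"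
  by (simp add: orth_projection_form orth_projection_norm norm_le[symmetric])

lemma orth_projection_complement: "orth_projection p \<Longrightarrow> orth_projection (id_blinfun - p)"
  by (auto simp: orth_projection_def[of "id_blinfun - p"] orth_projection_idem blinfun.diff_left
      blinfun.diff_right orth_projection_def[THEN iffD1, THEN conjunct1]
      intro!: blinfun_eqI symmetric_op_diff symmetric_op_id)

text \<open>
  Polarization: \<open>4 (a \<xi> \<bullet> \<eta>)\<close> is the difference of the form at \<open>\<xi> + \<eta>\<close> and \<open>\<xi> - \<eta>\<close>. The vector \<open>\<eta>\<close>
  is \<open>a \<xi>\<close> rescaled to the length of \<open>\<xi>\<close>.
\<close>

lemma norm_le_of_form_le:
  assumes sym: "symmetric_op a" and c: "0 \<le> c"
    and form: "\<And>\<xi>. \<bar>a \<xi> \<bullet> \<xi>\<bar> \<le> c * (\<xi> \<bullet> \<xi>)"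
  shows "norm a \<le> c"
proof (rule norm_blinfun_bound[OF c])
  fix \<xi>
  show "norm (a \<xi>) \<le> c * norm \<xi>"
  proof (cases "a \<xi> = 0 \<or> \<xi> = 0")
    case True
    then show ?thesis using c by auto
  next
    case False
    define \<eta> where "\<eta> = (norm \<xi> / norm (a \<xi>)) *\<^sub>R a \<xi>"
    have n: "norm \<eta> = norm \<xi>"
      using False by (simp add: \<eta>_def)
    have ip: "a \<xi> \<bullet> \<eta> = norm \<xi> * norm (a \<xi>)"
      using False by (simp add: \<eta>_def dot_square_norm power2_eq_square)
    have "4 * (a \<xi> \<bullet> \<eta>) = a (\<xi> + \<eta>) \<bullet> (\<xi> + \<eta>) - a (\<xi> - \<eta>) \<bullet> (\<xi> - \<eta>)"
      using symmetric_opD[OF sym, of \<eta> \<xi>]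
      by (simp add: blinfun.add_right blinfun.diff_right inner_add_left inner_add_right
          inner_diff_left inner_diff_right inner_commute)
    also have "\<dots> \<le> c * ((\<xi> + \<eta>) \<bullet> (\<xi> + \<eta>)) + c * ((\<xi> - \<eta>) \<bullet> (\<xi> - \<eta>))"
      using form[of "\<xi> + \<eta>"] form[of "\<xi> - \<eta>"] by linarith
    also have "\<dots> = c * (2 * (\<xi> \<bullet> \<xi>) + 2 * (\<eta> \<bullet> \<eta>))"
      by (simp add: inner_add_left inner_add_right inner_diff_left inner_diff_right inner_commute
          algebra_simps)
    also have "\<dots> = 4 * (c * norm \<xi> * norm \<xi>)"
      by (simp add: dot_square_norm n power2_eq_square)
    finally have "norm \<xi> * norm (a \<xi>) \<le> norm \<xi> * (c * norm \<xi>)"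
      by (simp add: ip mult.commute mult.left_commute)
    then show ?thesis
      using False by simp
  qed
qed

text \<open>
  The form is nonnegative on the line \<open>\<xi> + s (a \<xi>)\<close>, where it is a quadratic polynomial in \<open>s\<close>
  without constant term and with linear coefficient \<open>2 \<parallel>a \<xi>\<parallel>\<^sup>2\<close>.
\<close>

lemma positive_form_kernel:
  assumes sym: "symmetric_op a" and pos: "\<And>\<xi>. 0 \<le> a \<xi> \<bullet> \<xi>" and zero: "a \<xi> \<bullet> \<xi> = 0"
  shows "a \<xi> = 0"
proof (rule ccontr)
  assume "a \<xi> \<noteq> 0"
  then have m: "0 < a \<xi> \<bullet> a \<xi>" by simp
  define m where "m = a \<xi> \<bullet> a \<xi>"
  define k where "k = a (a \<xi>) \<bullet> a \<xi>"
  have k: "0 \<le> k" unfolding k_def by (rule pos)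
  have quad: "0 \<le> 2 * s * m + s\<^sup>2 * k" for s
  proof -
    have "a (\<xi> + s *\<^sub>R a \<xi>) \<bullet> (\<xi> + s *\<^sub>R a \<xi>) = 2 * s * m + s\<^sup>2 * k"
      using symmetric_opD[OF sym, of "a \<xi>" \<xi>] zero
      by (simp add: blinfun.add_right blinfun.scaleR_right inner_add_left inner_add_right
          m_def k_def power2_eq_square algebra_simps)
    then show ?thesis using pos by metis
  qed
  define s where "s = - m / (1 + k)"
  have s: "s * (1 + k) = - m" "s < 0"
    using k m unfolding s_def m_def[symmetric] by (simp_all add: divide_neg_pos)
  have "2 * s * m + s\<^sup>2 * k = s * (m + (m + s * (1 + k)) - s)"
    by (simp add: algebra_simps power2_eq_square)
  also have "\<dots> = s * (m - s)"
    using s(1) by simp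
  also have "\<dots> < 0"
    using s(2) m unfolding m_def[symmetric] by (simp add: mult_neg_pos)
  finally show False
    using quad[of s] by linarith
qed

section \<open>Strongly closed operator algebras\<close>

text \<open>
  Closure under pointwise limits of sequences is all that the limit constructions below use of
  strong closedness. The identity is not required to be in \<open>A\<close>.
\<close>

definition strong_algebra :: "('a::real_normed_vector \<Rightarrow>\<^sub>L 'a) set \<Rightarrow> bool" where
  "strong_algebra A \<longleftrightarrow>
     (\<forall>a\<in>A. \<forall>b\<in>A. a + b \<in> A) \<and> (\<forall>r. \<forall>a\<in>A. r *\<^sub>R a \<in> A) \<and> (\<forall>a\<in>A. \<forall>b\<in>A. a o\<^sub>L b \<in> A) \<and>
     (\<forall>f a. range f \<subseteq> A \<and> (\<forall>\<xi>. (\<lambda>n::nat. blinfun_apply (f n) \<xi>) \<longlonglongrightarrow> blinfun_apply a \<xi>) \<longrightarrow> a \<in> A)"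

lemma
  fixes A :: "('a::real_normed_vector \<Rightarrow>\<^sub>L 'a) set"
  assumes "strong_algebra A"
  shows strong_algebra_add: "a \<in> A \<Longrightarrow> b \<in> A \<Longrightarrow> a + b \<in> A"
    and strong_algebra_scaleR: "a \<in> A \<Longrightarrow> r *\<^sub>R a \<in> A"
    and strong_algebra_compose: "a \<in> A \<Longrightarrow> b \<in> A \<Longrightarrow> a o\<^sub>L b \<in> A"
    and strong_algebra_limit: "(\<And>n. (f :: nat \<Rightarrow> 'a \<Rightarrow>\<^sub>L 'a) n \<in> A) \<Longrightarrow> (\<And>\<xi>. (\<lambda>n. f n \<xi>) \<longlonglongrightarrow> (a :: 'a \<Rightarrow>\<^sub>L 'a) \<xi>) \<Longrightarrow> a \<in> A"
proof -
  note A = assms[unfolded strong_algebra_def]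
  show "a \<in> A \<Longrightarrow> b \<in> A \<Longrightarrow> a + b \<in> A"
    using A[THEN conjunct1] by blast
  show "a \<in> A \<Longrightarrow> r *\<^sub>R a \<in> A"
    using A[THEN conjunct2, THEN conjunct1] by blast
  show "a \<in> A \<Longrightarrow> b \<in> A \<Longrightarrow> a o\<^sub>L b \<in> A"
    using A[THEN conjunct2, THEN conjunct2, THEN conjunct1] by blast
  show "(\<And>n. f n \<in> A) \<Longrightarrow> (\<And>\<xi>. (\<lambda>n. f n \<xi>) \<longlonglongrightarrow> a \<xi>) \<Longrightarrow> a \<in> A"
    using A[THEN conjunct2, THEN conjunct2, THEN conjunct2, rule_format, of f a] by blast
qed

lemma strong_algebra_diff: "strong_algebra A \<Longrightarrow> a \<in> A \<Longrightarrow> b \<in> A \<Longrightarrow> a - b \<in> A"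
  using strong_algebra_add[of A a "(-1) *\<^sub>R b"] strong_algebra_scaleR[of A b "-1"] by simp

lemma strong_algebraI:
  fixes A :: "('a::real_normed_vector \<Rightarrow>\<^sub>L 'a) set"
  assumes "\<And>a b. a \<in> A \<Longrightarrow> b \<in> A \<Longrightarrow> a + b \<in> A" "\<And>r a. a \<in> A \<Longrightarrow> r *\<^sub>R a \<in> A"
    and "\<And>a b. a \<in> A \<Longrightarrow> b \<in> A \<Longrightarrow> a o\<^sub>L b \<in> A"
    and "\<And>f a. (\<And>n::nat. f n \<in> A) \<Longrightarrow>
      (\<And>\<xi>. (\<lambda>n::nat. blinfun_apply (f n) \<xi>) \<longlonglongrightarrow> blinfun_apply a \<xi>) \<Longrightarrow> a \<in> A"
  shows "strong_algebra A"
  unfolding strong_algebra_def using assms(1-3) by (auto simp: image_subset_iff intro: assms(4))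

text \<open>
  Membership in this algebra is the record that is kept of every operator constructed from \<open>x\<close>:
  it yields symmetry, commutation with the commutant of \<open>x\<close>, and the multiplier property for
  any strongly closed algebra containing \<open>x\<close>.
\<close>

definition generated_algebra :: "('a::real_normed_vector \<Rightarrow>\<^sub>L 'a) \<Rightarrow> ('a \<Rightarrow>\<^sub>L 'a) set" where
  "generated_algebra x = \<Inter>{A. strong_algebra A \<and> id_blinfun \<in> A \<and> x \<in> A}"

lemma generated_algebra_least:
  "strong_algebra A \<Longrightarrow> id_blinfun \<in> A \<Longrightarrow> x \<in> A \<Longrightarrow> y \<in> generated_algebra x \<Longrightarrow> y \<in> A"
  by (auto simp: generated_algebra_def)

lemma strong_algebra_generated:
  fixes x :: "'a::real_normed_vector \<Rightarrow>\<^sub>L 'a"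
  shows "strong_algebra (generated_algebra x)"
proof (rule strong_algebraI)
  fix f :: "nat \<Rightarrow> 'a \<Rightarrow>\<^sub>L 'a" and a
  assume f: "f n \<in> generated_algebra x" and lim: "(\<lambda>n. f n \<xi>) \<longlonglongrightarrow> blinfun_apply a \<xi>" for n \<xi>
  have "a \<in> A" if A: "strong_algebra A" "id_blinfun \<in> A" "x \<in> A" for A
  proof (rule strong_algebra_limit[OF A(1) _ lim])
    show "f n \<in> A" for n
      using f[of n] A unfolding generated_algebra_def by simp
  qed
  then show "a \<in> generated_algebra x"
    by (simp add: generated_algebra_def)
qed (simp_all add: generated_algebra_def strong_algebra_add strong_algebra_scaleR
    strong_algebra_compose)

lemma generated_algebra_id: "id_blinfun \<in> generated_algebra x"
  by (auto simp: generated_algebra_def)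

lemma generated_algebra_self: "x \<in> generated_algebra x"
  by (auto simp: generated_algebra_def)

lemma generated_algebra_trans:
  "y \<in> generated_algebra x \<Longrightarrow> z \<in> generated_algebra y \<Longrightarrow> z \<in> generated_algebra x"
  by (rule generated_algebra_least[OF strong_algebra_generated generated_algebra_id])

lemma generated_algebra_commute:
  fixes x :: "'a::real_normed_vector \<Rightarrow>\<^sub>L 'a"
  assumes "t o\<^sub>L x = x o\<^sub>L t" and "y \<in> generated_algebra x"
  shows "t o\<^sub>L y = y o\<^sub>L t"
proof -
  let ?A = "{y. t o\<^sub>L y = y o\<^sub>L t}"
  have "strong_algebra ?A"
  proof (rule strong_algebraI)
    fix a b assume "a \<in> ?A" "b \<in> ?A"
    then show "a + b \<in> ?A" "a o\<^sub>L b \<in> ?A"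
      by (auto intro!: blinfun_eqI simp: blinfun.add_left blinfun.add_right commute_apply)
  next
    fix r a assume "a \<in> ?A"
    then show "r *\<^sub>R a \<in> ?A"
      by (auto intro!: blinfun_eqI simp: blinfun.scaleR_left blinfun.scaleR_right commute_apply)
  next
    fix f :: "nat \<Rightarrow> 'a \<Rightarrow>\<^sub>L 'a" and a :: "'a \<Rightarrow>\<^sub>L 'a"
    assume f: "f n \<in> ?A"
      and lim: "(\<lambda>n. f n \<xi>) \<longlonglongrightarrow> a \<xi>" for n \<xi>
    have "t (a \<xi>) = a (t \<xi>)" for \<xi>
    proof (rule LIMSEQ_unique)
      show "(\<lambda>n. t (f n \<xi>)) \<longlonglongrightarrow> t (a \<xi>)"
        by (intro bounded_linear.tendsto[OF blinfun.bounded_linear_right] lim)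
      have "t (f n \<xi>) = f n (t \<xi>)" for n
        using f by (intro commute_apply) simp
      then show "(\<lambda>n. t (f n \<xi>)) \<longlonglongrightarrow> a (t \<xi>)"
        using lim by simp
    qed
    then show "a \<in> ?A" by (auto intro!: blinfun_eqI)
  qed
  moreover have "id_blinfun \<in> ?A" by (auto intro!: blinfun_eqI)
  ultimately show ?thesis
    using generated_algebra_least[of ?A x y] assms by simp
qed

lemma generated_algebra_commute_self:
  "y \<in> generated_algebra x \<Longrightarrow> z \<in> generated_algebra x \<Longrightarrow> y o\<^sub>L z = z o\<^sub>L y"
  using generated_algebra_commute[of y x z] generated_algebra_commute[of x x y] by metis

lemma generated_algebra_symmetric:
  fixes x :: "'a::real_inner \<Rightarrow>\<^sub>L 'a"
  assumes "symmetric_op x" and "y \<in> generated_algebra x"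
  shows "symmetric_op y"
proof -
  let ?A = "{y \<in> generated_algebra x. symmetric_op y}"
  have "strong_algebra ?A"
  proof (rule strong_algebraI)
    fix a b assume "a \<in> ?A" "b \<in> ?A"
    then show "a + b \<in> ?A" "a o\<^sub>L b \<in> ?A"
      by (simp_all add: symmetric_op_add symmetric_op_compose generated_algebra_commute_self[of a x b]
          strong_algebra_add strong_algebra_compose strong_algebra_generated)
  next
    fix r a assume "a \<in> ?A"
    then show "r *\<^sub>R a \<in> ?A"
      by (simp add: symmetric_op_scaleR strong_algebra_scaleR strong_algebra_generated)
  next
    fix f :: "nat \<Rightarrow> 'a \<Rightarrow>\<^sub>L 'a" and a :: "'a \<Rightarrow>\<^sub>L 'a"
    assume f: "f n \<in> ?A"
      and lim: "(\<lambda>n. f n \<xi>) \<longlonglongrightarrow> a \<xi>" for n \<xi>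
    have "a \<xi> \<bullet> \<eta> = \<xi> \<bullet> a \<eta>" for \<xi> \<eta>
    proof (rule LIMSEQ_unique)
      show "(\<lambda>n. f n \<xi> \<bullet> \<eta>) \<longlonglongrightarrow> a \<xi> \<bullet> \<eta>"
        by (intro tendsto_inner tendsto_const lim)
      have "f n \<xi> \<bullet> \<eta> = \<xi> \<bullet> f n \<eta>" for n
        using f by (intro symmetric_opD) simp
      moreover have "(\<lambda>n. \<xi> \<bullet> f n \<eta>) \<longlonglongrightarrow> \<xi> \<bullet> a \<eta>"
        by (intro tendsto_inner tendsto_const lim)
      ultimately show "(\<lambda>n. f n \<xi> \<bullet> \<eta>) \<longlonglongrightarrow> \<xi> \<bullet> a \<eta>"
        by simp
    qed
    moreover have "a \<in> generated_algebra x"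
      by (rule strong_algebra_limit[OF strong_algebra_generated _ lim]) (use f in simp)
    ultimately show "a \<in> ?A" by (simp add: symmetric_op_def)
  qed
  then show ?thesis
    using generated_algebra_least[of ?A x y] assms
    by (simp add: symmetric_op_id generated_algebra_id generated_algebra_self)
qed

section \<open>Absolute values and kernel projections\<close>

text \<open>
  With \<open>r = id - s\<close> the equation says \<open>r\<^sup>2 = id - t\<close>, so this is a square root of \<open>id - t\<close>. The
  iteration \<open>S (n + 1) = (t + (S n)\<^sup>2) / 2\<close> is dominated by the same iteration \<open>\<sigma>\<close> for the number \<open>1\<close>
  in place of \<open>t\<close>: both \<open>\<parallel>S n\<parallel> \<le> \<sigma> n\<close> and \<open>\<parallel>S (n + 1) - S n\<parallel> \<le> \<sigma> (n + 1) - \<sigma> n\<close>. As \<open>\<sigma>\<close> is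
  increasing and bounded by \<open>1\<close>, the sequence \<open>S\<close> converges in norm.
\<close>

lemma contraction_square_root:
  fixes t :: "'a::{real_normed_vector,banach} \<Rightarrow>\<^sub>L 'a"
  assumes t: "norm t \<le> 1"
  shows "\<exists>s\<in>generated_algebra t. norm s \<le> 1 \<and> s + s = t + (s o\<^sub>L s)"
proof -
  define \<sigma> :: "nat \<Rightarrow> real" where "\<sigma> = rec_nat 0 (\<lambda>_ r. (1 + r\<^sup>2) / 2)"
  define S :: "nat \<Rightarrow> 'a \<Rightarrow>\<^sub>L 'a" where "S = rec_nat 0 (\<lambda>_ s. (1/2) *\<^sub>R (t + (s o\<^sub>L s)))"
  have \<sigma>: "\<sigma> 0 = 0" "\<And>n. \<sigma> (Suc n) = (1 + (\<sigma> n)\<^sup>2) / 2"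
    and S: "S 0 = 0" "\<And>n. S (Suc n) = (1/2) *\<^sub>R (t + (S n o\<^sub>L S n))"
    by (simp_all add: \<sigma>_def S_def)
  have \<sigma>01: "0 \<le> \<sigma> n \<and> \<sigma> n \<le> 1" for n
    by (induction n) (auto simp: \<sigma> power_le_one)
  have S_norm: "norm (S n) \<le> \<sigma> n" for n
  proof (induction n)
    case (Suc n)
    have "norm (t + (S n o\<^sub>L S n)) \<le> 1 + \<sigma> n * \<sigma> n"
      using norm_triangle_ineq[of t "S n o\<^sub>L S n"] t norm_blinfun_compose[of "S n" "S n"]
        mult_mono[OF Suc Suc] \<sigma>01[of n] by simp
    then show ?case by (simp add: S \<sigma> power2_eq_square)
  qed (simp add: S \<sigma>)
  have step: "norm (S (Suc n) - S n) \<le> \<sigma> (Suc n) - \<sigma> n" for n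
  proof (induction n)
    case 0
    show ?case using t by (simp add: S \<sigma>)
  next
    case (Suc n)
    let ?D = "S (Suc n) - S n"
    have "S (Suc (Suc n)) - S (Suc n) = (1/2) *\<^sub>R ((S (Suc n) o\<^sub>L S (Suc n)) - (S n o\<^sub>L S n))"
      by (subst S(2)[of "Suc n"], subst (3) S(2)[of n]) (simp add: scaleR_right_diff_distrib[symmetric])
    also have "(S (Suc n) o\<^sub>L S (Suc n)) - (S n o\<^sub>L S n) = (S (Suc n) o\<^sub>L ?D) + (?D o\<^sub>L S n)"
      by (rule blinfun_eqI) (simp add: blinfun.add_left blinfun.diff_left blinfun.diff_right)
    finally have "norm (S (Suc (Suc n)) - S (Suc n)) =
        norm ((S (Suc n) o\<^sub>L ?D) + (?D o\<^sub>L S n)) / 2"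
      by simp
    also have "\<dots> \<le> (norm (S (Suc n)) * norm ?D + norm ?D * norm (S n)) / 2"
      by (intro divide_right_mono order_trans[OF norm_triangle_ineq] add_mono norm_blinfun_compose)
        simp
    also have "\<dots> \<le> (\<sigma> (Suc n) * (\<sigma> (Suc n) - \<sigma> n) + (\<sigma> (Suc n) - \<sigma> n) * \<sigma> n) / 2"
      using mult_mono[OF S_norm[of "Suc n"] Suc] mult_mono[OF Suc S_norm[of n]] \<sigma>01
        order_trans[OF norm_ge_zero Suc] by simp
    also have "\<dots> = (1 + (\<sigma> (Suc n))\<^sup>2) / 2 - (1 + (\<sigma> n)\<^sup>2) / 2"
      by (simp add: field_simps power2_eq_square)
    also have "\<dots> = \<sigma> (Suc (Suc n)) - \<sigma> (Suc n)"
      by (simp only: \<sigma>(2))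
    finally show ?case .
  qed
  have "incseq \<sigma>"
    using order_trans[OF norm_ge_zero step] by (intro incseq_SucI) simp
  then obtain l where "\<sigma> \<longlonglongrightarrow> l"
    using \<sigma>01 incseq_convergent[of \<sigma> 1] by blast
  then have "summable (\<lambda>n. \<sigma> (Suc n) - \<sigma> n)"
    by (rule telescope_summable)
  then have "summable (\<lambda>n. S (Suc n) - S n)"
    by (rule summable_comparison_test[rotated]) (use step in blast)
  then obtain s where "(\<lambda>n. \<Sum>i<n. S (Suc i) - S i) \<longlonglongrightarrow> s"
    unfolding summable_def sums_def by blast
  then have lim: "S \<longlonglongrightarrow> s"
    by (simp add: sum_lessThan_telescope S(1))
  have "(\<lambda>n. (1/2) *\<^sub>R (t + (S n o\<^sub>L S n))) \<longlonglongrightarrow> (1/2) *\<^sub>R (t + (s o\<^sub>L s))"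
    by (intro tendsto_intros bounded_bilinear.tendsto[OF bounded_bilinear_blinfun_compose] lim)
  moreover have "(\<lambda>n. S (Suc n)) \<longlonglongrightarrow> s"
    using lim by (rule LIMSEQ_Suc)
  ultimately have "s = (1/2) *\<^sub>R (t + (s o\<^sub>L s))"
    unfolding S(2) using LIMSEQ_unique by blast
  then have "s + s = t + (s o\<^sub>L s)"
    by (metis scaleR_half_double scaleR_right_distrib)
  moreover have "norm s \<le> 1"
    using S_norm \<sigma>01 by (intro LIMSEQ_le_const2[OF tendsto_norm[OF lim]]) (meson order_trans)
  moreover have "s \<in> generated_algebra t"
  proof (rule strong_algebra_limit[OF strong_algebra_generated])
    show "S n \<in> generated_algebra t" for n
    proof (induction n)
      case 0
      then show ?case
        using strong_algebra_scaleR[OF strong_algebra_generated generated_algebra_id, of 0 t]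
        by (simp add: S)
    next
      case (Suc n)
      then show ?case
        unfolding S
        by (intro strong_algebra_scaleR strong_algebra_add strong_algebra_compose
            strong_algebra_generated generated_algebra_self)
    qed
    show "(\<lambda>n. S n \<xi>) \<longlonglongrightarrow> s \<xi>" for \<xi>
      by (intro blinfun.tendsto lim tendsto_const)
  qed
  ultimately show ?thesis by blast
qed

text \<open>
  Rescaling so that \<open>c\<close> has norm at most \<open>1\<close> puts \<open>t = id - c\<^sup>2 / K\<^sup>2\<close> between \<open>0\<close> and \<open>id\<close>. Square
  roots of \<open>c\<^sup>2\<close> and the kernel of \<open>c\<close> are both read off from \<open>t\<close>.
\<close>

lemma complementary_contraction:
  fixes c :: "'a::real_inner \<Rightarrow>\<^sub>L 'a"
  assumes c: "symmetric_op c"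
  obtains K t where "0 < K" "t = id_blinfun - (1 / K\<^sup>2) *\<^sub>R (c o\<^sub>L c)" "symmetric_op t"
    "norm t \<le> 1" "\<And>\<xi>. 0 \<le> t \<xi> \<bullet> \<xi>"
proof -
  define K where "K = norm c + 1"
  define t where "t = id_blinfun - (1 / K\<^sup>2) *\<^sub>R (c o\<^sub>L c)"
  have K: "0 < K" by (simp add: K_def add_nonneg_pos)
  have form: "t \<xi> \<bullet> \<xi> = \<xi> \<bullet> \<xi> - (c \<xi> \<bullet> c \<xi>) / K\<^sup>2" for \<xi>
    by (simp add: t_def blinfun.diff_left blinfun.scaleR_left inner_diff_left symmetric_opD[OF c])
  have bound: "(c \<xi> \<bullet> c \<xi>) / K\<^sup>2 \<le> \<xi> \<bullet> \<xi>" for \<xi>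
  proof -
    have "norm (c \<xi>) \<le> K * norm \<xi>"
      using norm_blinfun[of c \<xi>] norm_ge_zero[of \<xi>] unfolding K_def distrib_right by linarith
    then have "c \<xi> \<bullet> c \<xi> \<le> K\<^sup>2 * (\<xi> \<bullet> \<xi>)"
      using power_mono[of "norm (c \<xi>)" "K * norm \<xi>" 2] by (simp add: power_mult_distrib power2_norm_eq_inner)
    then show ?thesis
      using K by (simp add: divide_le_eq mult.commute)
  qed
  have sym: "symmetric_op t"
    unfolding t_def
    by (intro symmetric_op_diff symmetric_op_id symmetric_op_scaleR symmetric_op_compose c refl)
  have pos: "0 \<le> t \<xi> \<bullet> \<xi>" for \<xi>
    using bound form by simp
  have "norm t \<le> 1"
  proof (rule norm_le_of_form_le[OF sym])
    show "\<bar>t \<xi> \<bullet> \<xi>\<bar> \<le> 1 * (\<xi> \<bullet> \<xi>)" for \<xi>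
      using pos[of \<xi>] form[of \<xi>] by simp
  qed simp
  with that K t_def sym pos show thesis by blast
qed

lemma symmetric_op_abs:
  fixes c :: "'a::{real_inner,banach} \<Rightarrow>\<^sub>L 'a"
  assumes c: "symmetric_op c"
  shows "\<exists>b\<in>generated_algebra c. b o\<^sub>L b = c o\<^sub>L c \<and> (\<forall>\<xi>. 0 \<le> b \<xi> \<bullet> \<xi>)"
proof -
  obtain K t where K: "0 < K" and t_def: "t = id_blinfun - (1 / K\<^sup>2) *\<^sub>R (c o\<^sub>L c)"
    and t: "norm t \<le> 1"
    using complementary_contraction[OF c] by metis
  obtain s where s: "s \<in> generated_algebra t" "norm s \<le> 1" "s + s = t + (s o\<^sub>L s)"
    using contraction_square_root[OF t] by blast
  define b where "b = K *\<^sub>R (id_blinfun - s)"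
  have "t \<in> generated_algebra c"
    unfolding t_def
    by (intro strong_algebra_diff strong_algebra_scaleR strong_algebra_compose
        strong_algebra_generated generated_algebra_self generated_algebra_id)
  then have "s \<in> generated_algebra c"
    using s(1) generated_algebra_trans by blast
  then have "b \<in> generated_algebra c"
    unfolding b_def
    by (intro strong_algebra_diff strong_algebra_scaleR strong_algebra_generated
        generated_algebra_id)
  moreover have "b o\<^sub>L b = c o\<^sub>L c"
  proof (rule blinfun_eqI)
    fix \<xi>
    have ss: "s (s \<xi>) = s \<xi> + s \<xi> - t \<xi>"
      using arg_cong[OF s(3), of "\<lambda>a. blinfun_apply a \<xi>"] by (simp add: blinfun.add_left)
    have "b (b \<xi>) = K\<^sup>2 *\<^sub>R (\<xi> - s \<xi> - (s \<xi> - s (s \<xi>)))"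
      by (simp add: b_def blinfun.scaleR_left blinfun.diff_left blinfun.scaleR_right
          blinfun.diff_right power2_eq_square scaleR_right_diff_distrib)
    also have "\<dots> = K\<^sup>2 *\<^sub>R (\<xi> - t \<xi>)"
      by (simp add: ss)
    also have "\<dots> = c (c \<xi>)"
      using K by (simp add: t_def blinfun.scaleR_left blinfun.diff_left)
    finally show "(b o\<^sub>L b) \<xi> = (c o\<^sub>L c) \<xi>" by simp
  qed
  moreover have "0 \<le> b \<xi> \<bullet> \<xi>" for \<xi>
  proof -
    have "s \<xi> \<bullet> \<xi> \<le> norm (s \<xi>) * norm \<xi>"
      by (rule norm_cauchy_schwarz)
    also have "\<dots> \<le> (1 * norm \<xi>) * norm \<xi>"
      by (intro mult_right_mono order_trans[OF norm_blinfun] mult_right_mono s(2) norm_ge_zero)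
    also have "\<dots> = \<xi> \<bullet> \<xi>"
      by (simp add: dot_square_norm power2_eq_square)
    finally show ?thesis
      using K by (simp add: b_def blinfun.scaleR_left blinfun.diff_left inner_diff_left)
  qed
  ultimately show ?thesis by blast
qed

lemma pointwise_limit_operator:
  fixes f :: "nat \<Rightarrow> 'a::real_normed_vector \<Rightarrow>\<^sub>L 'a"
  assumes conv: "\<And>\<xi>. convergent (\<lambda>n. f n \<xi>)" and bound: "\<And>n \<xi>. norm (f n \<xi>) \<le> norm \<xi>"
  obtains p :: "'a \<Rightarrow>\<^sub>L 'a" where "\<And>\<xi>. (\<lambda>n. f n \<xi>) \<longlonglongrightarrow> p \<xi>"
proof -
  define g where "g \<xi> = lim (\<lambda>n. f n \<xi>)" for \<xi>
  have g: "(\<lambda>n. f n \<xi>) \<longlonglongrightarrow> g \<xi>" for \<xi>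
    unfolding g_def using conv by (simp add: convergent_LIMSEQ_iff)
  have "bounded_linear g"
  proof (rule bounded_linear_intro[where K = 1])
    show "g (\<xi> + \<eta>) = g \<xi> + g \<eta>" for \<xi> \<eta>
      by (rule LIMSEQ_unique[OF g]) (simp add: blinfun.add_right tendsto_add g)
    show "g (r *\<^sub>R \<xi>) = r *\<^sub>R g \<xi>" for r \<xi>
      by (rule LIMSEQ_unique[OF g]) (simp add: blinfun.scaleR_right tendsto_scaleR g)
    show "norm (g \<xi>) \<le> norm \<xi> * 1" for \<xi>
      using bound by (auto intro!: LIMSEQ_le_const2[OF tendsto_norm[OF g]])
  qed
  then have "blinfun_apply (Blinfun g) = g"
    by (rule bounded_linear_Blinfun_apply)
  with that[of "Blinfun g"] g show thesis by simp
qed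

text \<open>
  The even powers of \<open>t = id - a\<^sup>2 / K\<^sup>2\<close> converge strongly to the projection onto the fixed vectors of \<open>t\<close>,
  that is, onto the kernel of \<open>a\<close>: the numbers \<open>\<parallel>t\<^sup>n \<xi>\<parallel>\<^sup>2\<close> decrease, and they control the distance
  of any two of these powers. Moreover \<open>id - t\<^sup>n\<close> is a polynomial in \<open>a\<close> without constant term. Hence its
  values lie in the range of \<open>a\<close>, and its limit lies in every strongly closed algebra containing \<open>a\<close>,
  whether unital or not.
\<close>

lemma kernel_projection:
  fixes a :: "'a::{real_inner,banach} \<Rightarrow>\<^sub>L 'a"
  assumes a: "symmetric_op a"
  obtains p where "p \<in> generated_algebra a" "orth_projection p" "\<And>\<xi>. p \<xi> = \<xi> \<longleftrightarrow> a \<xi> = 0"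
    "\<And>\<xi>. \<xi> - p \<xi> \<in> closure (range a)" "\<And>A. strong_algebra A \<Longrightarrow> a \<in> A \<Longrightarrow> id_blinfun - p \<in> A"
proof -
  obtain K t where K: "0 < K" and t_def: "t = id_blinfun - (1 / K\<^sup>2) *\<^sub>R (a o\<^sub>L a)"
    and sym: "symmetric_op t" and t1: "norm t \<le> 1" and pos: "\<And>\<xi>. 0 \<le> t \<xi> \<bullet> \<xi>"
    using complementary_contraction[OF a] by metis
  have t_apply: "t \<xi> = \<xi> - (1 / K\<^sup>2) *\<^sub>R a (a \<xi>)" for \<xi>
    by (simp add: t_def blinfun.diff_left blinfun.scaleR_left)
  have contr: "norm (t \<xi>) \<le> norm \<xi>" for \<xi>
    using norm_blinfun[of t \<xi>] mult_right_mono[OF t1 norm_ge_zero[of \<xi>]] by simp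
  define P where "P = rec_nat id_blinfun (\<lambda>_ q. t o\<^sub>L q)"
  have P: "P 0 = id_blinfun" "\<And>n. P (Suc n) = t o\<^sub>L P n"
    by (simp_all add: P_def)
  have P_add: "P (m + n) \<xi> = P m (P n \<xi>)" for m n \<xi>
    by (induction m) (simp_all add: P)
  have P_sym: "P n \<xi> \<bullet> \<eta> = \<xi> \<bullet> P n \<eta>" for n \<xi> \<eta>
  proof (induction n arbitrary: \<xi> \<eta>)
    case (Suc n)
    have "P (Suc n) \<xi> \<bullet> \<eta> = \<xi> \<bullet> P n (t \<eta>)"
      by (simp add: P symmetric_opD[OF sym] Suc)
    also have "P n (t \<eta>) = P (Suc n) \<eta>"
      using P_add[of n 1 \<eta>] by (simp add: P)
    finally show ?case .
  qed (simp add: P)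
  have P_norm: "norm (P (m + n) \<xi>) \<le> norm (P n \<xi>)" for m n \<xi>
    by (induction m) (auto simp: P intro: order_trans[OF contr])
  have conv: "convergent (\<lambda>n. P (2 * n) \<xi>)" for \<xi>
  proof -
    define s where "s n = (norm (P n \<xi>))\<^sup>2" for n
    have ip: "P m \<xi> \<bullet> P n \<xi> = \<xi> \<bullet> P (m + n) \<xi>" for m n
      by (simp add: P_sym P_add)
    have s: "s n = \<xi> \<bullet> P (2 * n) \<xi>" for n
      using ip[of n n] by (simp add: s_def power2_norm_eq_inner mult_2)
    have dec: "s (m + n) \<le> s n" for m n
      unfolding s_def by (intro power_mono P_norm norm_ge_zero)
    have dist: "(norm (P (2 * m) \<xi> - P (2 * n) \<xi>))\<^sup>2 \<le> s (2 * n) - s (2 * m)" if "n \<le> m" for m n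
    proof -
      have "(norm (P (2 * m) \<xi> - P (2 * n) \<xi>))\<^sup>2 = s (2 * m) + s (2 * n) - 2 * s (m + n)"
        by (simp add: power2_norm_eq_inner inner_diff_left inner_diff_right ip s algebra_simps)
      moreover have "s (2 * m) \<le> s (m + n)"
        using dec[of "m - n" "m + n"] that by (simp add: mult_2)
      ultimately show ?thesis by simp
    qed
    have "decseq (\<lambda>n. s (2 * n))"
      using dec[of 2] by (intro decseq_SucI) simp
    then have "Cauchy (\<lambda>n. s (2 * n))"
      using decseq_convergent[of "\<lambda>n. s (2 * n)" 0]
      by (auto simp: s_def intro: LIMSEQ_imp_Cauchy)
    have "Cauchy (\<lambda>n. P (2 * n) \<xi>)"
      unfolding Cauchy_altdef2
    proof (intro allI impI)
      fix e :: real assume "0 < e"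
      then obtain N where N: "\<And>n. n \<ge> N \<Longrightarrow> dist (s (2 * n)) (s (2 * N)) < e\<^sup>2"
        using \<open>Cauchy (\<lambda>n. s (2 * n))\<close> unfolding Cauchy_altdef2 by (metis zero_less_power)
      have "dist (P (2 * n) \<xi>) (P (2 * N) \<xi>) < e" if "n \<ge> N" for n
      proof -
        have "(dist (P (2 * n) \<xi>) (P (2 * N) \<xi>))\<^sup>2 < e\<^sup>2"
          using dist[OF that] N[OF that] by (simp add: dist_norm)
        then show ?thesis using \<open>0 < e\<close> by (simp add: power_less_imp_less_base)
      qed
      then show "\<exists>N. \<forall>n\<ge>N. dist (P (2 * n) \<xi>) (P (2 * N) \<xi>) < e" by blast
    qed
    then show ?thesis by (simp add: Cauchy_convergent_iff)
  qed
  moreover have "norm (P (2 * n) \<xi>) \<le> norm \<xi>" for n \<xi>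
    using P_norm[of "2 * n" 0 \<xi>] by (simp add: P)
  ultimately obtain p :: "'a \<Rightarrow>\<^sub>L 'a" where p: "\<And>\<xi>. (\<lambda>n. P (2 * n) \<xi>) \<longlonglongrightarrow> p \<xi>"
    using pointwise_limit_operator[of "\<lambda>n. P (2 * n)"] by blast
  have ap: "a (p \<xi>) = 0" for \<xi>
  proof -
    have "(\<lambda>n. t (t (P (2 * n) \<xi>))) \<longlonglongrightarrow> t (t (p \<xi>))"
      by (intro bounded_linear.tendsto[OF blinfun.bounded_linear_right] p)
    moreover have "(\<lambda>n. t (t (P (2 * n) \<xi>))) \<longlonglongrightarrow> p \<xi>"
      using LIMSEQ_Suc[OF p[of \<xi>]] by (simp add: P)
    ultimately have tt: "t (t (p \<xi>)) = p \<xi>"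
      by (rule LIMSEQ_unique)
    define \<zeta> where "\<zeta> = p \<xi> - t (p \<xi>)"
    have "t \<zeta> = - \<zeta>"
      by (simp add: \<zeta>_def blinfun.diff_right tt)
    then have "\<zeta> \<bullet> \<zeta> \<le> 0"
      using pos[of \<zeta>] by simp
    then have "\<zeta> = 0"
      using inner_gt_zero_iff[of \<zeta>] by linarith
    then have "t (p \<xi>) = p \<xi>"
      by (simp add: \<zeta>_def)
    then have "a (a (p \<xi>)) = 0"
      using K by (simp add: t_apply)
    then have "a (p \<xi>) \<bullet> a (p \<xi>) = 0"
      by (simp add: symmetric_opD[OF a])
    then show ?thesis by simp
  qed
  have p_fix: "p \<xi> = \<xi>" if "a \<xi> = 0" for \<xi>
  proof -
    have "P n \<xi> = \<xi>" for n
      by (induction n) (simp_all add: P t_apply that blinfun.zero_right)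
    then show ?thesis
      using p[of \<xi>] by (simp add: LIMSEQ_const_iff)
  qed
  have ran: "\<xi> - P n \<xi> \<in> range a" for n \<xi>
  proof (induction n)
    case 0
    have "\<xi> - P 0 \<xi> = a 0"
      by (simp add: P blinfun.zero_right)
    then show ?case by (metis rangeI)
  next
    case (Suc n)
    then obtain \<eta> where "\<xi> - P n \<xi> = a \<eta>" by auto
    then have "\<xi> - P (Suc n) \<xi> = a (\<eta> + (1 / K\<^sup>2) *\<^sub>R a (P n \<xi>))"
      by (simp add: P t_apply blinfun.add_right blinfun.scaleR_right)
    then show ?case by blast
  qed
  have compl: "id_blinfun - p \<in> A" if A: "strong_algebra A" "a \<in> A" for A
  proof (rule strong_algebra_limit[OF A(1)])
    have "id_blinfun - P n \<in> A" for n
    proof (induction n)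
      case 0
      then show ?case using strong_algebra_scaleR[OF A, of 0] by (simp add: P)
    next
      case (Suc n)
      let ?c = "(1 / K\<^sup>2) *\<^sub>R (a o\<^sub>L a)"
      have eq: "id_blinfun - P (Suc n) = (id_blinfun - P n) + (?c - (?c o\<^sub>L (id_blinfun - P n)))"
        by (rule blinfun_eqI)
          (simp add: P t_apply blinfun.diff_left blinfun.add_left blinfun.scaleR_left
            blinfun.diff_right blinfun.scaleR_right algebra_simps)
      show ?case
        unfolding eq
        by (intro strong_algebra_add strong_algebra_diff strong_algebra_compose
            strong_algebra_scaleR A Suc)
    qed
    then show "id_blinfun - P (2 * n) \<in> A" for n .
    show "(\<lambda>n. (id_blinfun - P (2 * n)) \<xi>) \<longlonglongrightarrow> (id_blinfun - p) \<xi>" for \<xi>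
      by (simp add: blinfun.diff_left tendsto_diff p)
  qed
  have gen: "p \<in> generated_algebra a"
  proof -
    have "id_blinfun - (id_blinfun - p) \<in> generated_algebra a"
      by (intro strong_algebra_diff strong_algebra_generated generated_algebra_id compl
          generated_algebra_self)
    then show ?thesis by simp
  qed
  have "p o\<^sub>L p = p"
    by (rule blinfun_eqI) (simp add: p_fix ap)
  then have "orth_projection p"
    unfolding orth_projection_def using generated_algebra_symmetric[OF a gen] by simp
  moreover have "p \<xi> = \<xi> \<longleftrightarrow> a \<xi> = 0" for \<xi>
    using p_fix ap by metis
  moreover have "\<xi> - p \<xi> \<in> closure (range a)" for \<xi>
    unfolding closure_sequential
    using ran p by (intro exI[of _ "\<lambda>n. \<xi> - P (2 * n) \<xi>"]) (auto intro!: tendsto_diff)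
  ultimately show thesis
    using that gen compl by blast
qed

section \<open>The spectral theorem for symmetric operators\<close>

text \<open>
  With \<open>c = x - \<mu>\<close> and \<open>b = \<bar>c\<bar>\<close>, the projection \<open>e\<close> is the kernel projection of \<open>a = b + c\<close>, which is
  twice the positive part of \<open>c\<close>. On the kernel of \<open>a\<close> the operator \<open>c\<close> equals \<open>- b\<close>; as
  \<open>(b + c) (b - c) = 0\<close>, it equals \<open>b\<close> on the orthogonal complement. The last two conclusions are
  needed for the right-continuity of \<open>e\<close> in \<open>\<mu>\<close>.
\<close>

lemma spectral_cut:
  fixes x :: "'a::{real_inner,banach} \<Rightarrow>\<^sub>L 'a"
  assumes x: "symmetric_op x"
  obtains e a where "e \<in> generated_algebra x" "orth_projection e" "a \<in> generated_algebra x"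
    "\<And>\<xi>. e \<xi> = \<xi> \<Longrightarrow> x \<xi> \<bullet> \<xi> \<le> \<mu> * (\<xi> \<bullet> \<xi>)" "\<And>\<xi>. e \<xi> = 0 \<Longrightarrow> \<mu> * (\<xi> \<bullet> \<xi>) \<le> x \<xi> \<bullet> \<xi>"
    "\<And>\<xi>. e \<xi> = 0 \<Longrightarrow> a \<xi> = 2 *\<^sub>R (x \<xi> - \<mu> *\<^sub>R \<xi>)" "\<And>\<xi>. \<xi> - e \<xi> \<in> closure (range a)"
proof -
  define c where "c = x - \<mu> *\<^sub>R id_blinfun"
  have c_apply: "c \<xi> = x \<xi> - \<mu> *\<^sub>R \<xi>" for \<xi>
    by (simp add: c_def blinfun.diff_left blinfun.scaleR_left)
  have c_form: "c \<xi> \<bullet> \<xi> = x \<xi> \<bullet> \<xi> - \<mu> * (\<xi> \<bullet> \<xi>)" for \<xi>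
    by (simp add: c_apply inner_diff_left)
  have c_gen: "c \<in> generated_algebra x"
    unfolding c_def by (intro strong_algebra_diff strong_algebra_scaleR strong_algebra_generated
        generated_algebra_self generated_algebra_id)
  have c: "symmetric_op c"
    using generated_algebra_symmetric[OF x c_gen] .
  obtain b where b_gen: "b \<in> generated_algebra c" and bb: "b o\<^sub>L b = c o\<^sub>L c"
    and b_pos: "\<And>\<xi>. 0 \<le> b \<xi> \<bullet> \<xi>"
    using symmetric_op_abs[OF c] by blast
  have bc: "b (c \<xi>) = c (b \<xi>)" for \<xi>
    by (rule commute_apply[OF generated_algebra_commute_self[OF b_gen generated_algebra_self]])
  define a where "a = b + c"
  have a_gen: "a \<in> generated_algebra x"
    unfolding a_def
    by (intro strong_algebra_add strong_algebra_generated c_gen generated_algebra_trans[OF c_gen b_gen])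
  obtain e where e: "e \<in> generated_algebra a" "orth_projection e" "\<And>\<xi>. e \<xi> = \<xi> \<longleftrightarrow> a \<xi> = 0"
    "\<And>\<xi>. \<xi> - e \<xi> \<in> closure (range a)"
    using kernel_projection[OF generated_algebra_symmetric[OF x a_gen]] by metis
  have e_gen: "e \<in> generated_algebra x"
    using generated_algebra_trans[OF a_gen e(1)] .
  have upper: "x \<xi> \<bullet> \<xi> \<le> \<mu> * (\<xi> \<bullet> \<xi>)" if "e \<xi> = \<xi>" for \<xi>
  proof -
    have "b \<xi> + c \<xi> = 0"
      using that e(3) by (simp add: a_def blinfun.add_left)
    then have "b \<xi> \<bullet> \<xi> + c \<xi> \<bullet> \<xi> = 0"
      by (metis inner_add_left inner_zero_left)
    then show ?thesis
      using b_pos[of \<xi>] c_form[of \<xi>] by linarith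
  qed
  have eq: "b \<xi> = c \<xi>" if "e \<xi> = 0" for \<xi>
  proof -
    let ?\<zeta> = "b \<xi> - c \<xi>"
    have "a ?\<zeta> = (b o\<^sub>L b) \<xi> - (c o\<^sub>L c) \<xi>"
      by (simp add: a_def blinfun.add_left blinfun.diff_right bc)
    then have "e ?\<zeta> = ?\<zeta>"
      using e(3) bb by simp
    moreover have "e (b \<xi>) = b (e \<xi>)"
      by (intro commute_apply generated_algebra_commute_self[of _ x] e_gen
          generated_algebra_trans[OF c_gen b_gen])
    moreover have "e (c \<xi>) = c (e \<xi>)"
      by (intro commute_apply generated_algebra_commute_self[of _ x] e_gen c_gen)
    ultimately show ?thesis
      using that by (simp add: blinfun.diff_right)
  qed
  have lower: "\<mu> * (\<xi> \<bullet> \<xi>) \<le> x \<xi> \<bullet> \<xi>" if "e \<xi> = 0" for \<xi>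
    using b_pos[of \<xi>] c_form[of \<xi>] eq[OF that] by simp
  have diff: "a \<xi> = 2 *\<^sub>R (x \<xi> - \<mu> *\<^sub>R \<xi>)" if "e \<xi> = 0" for \<xi>
    using eq[OF that] by (simp add: a_def blinfun.add_left c_apply scaleR_2)
  show thesis
    by (rule that[OF e_gen e(2) a_gen upper lower diff e(4)])
qed

text \<open>
  A working form of the spectral family that avoids Riemann sums: \<open>x \<le> \<mu>\<close> on the range of \<open>E \<mu>\<close> and
  \<open>x \<ge> \<mu>\<close> on its orthogonal complement.
\<close>

definition resolves :: "('a::real_inner \<Rightarrow>\<^sub>L 'a) \<Rightarrow> (real \<Rightarrow> 'a \<Rightarrow>\<^sub>L 'a) \<Rightarrow> bool" where
  "resolves x E \<longleftrightarrow> (\<forall>\<mu>. orth_projection (E \<mu>)) \<and> (\<forall>\<mu>. x o\<^sub>L E \<mu> = E \<mu> o\<^sub>L x) \<and>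
     (\<forall>\<mu> \<nu> \<xi>. \<mu> \<le> \<nu> \<longrightarrow> E \<nu> (E \<mu> \<xi>) = E \<mu> \<xi>) \<and>
     (\<forall>\<mu> \<xi>. ((\<lambda>\<nu>. E \<nu> \<xi>) \<longlongrightarrow> E \<mu> \<xi>) (at_right \<mu>)) \<and>
     (\<forall>\<mu> \<xi>. E \<mu> \<xi> = \<xi> \<longrightarrow> x \<xi> \<bullet> \<xi> \<le> \<mu> * (\<xi> \<bullet> \<xi>)) \<and>
     (\<forall>\<mu> \<xi>. E \<mu> \<xi> = 0 \<longrightarrow> \<mu> * (\<xi> \<bullet> \<xi>) \<le> x \<xi> \<bullet> \<xi>)"

lemma
  assumes "resolves x E"
  shows resolves_projection: "orth_projection (E \<mu>)"
    and resolves_commute: "x o\<^sub>L E \<mu> = E \<mu> o\<^sub>L x"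
    and resolves_mono: "\<mu> \<le> \<nu> \<Longrightarrow> E \<nu> (E \<mu> \<xi>) = E \<mu> \<xi>"
    and resolves_continuous: "((\<lambda>\<nu>. E \<nu> \<xi>) \<longlongrightarrow> E \<mu> \<xi>) (at_right \<mu>)"
    and resolves_upper: "E \<mu> \<xi> = \<xi> \<Longrightarrow> x \<xi> \<bullet> \<xi> \<le> \<mu> * (\<xi> \<bullet> \<xi>)"
    and resolves_lower: "E \<mu> \<xi> = 0 \<Longrightarrow> \<mu> * (\<xi> \<bullet> \<xi>) \<le> x \<xi> \<bullet> \<xi>"
  using assms by (simp_all add: resolves_def)

lemma resolvesI:
  assumes "\<And>\<mu>. orth_projection (E \<mu>)" "\<And>\<mu>. x o\<^sub>L E \<mu> = E \<mu> o\<^sub>L x"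
    and "\<And>\<mu> \<nu> \<xi>. \<mu> \<le> \<nu> \<Longrightarrow> E \<nu> (E \<mu> \<xi>) = E \<mu> \<xi>"
    and "\<And>\<mu> \<xi>. ((\<lambda>\<nu>. E \<nu> \<xi>) \<longlongrightarrow> E \<mu> \<xi>) (at_right \<mu>)"
    and "\<And>\<mu> \<xi>. E \<mu> \<xi> = \<xi> \<Longrightarrow> x \<xi> \<bullet> \<xi> \<le> \<mu> * (\<xi> \<bullet> \<xi>)"
    and "\<And>\<mu> \<xi>. E \<mu> \<xi> = 0 \<Longrightarrow> \<mu> * (\<xi> \<bullet> \<xi>) \<le> x \<xi> \<bullet> \<xi>"
  shows "resolves x E"
  using assms by (simp add: resolves_def)

lemma orth_projection_absorb:
  assumes p: "orth_projection p" and q: "orth_projection q" and qp: "\<And>\<xi>. q (p \<xi>) = p \<xi>"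
  shows "p (q \<xi>) = p \<xi>"
proof -
  have "p (q \<xi>) \<bullet> \<eta> = p \<xi> \<bullet> \<eta>" for \<eta>
    using p q qp[of \<eta>] by (metis orth_projection_def symmetric_opD)
  then have "(p (q \<xi>) - p \<xi>) \<bullet> (p (q \<xi>) - p \<xi>) = 0"
    by (simp add: inner_diff_left)
  then show ?thesis by simp
qed

lemma resolves_mono': "resolves x E \<Longrightarrow> \<mu> \<le> \<nu> \<Longrightarrow> E \<mu> (E \<nu> \<xi>) = E \<mu> \<xi>"
  by (rule orth_projection_absorb) (simp_all add: resolves_projection resolves_mono)

lemma resolves_fixed_mono: "resolves x E \<Longrightarrow> \<mu> \<le> \<nu> \<Longrightarrow> E \<mu> \<xi> = \<xi> \<Longrightarrow> E \<nu> \<xi> = \<xi>"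
  by (metis resolves_mono)

lemma resolves_zero_mono: "resolves x E \<Longrightarrow> \<mu> \<le> \<nu> \<Longrightarrow> E \<nu> \<xi> = 0 \<Longrightarrow> E \<mu> \<xi> = 0"
  by (metis resolves_mono' blinfun.zero_right)

text \<open>
  On such a vector the form of \<open>x\<close> would be at least \<open>\<mu>\<close> and at most \<open>\<nu> < \<mu>\<close>. Using two different
  families for the same \<open>x\<close>, this compares them and gives uniqueness.
\<close>

lemma resolves_apart:
  assumes "resolves x E" "resolves x F" and "\<nu> < \<mu>" and "E \<mu> \<xi> = 0" "F \<nu> \<xi> = \<xi>"
  shows "\<xi> = 0"
proof (rule ccontr)
  assume "\<xi> \<noteq> 0"
  then have "\<nu> * (\<xi> \<bullet> \<xi>) < \<mu> * (\<xi> \<bullet> \<xi>)"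
    using assms(3) by simp
  then show False
    using resolves_lower[OF assms(1,4)] resolves_upper[OF assms(2,5)] by linarith
qed

text \<open>
  The cuts of \<open>spectral_cut\<close> at the various levels commute, which together with the form bounds gives
  monotonicity. For right-continuity, the increment \<open>D = E \<nu> - E \<mu>\<close> vanishes on the range of \<open>E \<mu>\<close>, and the
  vectors \<open>A \<mu> \<eta>\<close> approximate every vector of the complement; on these \<open>D\<close> commutes past \<open>A \<mu>\<close> and
  \<open>A \<mu> = 2 (x - \<mu>)\<close> has norm at most \<open>2 (\<nu> - \<mu>)\<close> on the range of \<open>D\<close>.
\<close>

theorem resolves_exists:
  fixes x :: "'a::{real_inner,banach} \<Rightarrow>\<^sub>L 'a"
  assumes x: "symmetric_op x"
  obtains E where "resolves x E" "\<And>\<mu>. E \<mu> \<in> generated_algebra x"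
proof -
  have "\<exists>e a. e \<in> generated_algebra x \<and> orth_projection e \<and> a \<in> generated_algebra x \<and>
      (\<forall>\<xi>. e \<xi> = \<xi> \<longrightarrow> x \<xi> \<bullet> \<xi> \<le> \<mu> * (\<xi> \<bullet> \<xi>)) \<and> (\<forall>\<xi>. e \<xi> = 0 \<longrightarrow> \<mu> * (\<xi> \<bullet> \<xi>) \<le> x \<xi> \<bullet> \<xi>) \<and>
      (\<forall>\<xi>. e \<xi> = 0 \<longrightarrow> a \<xi> = 2 *\<^sub>R (x \<xi> - \<mu> *\<^sub>R \<xi>)) \<and> (\<forall>\<xi>. \<xi> - e \<xi> \<in> closure (range a))"
    for \<mu>
    by (rule spectral_cut[OF x, of \<mu>]) blast
  then obtain E A where gen: "\<And>\<mu>. E \<mu> \<in> generated_algebra x" and proj: "\<And>\<mu>. orth_projection (E \<mu>)"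
    and A_gen: "\<And>\<mu>. A \<mu> \<in> generated_algebra x"
    and upper: "\<And>\<mu> \<xi>. E \<mu> \<xi> = \<xi> \<Longrightarrow> x \<xi> \<bullet> \<xi> \<le> \<mu> * (\<xi> \<bullet> \<xi>)"
    and lower: "\<And>\<mu> \<xi>. E \<mu> \<xi> = 0 \<Longrightarrow> \<mu> * (\<xi> \<bullet> \<xi>) \<le> x \<xi> \<bullet> \<xi>"
    and A: "\<And>\<mu> \<xi>. E \<mu> \<xi> = 0 \<Longrightarrow> A \<mu> \<xi> = 2 *\<^sub>R (x \<xi> - \<mu> *\<^sub>R \<xi>)"
    and dense: "\<And>\<mu> \<xi>. \<xi> - E \<mu> \<xi> \<in> closure (range (A \<mu>))"
    by metis
  have comm: "E \<mu> (E \<nu> \<xi>) = E \<nu> (E \<mu> \<xi>)" for \<mu> \<nu> \<xi>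
    by (intro commute_apply generated_algebra_commute_self[of _ x] gen)
  have idem: "E \<mu> (E \<mu> \<xi>) = E \<mu> \<xi>" for \<mu> \<xi>
    using proj by (rule orth_projection_idem)
  have xE: "x o\<^sub>L E \<mu> = E \<mu> o\<^sub>L x" for \<mu>
    by (intro generated_algebra_commute_self[of _ x] generated_algebra_self gen)
  have mono: "E \<nu> (E \<mu> \<xi>) = E \<mu> \<xi>" if "\<mu> \<le> \<nu>" for \<mu> \<nu> \<xi>
  proof (cases "\<mu> = \<nu>")
    case False
    define \<zeta> where "\<zeta> = E \<mu> \<xi> - E \<nu> (E \<mu> \<xi>)"
    have "E \<mu> \<zeta> = \<zeta>" "E \<nu> \<zeta> = 0"
      by (simp_all add: \<zeta>_def blinfun.diff_right idem comm[of \<mu> \<nu>])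
    then have "\<nu> * (\<zeta> \<bullet> \<zeta>) \<le> \<mu> * (\<zeta> \<bullet> \<zeta>)"
      using upper lower order_trans by blast
    then have "\<not> 0 < \<zeta> \<bullet> \<zeta>"
      using False that by (simp add: mult_le_cancel_right)
    then have "\<zeta> = 0" by simp
    then show ?thesis by (simp add: \<zeta>_def)
  qed (simp add: idem)
  have mono': "E \<mu> (E \<nu> \<xi>) = E \<mu> \<xi>" if "\<mu> \<le> \<nu>" for \<mu> \<nu> \<xi>
    using mono[OF that] comm by metis
  have cont: "((\<lambda>\<nu>. E \<nu> \<xi>) \<longlongrightarrow> E \<mu> \<xi>) (at_right \<mu>)" for \<mu> \<xi>
  proof (rule tendstoI)
    fix \<epsilon> :: real assume "0 < \<epsilon>"
    then obtain \<eta> where \<eta>: "dist (A \<mu> \<eta>) (\<xi> - E \<mu> \<xi>) < \<epsilon> / 2"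
      using dense[of \<xi> \<mu>] unfolding closure_approachable by (metis half_gt_zero imageE)
    have "dist (E \<nu> \<xi>) (E \<mu> \<xi>) < \<epsilon>"
      if \<nu>: "\<mu> < \<nu>" "\<nu> < \<mu> + \<epsilon> / (4 * (norm \<eta> + 1))" for \<nu>
    proof -
      define D where "D = E \<nu> - E \<mu>"
      have D_apply: "D \<zeta> = E \<nu> \<zeta> - E \<mu> \<zeta>" for \<zeta>
        by (simp add: D_def blinfun.diff_left)
      have D_gen: "D \<in> generated_algebra x"
        unfolding D_def by (intro strong_algebra_diff strong_algebra_generated gen)
      have D_sym: "symmetric_op D"
        using generated_algebra_symmetric[OF x D_gen] .
      have ED: "E \<mu> (D \<zeta>) = 0" "E \<nu> (D \<zeta>) = D \<zeta>" for \<zeta>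
        using \<nu>(1) by (simp_all add: D_apply blinfun.diff_right idem mono mono')
      have D: "orth_projection D"
        unfolding orth_projection_def using D_sym \<nu>(1)
        by (auto intro!: blinfun_eqI simp: D_apply blinfun.diff_right idem mono mono')
      \<comment> \<open>On the range of \<open>D\<close> the form of \<open>x - \<mu>\<close> lies between \<open>0\<close> and \<open>\<nu> - \<mu>\<close>.\<close>
      define c where "c = (x - \<mu> *\<^sub>R id_blinfun) o\<^sub>L D"
      have c_apply: "c \<zeta> = x (D \<zeta>) - \<mu> *\<^sub>R D \<zeta>" for \<zeta>
        by (simp add: c_def blinfun.diff_left blinfun.scaleR_left)
      have c_gen: "c \<in> generated_algebra x"
        unfolding c_def by (intro strong_algebra_diff strong_algebra_compose strong_algebra_scaleR
            strong_algebra_generated generated_algebra_self generated_algebra_id D_gen)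
      have "norm c \<le> \<nu> - \<mu>"
      proof (rule norm_le_of_form_le[OF generated_algebra_symmetric[OF x c_gen]])
        fix \<zeta>
        have "D (c \<zeta>) = c (D \<zeta>)"
          by (intro commute_apply generated_algebra_commute_self[of _ x] D_gen c_gen)
        also have "\<dots> = c \<zeta>"
          by (simp add: c_apply orth_projection_idem[OF D])
        finally have "c \<zeta> \<bullet> \<zeta> = c \<zeta> \<bullet> D \<zeta>"
          by (metis D_sym symmetric_opD)
        also have "\<dots> = x (D \<zeta>) \<bullet> D \<zeta> - \<mu> * (D \<zeta> \<bullet> D \<zeta>)"
          by (simp add: c_apply inner_diff_left)
        finally have "c \<zeta> \<bullet> \<zeta> = x (D \<zeta>) \<bullet> D \<zeta> - \<mu> * (D \<zeta> \<bullet> D \<zeta>)" .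
        then have "0 \<le> c \<zeta> \<bullet> \<zeta>" "c \<zeta> \<bullet> \<zeta> \<le> (\<nu> - \<mu>) * (D \<zeta> \<bullet> D \<zeta>)"
          using lower[OF ED(1)[of \<zeta>]] upper[OF ED(2)[of \<zeta>]] by (simp_all add: algebra_simps)
        moreover have "(\<nu> - \<mu>) * (D \<zeta> \<bullet> D \<zeta>) \<le> (\<nu> - \<mu>) * (\<zeta> \<bullet> \<zeta>)"
          using \<nu>(1) orth_projection_form_le[OF D, of \<zeta>] orth_projection_form[OF D, of \<zeta>]
          by (intro mult_left_mono) simp_all
        ultimately show "\<bar>c \<zeta> \<bullet> \<zeta>\<bar> \<le> (\<nu> - \<mu>) * (\<zeta> \<bullet> \<zeta>)"
          by linarith
      qed (use \<nu> in simp)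
      then have "norm (c \<eta>) \<le> (\<nu> - \<mu>) * norm \<eta>"
        using norm_blinfun[of c \<eta>] mult_right_mono[of "norm c" "\<nu> - \<mu>" "norm \<eta>"] by simp
      moreover have "A \<mu> (D \<eta>) = 2 *\<^sub>R c \<eta>"
        using A[OF ED(1)] by (simp add: c_apply)
      moreover have "D (A \<mu> \<eta>) = A \<mu> (D \<eta>)"
        by (intro commute_apply generated_algebra_commute_self[of _ x] D_gen A_gen)
      ultimately have DA: "norm (D (A \<mu> \<eta>)) \<le> 2 * ((\<nu> - \<mu>) * norm \<eta>)"
        by simp
      have "(\<nu> - \<mu>) * norm \<eta> \<le> (\<nu> - \<mu>) * (norm \<eta> + 1)"
        using \<nu>(1) by (intro mult_left_mono) simp_all
      also have "\<dots> < \<epsilon> / 4"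
      proof -
        have k: "0 < norm \<eta> + 1" by (simp add: add_nonneg_pos)
        have "\<nu> - \<mu> < \<epsilon> / 4 / (norm \<eta> + 1)"
          using \<nu>(2) by simp
        then show ?thesis
          by (simp only: pos_less_divide_eq[OF k])
      qed
      finally have small: "norm (D (A \<mu> \<eta>)) < \<epsilon> / 2"
        using DA by simp
      have "E \<nu> \<xi> - E \<mu> \<xi> = D (\<xi> - E \<mu> \<xi>)"
        using \<nu>(1) by (simp add: D_apply blinfun.diff_right idem mono)
      also have "\<dots> = D (A \<mu> \<eta>) + D ((\<xi> - E \<mu> \<xi>) - A \<mu> \<eta>)"
        by (simp add: blinfun.diff_right)
      also have "norm \<dots> \<le> norm (D (A \<mu> \<eta>)) + norm ((\<xi> - E \<mu> \<xi>) - A \<mu> \<eta>)"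
        by (intro order_trans[OF norm_triangle_ineq] add_left_mono orth_projection_norm D)
      also have "\<dots> < \<epsilon>"
        using small \<eta> by (simp add: dist_norm norm_minus_commute)
      finally show ?thesis by (simp add: dist_norm)
    qed
    moreover have "\<mu> < \<mu> + \<epsilon> / (4 * (norm \<eta> + 1))"
      using \<open>0 < \<epsilon>\<close> by (simp add: add_nonneg_pos)
    ultimately show "eventually (\<lambda>\<nu>. dist (E \<nu> \<xi>) (E \<mu> \<xi>) < \<epsilon>) (at_right \<mu>)"
      unfolding eventually_at_right_field by blast
  qed
  have "resolves x E"
    by (rule resolvesI; fact proj xE mono cont upper lower)
  with that gen show thesis by blast
qed

text \<open>
  Since \<open>F \<nu>\<close> is in the algebra generated by \<open>x\<close>, it commutes with \<open>E \<mu>\<close>. For \<open>\<mu> < \<nu>\<close> the ranges of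
  \<open>E \<mu>\<close> and \<open>id - F \<nu>\<close> then meet only in \<open>0\<close>, and right-continuity removes the gap between \<open>\<mu>\<close>
  and \<open>\<nu>\<close>.
\<close>

lemma resolves_unique:
  fixes x :: "'a::{real_inner,banach} \<Rightarrow>\<^sub>L 'a"
  assumes x: "symmetric_op x" and E: "resolves x E" and F: "resolves x F"
    and gen: "\<And>\<mu>. F \<mu> \<in> generated_algebra x"
  shows "E = F"
proof
  fix \<mu>
  have comm: "E \<nu> (F \<rho> \<xi>) = F \<rho> (E \<nu> \<xi>)" for \<nu> \<rho> \<xi>
    by (intro commute_apply generated_algebra_commute[OF _ gen] resolves_commute[OF E, symmetric])
  note idem = orth_projection_idem[OF resolves_projection]
  have EF: "F \<nu> (E \<mu> \<xi>) = E \<mu> \<xi>" and FE: "E \<nu> (F \<mu> \<xi>) = F \<mu> \<xi>" if "\<mu> < \<nu>" for \<nu> \<xi>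
  proof -
    have "E \<mu> \<xi> - F \<nu> (E \<mu> \<xi>) = 0"
      by (rule resolves_apart[OF F E that])
        (simp_all add: blinfun.diff_right comm idem[OF E] idem[OF F])
    then show "F \<nu> (E \<mu> \<xi>) = E \<mu> \<xi>" by simp
    have "F \<mu> \<xi> - E \<nu> (F \<mu> \<xi>) = 0"
      by (rule resolves_apart[OF E F that])
        (simp_all add: blinfun.diff_right comm[symmetric] idem[OF E] idem[OF F])
    then show "E \<nu> (F \<mu> \<xi>) = F \<mu> \<xi>" by simp
  qed
  have "eventually (\<lambda>\<nu>. \<mu> < \<nu>) (at_right \<mu>)"
    by (rule eventually_at_right_less)
  then have ev: "eventually (\<lambda>\<nu>. F \<nu> (E \<mu> \<xi>) = E \<mu> \<xi>) (at_right \<mu>)"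
      "eventually (\<lambda>\<nu>. E \<nu> (F \<mu> \<xi>) = F \<mu> \<xi>) (at_right \<mu>)" for \<xi>
    by (eventually_elim, simp add: EF FE)+
  have "F \<mu> (E \<mu> \<xi>) = E \<mu> \<xi>" "E \<mu> (F \<mu> \<xi>) = F \<mu> \<xi>" for \<xi>
    using tendsto_unique[OF trivial_limit_at_right_real resolves_continuous[OF F] tendsto_eventually[OF ev(1)]]
      tendsto_unique[OF trivial_limit_at_right_real resolves_continuous[OF E] tendsto_eventually[OF ev(2)]]
    by blast+
  then show "E \<mu> = F \<mu>"
    using comm by (intro blinfun_eqI) metis
qed

lemma resolves_below:
  assumes E: "resolves x E" and lower: "\<And>\<xi>. a * (\<xi> \<bullet> \<xi>) \<le> x \<xi> \<bullet> \<xi>" and "\<mu> < a"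
  shows "E \<mu> = 0"
proof -
  have "E \<mu> \<xi> = 0" for \<xi>
  proof (rule ccontr)
    assume "E \<mu> \<xi> \<noteq> 0"
    then have "\<mu> * (E \<mu> \<xi> \<bullet> E \<mu> \<xi>) < a * (E \<mu> \<xi> \<bullet> E \<mu> \<xi>)"
      using \<open>\<mu> < a\<close> by simp
    then show False
      using lower[of "E \<mu> \<xi>"] resolves_upper[OF E, of \<mu> "E \<mu> \<xi>"]
      by (simp add: orth_projection_idem[OF resolves_projection[OF E]])
  qed
  then show ?thesis by (auto intro: blinfun_eqI)
qed

lemma resolves_above:
  assumes E: "resolves x E" and upper: "\<And>\<xi>. x \<xi> \<bullet> \<xi> \<le> b * (\<xi> \<bullet> \<xi>)" and "b \<le> \<mu>"
  shows "E \<mu> = id_blinfun"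
proof -
  have id: "E \<nu> \<xi> = \<xi>" if "b < \<nu>" for \<nu> \<xi>
  proof (rule ccontr)
    define \<zeta> where "\<zeta> = \<xi> - E \<nu> \<xi>"
    assume "E \<nu> \<xi> \<noteq> \<xi>"
    then have "b * (\<zeta> \<bullet> \<zeta>) < \<nu> * (\<zeta> \<bullet> \<zeta>)"
      using that by (simp add: \<zeta>_def)
    moreover have "E \<nu> \<zeta> = 0"
      by (simp add: \<zeta>_def blinfun.diff_right orth_projection_idem[OF resolves_projection[OF E]])
    ultimately show False
      using upper[of \<zeta>] resolves_lower[OF E, of \<nu> \<zeta>] by simp
  qed
  have "E \<mu> \<xi> = \<xi>" for \<xi>
  proof -
    have "eventually (\<lambda>\<nu>. \<mu> < \<nu>) (at_right \<mu>)"
      by (rule eventually_at_right_less)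
    then have "eventually (\<lambda>\<nu>. E \<nu> \<xi> = \<xi>) (at_right \<mu>)"
      by eventually_elim (use id \<open>b \<le> \<mu>\<close> in auto)
    then show ?thesis
      using tendsto_unique[OF trivial_limit_at_right_real resolves_continuous[OF E] tendsto_eventually]
      by blast
  qed
  then show ?thesis by (auto intro: blinfun_eqI)
qed

section \<open>Spectral families of self-adjoint operators\<close>

instance complex_hilbert \<subseteq> banach ..

lemma cinner_eq_Complex: "cinner x y = Complex (x \<bullet> y) (((- \<i>) *\<^sub>C x) \<bullet> y)"
  by (rule complex_eqI) (simp_all add: inner_eq_Re_cinner cinner_scaleC_left)

text \<open>
  The imaginary part of \<open>cinner x y\<close> is the real inner product of \<open>- \<i> x\<close> and \<open>y\<close>, so symmetry for
  the real inner product and complex linearity together determine the complex adjoint.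
\<close>

lemma selfadjoint_op_iff: "selfadjoint_op a \<longleftrightarrow> symmetric_op a \<and> complex_linear_op a"
proof
  assume a: "selfadjoint_op a"
  then have adj: "cinner (a \<xi>) \<eta> = cinner \<xi> (a \<eta>)" for \<xi> \<eta>
    by (simp add: selfadjoint_op_def is_adjoint_def)
  have "a (c *\<^sub>C \<xi>) \<bullet> \<eta> = (c *\<^sub>C a \<xi>) \<bullet> \<eta>" for c \<xi> \<eta>
    by (simp add: inner_eq_Re_cinner adj cinner_scaleC_left)
  then have "a (c *\<^sub>C \<xi>) = c *\<^sub>C a \<xi>" for c \<xi>
    by (metis vector_eq_rdot)
  then show "symmetric_op a \<and> complex_linear_op a"
    by (simp add: symmetric_op_def complex_linear_op_def inner_eq_Re_cinner adj)
next
  assume "symmetric_op a \<and> complex_linear_op a"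
  then have "cinner (a \<xi>) \<eta> = cinner \<xi> (a \<eta>)" for \<xi> \<eta>
    by (simp only: cinner_eq_Complex symmetric_opD complex_linear_op_def[THEN iffD1, rule_format, symmetric])
  then show "selfadjoint_op a"
    by (simp add: selfadjoint_op_def is_adjoint_def)
qed

lemma positive_op_iff: "positive_op a \<longleftrightarrow> selfadjoint_op a \<and> (\<forall>\<xi>. 0 \<le> a \<xi> \<bullet> \<xi>)"
  by (simp add: positive_op_def inner_eq_Re_cinner)

lemma projection_op_iff: "projection_op p \<longleftrightarrow> orth_projection p \<and> complex_linear_op p"
  by (auto simp: projection_op_def orth_projection_def selfadjoint_op_iff)

lemma selfadjoint_op_diff: "selfadjoint_op a \<Longrightarrow> selfadjoint_op b \<Longrightarrow> selfadjoint_op (a - b)"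
  by (simp add: selfadjoint_op_iff symmetric_op_diff complex_linear_op_def blinfun.diff_left
      linear_diff[OF bounded_linear.linear[OF bounded_linear_scaleC]])

lemma complex_linear_generated:
  assumes x: "complex_linear_op x" and y: "y \<in> generated_algebra x"
  shows "complex_linear_op y"
  unfolding complex_linear_op_def
proof (intro allI)
  fix c \<xi>
  have "scaleC_op c id_blinfun o\<^sub>L x = x o\<^sub>L scaleC_op c id_blinfun"
    using x by (auto intro!: blinfun_eqI simp: scaleC_op_apply complex_linear_op_def)
  from commute_apply[OF generated_algebra_commute[OF this y], of \<xi>]
  show "y (c *\<^sub>C \<xi>) = c *\<^sub>C y \<xi>"
    by (simp add: scaleC_op_apply)
qed

lemma orth_projection_diff:
  assumes p: "orth_projection p" and q: "orth_projection q" and qp: "\<And>\<xi>. q (p \<xi>) = p \<xi>"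
  shows "orth_projection (q - p)" "q ((q - p) \<xi>) = (q - p) \<xi>" "p ((q - p) \<xi>) = 0"
proof -
  note pq = orth_projection_absorb[OF p q qp]
  note simps = blinfun.diff_left blinfun.diff_right qp pq orth_projection_idem[OF p]
    orth_projection_idem[OF q]
  show "orth_projection (q - p)"
    using p q unfolding orth_projection_def
    by (auto intro!: symmetric_op_diff blinfun_eqI simp: simps)
  show "q ((q - p) \<xi>) = (q - p) \<xi>" "p ((q - p) \<xi>) = 0"
    by (simp_all add: simps)
qed

lemma op_le_projections:
  assumes p: "projection_op p" and q: "projection_op q"
  shows "op_le p q \<longleftrightarrow> (\<forall>\<xi>. q (p \<xi>) = p \<xi>)"
proof
  have pq: "orth_projection p" "orth_projection q"
    using p q by (simp_all add: projection_op_iff)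
  show "\<forall>\<xi>. q (p \<xi>) = p \<xi>" if "op_le p q"
  proof
    fix \<xi>
    let ?\<zeta> = "p \<xi>"
    have "?\<zeta> \<bullet> ?\<zeta> \<le> q ?\<zeta> \<bullet> ?\<zeta>"
      using that orth_projection_idem[OF pq(1), of \<xi>]
      by (auto simp: op_le_def positive_op_iff blinfun.diff_left inner_diff_left dest!: spec[of _ ?\<zeta>])
    moreover have "(q ?\<zeta> - ?\<zeta>) \<bullet> (q ?\<zeta> - ?\<zeta>) = ?\<zeta> \<bullet> ?\<zeta> - q ?\<zeta> \<bullet> ?\<zeta>"
      using orth_projection_form[OF pq(2), of ?\<zeta>]
      by (simp add: inner_diff_left inner_diff_right inner_commute)
    ultimately have "\<not> 0 < (q ?\<zeta> - ?\<zeta>) \<bullet> (q ?\<zeta> - ?\<zeta>)"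
      by linarith
    then show "q ?\<zeta> = ?\<zeta>" by simp
  qed
  show "op_le p q" if "\<forall>\<xi>. q (p \<xi>) = p \<xi>"
  proof -
    have "orth_projection (q - p)"
      using orth_projection_diff(1)[OF pq] that by blast
    then show ?thesis
      using p q selfadjoint_op_diff[of q p]
      by (simp add: op_le_def positive_op_iff orth_projection_form projection_op_def)
  qed
qed

lemma symmetric_op_sum: "(\<And>i. i \<in> I \<Longrightarrow> symmetric_op (f i)) \<Longrightarrow> symmetric_op (sum f I)"
  by (induction I rule: infinite_finite_induct) (auto simp: symmetric_op_0 symmetric_op_add)

lemma form_le_norm:
  fixes a :: "'a::real_inner \<Rightarrow>\<^sub>L 'a"
  shows "\<bar>a \<xi> \<bullet> \<xi>\<bar> \<le> norm a * (\<xi> \<bullet> \<xi>)"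
proof -
  have "\<bar>a \<xi> \<bullet> \<xi>\<bar> \<le> norm (a \<xi>) * norm \<xi>"
    by (rule Cauchy_Schwarz_ineq2)
  also have "\<dots> \<le> norm a * norm \<xi> * norm \<xi>"
    by (intro mult_right_mono norm_blinfun norm_ge_zero)
  finally show ?thesis
    by (simp add: dot_square_norm power2_eq_square mult.assoc)
qed

lemma resolves_bounds:
  assumes E: "resolves x E"
  shows "\<mu> < - norm x \<Longrightarrow> E \<mu> = 0" "norm x \<le> \<mu> \<Longrightarrow> E \<mu> = id_blinfun"
proof -
  have "- norm x * (\<xi> \<bullet> \<xi>) \<le> x \<xi> \<bullet> \<xi>" "x \<xi> \<bullet> \<xi> \<le> norm x * (\<xi> \<bullet> \<xi>)" for \<xi>
    using form_le_norm[of x \<xi>] by linarith+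
  then show "\<mu> < - norm x \<Longrightarrow> E \<mu> = 0" "norm x \<le> \<mu> \<Longrightarrow> E \<mu> = id_blinfun"
    using resolves_below[OF E] resolves_above[OF E] by blast+
qed

text \<open>
  The increments of \<open>E\<close> over a partition are projections that add up to the identity, and on the
  range of each of them \<open>x\<close> differs from the intermediate point by less than the mesh. Summing these
  form estimates bounds the distance of \<open>x\<close> to the Riemann sum.
\<close>

lemma resolves_imp_spectral_family:
  assumes x: "selfadjoint_op x" and E: "resolves x E" and lin: "\<And>\<mu>. complex_linear_op (E \<mu>)"
  shows "is_spectral_family x E"
proof -
  note proj = resolves_projection[OF E]
  have p: "projection_op (E \<mu>)" for \<mu>
    by (simp add: projection_op_iff proj lin)
  have close: "norm (x - (\<Sum>i<n. s i *\<^sub>R (E (t (Suc i)) - E (t i)))) \<le> \<delta>"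
    if \<delta>: "0 < \<delta>" and t: "t 0 < - norm x" "norm x \<le> t n"
      and mesh: "\<And>i. i < n \<Longrightarrow> t i \<le> s i \<and> s i \<le> t (Suc i) \<and> t (Suc i) - t i < \<delta>"
    for n \<delta> and t s :: "nat \<Rightarrow> real"
  proof (rule norm_le_of_form_le)
    define D where "D i = E (t (Suc i)) - E (t i)" for i
    have D: "orth_projection (D i)" "E (t (Suc i)) (D i \<xi>) = D i \<xi>" "E (t i) (D i \<xi>) = 0"
      if "i < n" for i \<xi>
      unfolding D_def using mesh[OF that] resolves_mono[OF E, of "t i" "t (Suc i)"]
      by (intro orth_projection_diff proj; force)+
    show "symmetric_op (x - (\<Sum>i<n. s i *\<^sub>R (E (t (Suc i)) - E (t i))))"
      using x proj unfolding selfadjoint_op_iff orth_projection_def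
      by (intro symmetric_op_diff symmetric_op_sum symmetric_op_scaleR) auto
    fix \<xi>
    have tel: "(\<Sum>i<n. D i \<xi>) = \<xi>"
      using sum_lessThan_telescope[of "\<lambda>i. E (t i) \<xi>" n] resolves_bounds[OF E] t
      by (simp add: D_def blinfun.diff_left)
    have "(x - (\<Sum>i<n. s i *\<^sub>R D i)) \<xi> \<bullet> \<xi> = x (\<Sum>i<n. D i \<xi>) \<bullet> \<xi> - (\<Sum>i<n. s i * (D i \<xi> \<bullet> \<xi>))"
      by (simp add: tel blinfun.diff_left blinfun.sum_left blinfun.scaleR_left inner_diff_left
          inner_sum_left)
    also have "\<dots> = (\<Sum>i<n. x (D i \<xi>) \<bullet> \<xi> - s i * (D i \<xi> \<bullet> \<xi>))"
      by (simp add: blinfun.sum_right inner_sum_left sum_subtractf)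
    also have "\<bar>\<dots>\<bar> \<le> (\<Sum>i<n. \<delta> * (D i \<xi> \<bullet> \<xi>))"
    proof (rule order_trans[OF sum_abs sum_mono])
      fix i assume "i \<in> {..<n}"
      then have i: "i < n" by simp
      let ?\<zeta> = "D i \<xi>"
      have "D i (x ?\<zeta>) = x (D i ?\<zeta>)"
        using commute_apply[OF resolves_commute[OF E]] by (simp add: D_def blinfun.diff_left blinfun.diff_right)
      then have "x ?\<zeta> = D i (x ?\<zeta>)"
        by (simp add: orth_projection_idem[OF D(1)[OF i]])
      then have form: "x ?\<zeta> \<bullet> \<xi> = x ?\<zeta> \<bullet> ?\<zeta>"
        using D(1)[OF i] by (metis orth_projection_def symmetric_opD)
      have form1: "?\<zeta> \<bullet> \<xi> = ?\<zeta> \<bullet> ?\<zeta>"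
        by (rule orth_projection_form[OF D(1)[OF i]])
      have "t i * (?\<zeta> \<bullet> ?\<zeta>) \<le> x ?\<zeta> \<bullet> ?\<zeta>" "x ?\<zeta> \<bullet> ?\<zeta> \<le> t (Suc i) * (?\<zeta> \<bullet> ?\<zeta>)"
        using resolves_lower[OF E D(3)[OF i]] resolves_upper[OF E D(2)[OF i]] .
      moreover have "(t (Suc i) - s i) * (?\<zeta> \<bullet> ?\<zeta>) \<le> \<delta> * (?\<zeta> \<bullet> ?\<zeta>)"
        "(s i - t i) * (?\<zeta> \<bullet> ?\<zeta>) \<le> \<delta> * (?\<zeta> \<bullet> ?\<zeta>)"
        using mesh[OF i] by (intro mult_right_mono inner_ge_zero; linarith)+
      ultimately show "\<bar>x ?\<zeta> \<bullet> \<xi> - s i * (?\<zeta> \<bullet> \<xi>)\<bar> \<le> \<delta> * (?\<zeta> \<bullet> \<xi>)"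
        unfolding form form1 by (simp add: left_diff_distrib abs_le_iff)
    qed
    also have "\<dots> = \<delta> * (\<xi> \<bullet> \<xi>)"
      using tel by (simp add: sum_distrib_left[symmetric] inner_sum_left[symmetric])
    finally show "\<bar>(x - (\<Sum>i<n. s i *\<^sub>R (E (t (Suc i)) - E (t i)))) \<xi> \<bullet> \<xi>\<bar> \<le> \<delta> * (\<xi> \<bullet> \<xi>)"
      by (simp add: D_def)
  qed (use \<delta> in simp)
  have riemann: "\<exists>\<delta>>0. \<forall>n (t :: nat \<Rightarrow> real) (s :: nat \<Rightarrow> real).
        t 0 < - norm x \<and> norm x \<le> t n \<and>
        (\<forall>i<n. t i \<le> s i \<and> s i \<le> t (Suc i) \<and> t (Suc i) - t i < \<delta>) \<longrightarrow>
        norm (x - (\<Sum>i<n. s i *\<^sub>R (E (t (Suc i)) - E (t i)))) < \<epsilon>" if "0 < \<epsilon>" for \<epsilon>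
  proof (intro exI[of _ "\<epsilon> / 2"] conjI allI impI)
    show "0 < \<epsilon> / 2" using that by simp
    fix n and t s :: "nat \<Rightarrow> real"
    assume *: "t 0 < - norm x \<and> norm x \<le> t n \<and>
        (\<forall>i<n. t i \<le> s i \<and> s i \<le> t (Suc i) \<and> t (Suc i) - t i < \<epsilon> / 2)"
    have "norm (x - (\<Sum>i<n. s i *\<^sub>R (E (t (Suc i)) - E (t i)))) \<le> \<epsilon> / 2"
      by (rule close) (use * that in auto)
    also have "\<dots> < \<epsilon>" using that by simp
    finally show "norm (x - (\<Sum>i<n. s i *\<^sub>R (E (t (Suc i)) - E (t i)))) < \<epsilon>" .
  qed
  have le: "op_le (E \<mu>) (E \<nu>)" if "\<mu> \<le> \<nu>" for \<mu> \<nu>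
    using resolves_mono[OF E that] by (simp add: op_le_projections p)
  show ?thesis
    unfolding is_spectral_family_def
    using p le resolves_continuous[OF E] resolves_bounds[OF E] riemann by simp
qed

lemma nonpos_of_le_multiples:
  fixes a b :: real
  assumes "\<And>\<epsilon>. 0 < \<epsilon> \<Longrightarrow> a \<le> \<epsilon> * b" and b: "0 \<le> b"
  shows "a \<le> 0"
proof (rule ccontr)
  assume "\<not> a \<le> 0"
  then have a: "0 < a" by simp
  have "a \<le> a / (b + 1) * b"
    using a b by (intro assms(1)) simp
  also have "\<dots> < a"
    using a b by (simp add: field_simps)
  finally show False by simp
qed

text \<open>
  Given \<open>\<mu>\<close>, take partitions with \<open>\<mu>\<close> among their points and evaluate at left end points. The Riemann
  sums \<open>R\<close> then commute with \<open>E \<mu>\<close> and satisfy the form bounds at level \<open>\<mu>\<close> exactly, and these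
  properties pass to their norm limit \<open>x\<close>.
\<close>

lemma spectral_family_imp_resolves:
  assumes x: "selfadjoint_op x" and E: "is_spectral_family x E"
  shows "resolves x E"
proof -
  have p: "projection_op (E \<mu>)" and cont: "((\<lambda>\<nu>. E \<nu> \<xi>) \<longlongrightarrow> E \<mu> \<xi>) (at_right \<mu>)"
    and E0: "\<mu> < - norm x \<Longrightarrow> E \<mu> = 0" and E1: "norm x \<le> \<mu> \<Longrightarrow> E \<mu> = id_blinfun"
    and le: "\<mu> \<le> \<nu> \<Longrightarrow> op_le (E \<mu>) (E \<nu>)" for \<mu> \<nu> \<xi>
    using E unfolding is_spectral_family_def by blast+
  have proj: "orth_projection (E \<mu>)" for \<mu>
    using p by (simp add: projection_op_iff)
  have mono: "E \<nu> (E \<mu> \<xi>) = E \<mu> \<xi>" if "\<mu> \<le> \<nu>" for \<mu> \<nu> \<xi>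
    using le[OF that] by (simp add: op_le_projections p)
  have mono': "E \<mu> (E \<nu> \<xi>) = E \<mu> \<xi>" if "\<mu> \<le> \<nu>" for \<mu> \<nu> \<xi>
    by (rule orth_projection_absorb[OF proj proj mono[OF that]])
  have comm: "E \<mu> (E \<nu> \<xi>) = E \<nu> (E \<mu> \<xi>)" for \<mu> \<nu> \<xi>
    by (cases "\<mu> \<le> \<nu>") (simp_all add: mono mono')
  have approx: "\<exists>R. norm (x - R) < \<epsilon> \<and> R o\<^sub>L E \<mu> = E \<mu> o\<^sub>L R \<and>
      (\<forall>\<xi>. E \<mu> \<xi> = \<xi> \<longrightarrow> R \<xi> \<bullet> \<xi> \<le> \<mu> * (\<xi> \<bullet> \<xi>)) \<and> (\<forall>\<xi>. E \<mu> \<xi> = 0 \<longrightarrow> \<mu> * (\<xi> \<bullet> \<xi>) \<le> R \<xi> \<bullet> \<xi>)"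
    if \<epsilon>: "0 < \<epsilon>" for \<epsilon> \<mu>
  proof -
    obtain \<delta> where \<delta>: "0 < \<delta>" and riemann: "\<And>n (t :: nat \<Rightarrow> real) (s :: nat \<Rightarrow> real).
        t 0 < - norm x \<and> norm x \<le> t n \<and>
        (\<forall>i<n. t i \<le> s i \<and> s i \<le> t (Suc i) \<and> t (Suc i) - t i < \<delta>) \<Longrightarrow>
        norm (x - (\<Sum>i<n. s i *\<^sub>R (E (t (Suc i)) - E (t i)))) < \<epsilon>"
      using E \<epsilon> unfolding is_spectral_family_def by blast
    define h where "h = \<delta> / 2"
    have h: "0 < h" "h < \<delta>"
      using \<delta> by (simp_all add: h_def)
    obtain k :: nat where k: "\<bar>\<mu>\<bar> + norm x < real k * h"
      using reals_Archimedean3[OF h(1)] by blast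
    \<comment> \<open>An equidistant partition that has \<open>\<mu>\<close> as its \<open>k\<close>-th point.\<close>
    define t where "t i = \<mu> + (real i - real k) * h" for i
    define D where "D i = E (t (Suc i)) - E (t i)" for i
    define R where "R = (\<Sum>i<2 * k. t i *\<^sub>R D i)"
    have t_step: "t (Suc i) = t i + h" for i
      by (simp add: t_def algebra_simps)
    have t_ends: "t 0 < - norm x" "norm x \<le> t (2 * k)"
      using k by (simp_all add: t_def)
    have t_less: "t (Suc i) \<le> \<mu>" if "i < k" for i
    proof -
      have "(real (Suc i) - real k) * h \<le> 0"
        using that h(1) by (intro mult_nonpos_nonneg) simp_all
      then show ?thesis by (simp add: t_def)
    qed
    have t_ge: "\<mu> \<le> t i" if "\<not> i < k" for i
      using that h(1) by (simp add: t_def)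
    have D: "orth_projection (D i)" for i
      unfolding D_def by (intro orth_projection_diff proj mono) (simp add: t_step h(1) less_imp_le)
    have tel: "(\<Sum>i<2 * k. D i \<xi>) = \<xi>" for \<xi>
      using sum_lessThan_telescope[of "\<lambda>i. E (t i) \<xi>" "2 * k"] t_ends
      by (simp add: D_def blinfun.diff_left E0 E1)
    have R_form: "R \<xi> \<bullet> \<xi> = (\<Sum>i<2 * k. t i * (D i \<xi> \<bullet> \<xi>))" for \<xi>
      by (simp add: R_def blinfun.sum_left blinfun.scaleR_left inner_sum_left)
    have id_form: "(\<Sum>i<2 * k. \<mu> * (D i \<xi> \<bullet> \<xi>)) = \<mu> * (\<xi> \<bullet> \<xi>)" for \<xi>
      using tel[of \<xi>] by (simp add: sum_distrib_left[symmetric] inner_sum_left[symmetric])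
    have D_pos: "0 \<le> D i \<xi> \<bullet> \<xi>" for i \<xi>
      by (simp add: orth_projection_form[OF D])
    have "norm (x - R) < \<epsilon>"
      unfolding R_def D_def using t_ends h by (intro riemann) (simp add: t_step)
    moreover have "R o\<^sub>L E \<mu> = E \<mu> o\<^sub>L R"
      by (rule blinfun_eqI)
        (simp add: R_def D_def blinfun.sum_left blinfun.sum_right blinfun.scaleR_left
          blinfun.scaleR_right blinfun.diff_left blinfun.diff_right comm[of \<mu>])
    moreover have "R \<xi> \<bullet> \<xi> \<le> \<mu> * (\<xi> \<bullet> \<xi>)" if \<xi>: "E \<mu> \<xi> = \<xi>" for \<xi>
      unfolding R_form id_form[symmetric]
    proof (rule sum_mono)
      fix i
      show "t i * (D i \<xi> \<bullet> \<xi>) \<le> \<mu> * (D i \<xi> \<bullet> \<xi>)"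
      proof (cases "i < k")
        case True
        then show ?thesis
          using t_less[OF True] h(1) by (intro mult_right_mono D_pos) (simp add: t_step)
      next
        case False
        have "E (t j) \<xi> = \<xi>" if "i \<le> j" for j
          using mono[OF t_ge, of j \<xi>] \<xi> False that by simp
        then show ?thesis by (simp add: D_def blinfun.diff_left)
      qed
    qed
    moreover have "\<mu> * (\<xi> \<bullet> \<xi>) \<le> R \<xi> \<bullet> \<xi>" if \<xi>: "E \<mu> \<xi> = 0" for \<xi>
      unfolding R_form id_form[symmetric]
    proof (rule sum_mono)
      fix i
      show "\<mu> * (D i \<xi> \<bullet> \<xi>) \<le> t i * (D i \<xi> \<bullet> \<xi>)"
      proof (cases "i < k")
        case True
        have "E (t (Suc i)) \<xi> = 0" "E (t i) \<xi> = 0"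
          using mono'[OF t_less[OF True], of \<xi>] mono'[of "t i" \<mu> \<xi>] t_less[OF True] h(1)
          by (simp_all add: \<xi> t_step blinfun.zero_right)
        then show ?thesis by (simp add: D_def blinfun.diff_left)
      next
        case False
        then show ?thesis
          by (intro mult_right_mono D_pos t_ge)
      qed
    qed
    ultimately show ?thesis by blast
  qed
  have xE: "x o\<^sub>L E \<mu> = E \<mu> o\<^sub>L x" for \<mu>
  proof (rule blinfun_eqI)
    fix \<xi>
    have "norm (x (E \<mu> \<xi>) - E \<mu> (x \<xi>)) \<le> \<epsilon> * (2 * norm \<xi>)" if \<epsilon>: "0 < \<epsilon>" for \<epsilon>
    proof -
      obtain R where R: "norm (x - R) < \<epsilon>" "R o\<^sub>L E \<mu> = E \<mu> o\<^sub>L R"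
        using approx[OF \<epsilon>, of \<mu>] by blast
      have bound: "norm ((x - R) \<eta>) \<le> \<epsilon> * norm \<eta>" for \<eta>
        using norm_blinfun[of "x - R" \<eta>] mult_right_mono[OF less_imp_le[OF R(1)] norm_ge_zero[of \<eta>]]
        by linarith
      have "x (E \<mu> \<xi>) - E \<mu> (x \<xi>) = (x - R) (E \<mu> \<xi>) - E \<mu> ((x - R) \<xi>)"
        by (simp add: blinfun.diff_left blinfun.diff_right commute_apply[OF R(2)])
      also have "norm \<dots> \<le> norm ((x - R) (E \<mu> \<xi>)) + norm (E \<mu> ((x - R) \<xi>))"
        by (rule norm_triangle_ineq4)
      also have "\<dots> \<le> \<epsilon> * norm (E \<mu> \<xi>) + norm ((x - R) \<xi>)"
        by (intro add_mono bound orth_projection_norm proj)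
      also have "\<dots> \<le> \<epsilon> * norm \<xi> + \<epsilon> * norm \<xi>"
        using \<epsilon> by (intro add_mono bound mult_left_mono orth_projection_norm proj) simp
      finally show ?thesis by simp
    qed
    then have "norm (x (E \<mu> \<xi>) - E \<mu> (x \<xi>)) \<le> 0"
      by (rule nonpos_of_le_multiples) simp_all
    then show "(x o\<^sub>L E \<mu>) \<xi> = (E \<mu> o\<^sub>L x) \<xi>" by simp
  qed
  have upper: "x \<xi> \<bullet> \<xi> \<le> \<mu> * (\<xi> \<bullet> \<xi>)" if \<xi>: "E \<mu> \<xi> = \<xi>" for \<mu> \<xi>
  proof -
    have "x \<xi> \<bullet> \<xi> - \<mu> * (\<xi> \<bullet> \<xi>) \<le> \<epsilon> * (\<xi> \<bullet> \<xi>)" if \<epsilon>: "0 < \<epsilon>" for \<epsilon>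
    proof -
      obtain R where R: "norm (x - R) < \<epsilon>" "\<forall>\<xi>. E \<mu> \<xi> = \<xi> \<longrightarrow> R \<xi> \<bullet> \<xi> \<le> \<mu> * (\<xi> \<bullet> \<xi>)"
        using approx[OF \<epsilon>, of \<mu>] by blast
      have "R \<xi> \<bullet> \<xi> \<le> \<mu> * (\<xi> \<bullet> \<xi>)"
        using R(2) \<xi> by simp
      then show ?thesis
        using form_le_norm[of "x - R" \<xi>] mult_right_mono[OF less_imp_le[OF R(1)] inner_ge_zero[of \<xi>]]
        by (simp add: blinfun.diff_left inner_diff_left)
    qed
    then have "x \<xi> \<bullet> \<xi> - \<mu> * (\<xi> \<bullet> \<xi>) \<le> 0"
      by (rule nonpos_of_le_multiples) simp_all
    then show ?thesis by simp
  qed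
  have lower: "\<mu> * (\<xi> \<bullet> \<xi>) \<le> x \<xi> \<bullet> \<xi>" if \<xi>: "E \<mu> \<xi> = 0" for \<mu> \<xi>
  proof -
    have "\<mu> * (\<xi> \<bullet> \<xi>) - x \<xi> \<bullet> \<xi> \<le> \<epsilon> * (\<xi> \<bullet> \<xi>)" if \<epsilon>: "0 < \<epsilon>" for \<epsilon>
    proof -
      obtain R where R: "norm (x - R) < \<epsilon>" "\<forall>\<xi>. E \<mu> \<xi> = 0 \<longrightarrow> \<mu> * (\<xi> \<bullet> \<xi>) \<le> R \<xi> \<bullet> \<xi>"
        using approx[OF \<epsilon>, of \<mu>] by blast
      have "\<mu> * (\<xi> \<bullet> \<xi>) \<le> R \<xi> \<bullet> \<xi>"
        using R(2) \<xi> by simp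
      then show ?thesis
        using form_le_norm[of "x - R" \<xi>] mult_right_mono[OF less_imp_le[OF R(1)] inner_ge_zero[of \<xi>]]
        by (simp add: blinfun.diff_left inner_diff_left)
    qed
    then have "\<mu> * (\<xi> \<bullet> \<xi>) - x \<xi> \<bullet> \<xi> \<le> 0"
      by (rule nonpos_of_le_multiples) simp_all
    then show ?thesis by simp
  qed
  show ?thesis
    by (rule resolvesI; fact proj xE mono cont upper lower)
qed

theorem spectral_family_characterization:
  assumes x: "selfadjoint_op x"
  shows resolves_spectral_family: "resolves x (spectral_family x)"
    and spectral_family_generated: "spectral_family x \<mu> \<in> generated_algebra x"
    and spectral_family_eqI: "resolves x E \<Longrightarrow> spectral_family x = E"
proof -
  have sym: "symmetric_op x" and lin: "complex_linear_op x"
    using x by (simp_all add: selfadjoint_op_iff)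
  obtain F where F: "resolves x F" "\<And>\<mu>. F \<mu> \<in> generated_algebra x"
    using resolves_exists[OF sym] by blast
  note unique = resolves_unique[OF sym _ F]
  have sf: "is_spectral_family x F"
    by (rule resolves_imp_spectral_family[OF x F(1) complex_linear_generated[OF lin F(2)]])
  have "spectral_family x = F"
    unfolding spectral_family_def
    by (rule the_equality[of "is_spectral_family x", OF sf])
      (rule unique[OF spectral_family_imp_resolves[OF x]])
  then show "resolves x (spectral_family x)" "spectral_family x \<mu> \<in> generated_algebra x"
    "resolves x E \<Longrightarrow> spectral_family x = E"
    using F unique[of E] by metis+
qed

section \<open>The spectral order\<close>

lemma spectral_family_projection:
  "selfadjoint_op x \<Longrightarrow> projection_op (spectral_family x \<mu>)"
  using complex_linear_generated[OF _ spectral_family_generated, of x \<mu>]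
  by (simp add: projection_op_iff resolves_projection[OF resolves_spectral_family] selfadjoint_op_iff)

lemma spectral_le_iff:
  assumes x: "selfadjoint_op x" and y: "selfadjoint_op y"
  shows "spectral_le x y \<longleftrightarrow>
    (\<forall>\<mu> \<xi>. spectral_family y \<mu> \<xi> = \<xi> \<longrightarrow> spectral_family x \<mu> \<xi> = \<xi>)"
proof -
  have idem: "spectral_family y \<mu> (spectral_family y \<mu> \<xi>) = spectral_family y \<mu> \<xi>" for \<mu> \<xi>
    by (rule orth_projection_idem[OF resolves_projection[OF resolves_spectral_family[OF y]]])
  show ?thesis
    unfolding spectral_le_def
      op_le_projections[OF spectral_family_projection[OF y] spectral_family_projection[OF x]]
    by (metis idem)
qed

text \<open>
  Two operators with the same spectral family are approximated by the same Riemann sums, on a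
  partition that is fine enough and wide enough for both.
\<close>

lemma spectral_le_antisym:
  assumes x: "selfadjoint_op x" and y: "selfadjoint_op y"
    and le: "spectral_le x y" "spectral_le y x"
  shows "x = y"
proof -
  define E where "E = spectral_family x"
  note Ex = resolves_spectral_family[OF x, folded E_def]
  note Ey = resolves_spectral_family[OF y]
  have "E \<mu> = spectral_family y \<mu>" for \<mu>
  proof (rule blinfun_eqI)
    fix \<xi>
    have fixed: "E \<mu> \<eta> = \<eta> \<longleftrightarrow> spectral_family y \<mu> \<eta> = \<eta>" for \<eta>
      using le unfolding E_def spectral_le_iff[OF x y] spectral_le_iff[OF y x] by blast
    note p = resolves_projection[OF Ex, of \<mu>] and q = resolves_projection[OF Ey, of \<mu>]
    have "spectral_family y \<mu> (E \<mu> \<eta>) = E \<mu> \<eta>" for \<eta>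
      using fixed orth_projection_idem[OF p] by blast
    from orth_projection_absorb[OF p q this]
    show "E \<mu> \<xi> = spectral_family y \<mu> \<xi>"
      using fixed orth_projection_idem[OF q] by metis
  qed
  then have Ey: "resolves y E"
    using Ey by (metis ext)
  have lin: "complex_linear_op (E \<mu>)" for \<mu>
    using spectral_family_projection[OF x] unfolding E_def projection_op_iff by blast
  have sf: "is_spectral_family x E" "is_spectral_family y E"
    using resolves_imp_spectral_family[OF x Ex lin] resolves_imp_spectral_family[OF y Ey lin] .
  have "norm (x - y) \<le> \<epsilon> * 2" if \<epsilon>: "0 < \<epsilon>" for \<epsilon>
  proof -
    obtain \<delta>1 where \<delta>1: "0 < \<delta>1" and x_riemann: "\<And>n (t :: nat \<Rightarrow> real) (s :: nat \<Rightarrow> real).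
        t 0 < - norm x \<and> norm x \<le> t n \<and>
        (\<forall>i<n. t i \<le> s i \<and> s i \<le> t (Suc i) \<and> t (Suc i) - t i < \<delta>1) \<Longrightarrow>
        norm (x - (\<Sum>i<n. s i *\<^sub>R (E (t (Suc i)) - E (t i)))) < \<epsilon>"
      using sf(1) \<epsilon> unfolding is_spectral_family_def by blast
    obtain \<delta>2 where \<delta>2: "0 < \<delta>2" and y_riemann: "\<And>n (t :: nat \<Rightarrow> real) (s :: nat \<Rightarrow> real).
        t 0 < - norm y \<and> norm y \<le> t n \<and>
        (\<forall>i<n. t i \<le> s i \<and> s i \<le> t (Suc i) \<and> t (Suc i) - t i < \<delta>2) \<Longrightarrow>
        norm (y - (\<Sum>i<n. s i *\<^sub>R (E (t (Suc i)) - E (t i)))) < \<epsilon>"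
      using sf(2) \<epsilon> unfolding is_spectral_family_def by blast
    define h where "h = min \<delta>1 \<delta>2 / 2"
    have h: "0 < h" "h < \<delta>1" "h < \<delta>2"
      using \<delta>1 \<delta>2 by (auto simp: h_def min_def)
    define N where "N = norm x + norm y + 1"
    have N: "norm x < N" "norm y < N"
      using norm_ge_zero[of x] norm_ge_zero[of y] unfolding N_def by linarith+
    obtain n :: nat where n: "2 * N < real n * h"
      using reals_Archimedean3[OF h(1)] by blast
    define t where "t i = real i * h - N" for i
    define R where "R = (\<Sum>i<n. t i *\<^sub>R (E (t (Suc i)) - E (t i)))"
    have t: "t (Suc i) = t i + h" for i
      by (simp add: t_def algebra_simps)
    have ends: "t 0 < - norm x" "norm x \<le> t n" "t 0 < - norm y" "norm y \<le> t n"
      using n N by (simp_all add: t_def)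
    have "norm (x - R) < \<epsilon>"
      unfolding R_def by (rule x_riemann) (use ends h in \<open>simp add: t\<close>)
    moreover have "norm (y - R) < \<epsilon>"
      unfolding R_def by (rule y_riemann) (use ends h in \<open>simp add: t\<close>)
    moreover have "norm (x - y) \<le> norm (x - R) + norm (y - R)"
      using norm_triangle_ineq4[of "x - R" "y - R"] by simp
    ultimately show ?thesis by simp
  qed
  then have "norm (x - y) \<le> 0"
    by (rule nonpos_of_le_multiples) simp_all
  then show ?thesis by simp
qed

lemma form_lower_bound_iff:
  assumes x: "selfadjoint_op x"
  shows "(\<forall>\<xi>. a * (\<xi> \<bullet> \<xi>) \<le> x \<xi> \<bullet> \<xi>) \<longleftrightarrow> (\<forall>\<mu><a. spectral_family x \<mu> = 0)"
proof
  note E = resolves_spectral_family[OF x]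
  show "\<forall>\<mu><a. spectral_family x \<mu> = 0" if "\<forall>\<xi>. a * (\<xi> \<bullet> \<xi>) \<le> x \<xi> \<bullet> \<xi>"
    using resolves_below[OF E] that by blast
  show "\<forall>\<xi>. a * (\<xi> \<bullet> \<xi>) \<le> x \<xi> \<bullet> \<xi>" if zero: "\<forall>\<mu><a. spectral_family x \<mu> = 0"
  proof
    fix \<xi>
    have "a * (\<xi> \<bullet> \<xi>) - x \<xi> \<bullet> \<xi> \<le> \<epsilon> * (\<xi> \<bullet> \<xi>)" if "0 < \<epsilon>" for \<epsilon>
      using resolves_lower[OF E, of "a - \<epsilon>" \<xi>] zero that by (simp add: left_diff_distrib)
    then have "a * (\<xi> \<bullet> \<xi>) - x \<xi> \<bullet> \<xi> \<le> 0"
      by (rule nonpos_of_le_multiples) simp_all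
    then show "a * (\<xi> \<bullet> \<xi>) \<le> x \<xi> \<bullet> \<xi>" by simp
  qed
qed

lemma form_upper_bound_iff:
  assumes x: "selfadjoint_op x"
  shows "(\<forall>\<xi>. x \<xi> \<bullet> \<xi> \<le> b * (\<xi> \<bullet> \<xi>)) \<longleftrightarrow> spectral_family x b = id_blinfun"
  using resolves_above[OF resolves_spectral_family[OF x], of b b]
    resolves_upper[OF resolves_spectral_family[OF x], of b] by auto

lemma form_lower_bound_mono:
  assumes "selfadjoint_op x" "selfadjoint_op y" "spectral_le x y"
    and "\<forall>\<xi>. a * (\<xi> \<bullet> \<xi>) \<le> x \<xi> \<bullet> \<xi>"
  shows "\<forall>\<xi>. a * (\<xi> \<bullet> \<xi>) \<le> y \<xi> \<bullet> \<xi>"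
  unfolding form_lower_bound_iff[OF assms(2)]
proof (intro allI impI)
  fix \<mu> assume "\<mu> < a"
  then have x0: "spectral_family x \<mu> = 0"
    using assms(1,4) form_lower_bound_iff by blast
  note idem = orth_projection_idem[OF resolves_projection[OF resolves_spectral_family[OF assms(2)]]]
  have "spectral_family y \<mu> \<xi> = 0" for \<xi>
    using assms(3) idem[of \<mu> \<xi>] unfolding spectral_le_iff[OF assms(1,2)]
    by (metis x0 zero_blinfun.rep_eq)
  then show "spectral_family y \<mu> = 0"
    by (auto intro: blinfun_eqI)
qed

lemma form_upper_bound_mono:
  assumes "selfadjoint_op x" "selfadjoint_op y" "spectral_le x y"
    and "\<forall>\<xi>. y \<xi> \<bullet> \<xi> \<le> b * (\<xi> \<bullet> \<xi>)"
  shows "\<forall>\<xi>. x \<xi> \<bullet> \<xi> \<le> b * (\<xi> \<bullet> \<xi>)"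
  using assms unfolding form_upper_bound_iff[OF assms(1)] form_upper_bound_iff[OF assms(2)]
    spectral_le_iff[OF assms(1,2)]
  by (auto intro: blinfun_eqI)

section \<open>Truncations\<close>

lemma orth_projection_split:
  assumes e: "orth_projection e" and comm: "x o\<^sub>L e = e o\<^sub>L x"
  shows "x \<xi> \<bullet> \<xi> = x (e \<xi>) \<bullet> e \<xi> + x (\<xi> - e \<xi>) \<bullet> (\<xi> - e \<xi>)"
proof -
  have "e (\<xi> - e \<xi>) = 0"
    by (simp add: blinfun.diff_right orth_projection_idem[OF e])
  then have "e (x (\<xi> - e \<xi>)) = 0"
    by (metis comm commute_apply blinfun.zero_right)
  then have "x (\<xi> - e \<xi>) \<bullet> e \<xi> = 0"
    using e by (metis inner_zero_left orth_projection_def symmetric_opD)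
  moreover have "x (e \<xi>) \<bullet> (\<xi> - e \<xi>) = 0"
    using e \<open>e (\<xi> - e \<xi>) = 0\<close> commute_apply[OF comm, of \<xi>]
    by (metis comm commute_apply inner_zero_right orth_projection_def orth_projection_idem symmetric_opD)
  moreover have "x \<xi> = x (e \<xi>) + x (\<xi> - e \<xi>)"
    by (simp add: blinfun.diff_right)
  ultimately show ?thesis
    by (simp add: inner_diff_right inner_add_left algebra_simps)
qed

lemma orth_projection_pythagoras:
  "orth_projection e \<Longrightarrow> \<xi> \<bullet> \<xi> = e \<xi> \<bullet> e \<xi> + (\<xi> - e \<xi>) \<bullet> (\<xi> - e \<xi>)"
proof -
  assume e: "orth_projection e"
  have "id_blinfun o\<^sub>L e = e o\<^sub>L id_blinfun"
    by (rule blinfun_eqI) simp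
  from orth_projection_split[OF e this, of \<xi>] show ?thesis by simp
qed

lemma orth_projection_0: "orth_projection 0"
  by (auto simp: orth_projection_def symmetric_op_0 intro: blinfun_eqI)

lemma orth_projection_id: "orth_projection id_blinfun"
  by (auto simp: orth_projection_def symmetric_op_id intro: blinfun_eqI)

text \<open>
  Here \<open>y\<close> is \<open>max x a\<close>: it equals \<open>a\<close> on the range of \<open>E a\<close> and \<open>x\<close> on the complement.
\<close>

lemma resolves_lower_truncation:
  assumes E: "resolves x E" and y: "y = x - (E a o\<^sub>L x) + a *\<^sub>R E a"
  shows "resolves y (\<lambda>\<mu>. if \<mu> < a then 0 else E \<mu>)"
proof -
  let ?F = "\<lambda>\<mu>. if \<mu> < a then 0 else E \<mu>"
  note proj = resolves_projection[OF E]
  note xE = commute_apply[OF resolves_commute[OF E]]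
  have EE: "E \<mu> (E \<nu> \<xi>) = E \<nu> (E \<mu> \<xi>)" for \<mu> \<nu> \<xi>
    by (cases "\<mu> \<le> \<nu>") (simp_all add: resolves_mono[OF E] resolves_mono'[OF E])
  have y_apply: "y \<xi> = x (\<xi> - E a \<xi>) + a *\<^sub>R E a \<xi>" for \<xi>
    by (simp add: y blinfun.add_left blinfun.diff_left blinfun.scaleR_left blinfun.diff_right xE)
  have yE: "y o\<^sub>L E \<mu> = E \<mu> o\<^sub>L y" for \<mu>
    by (rule blinfun_eqI)
      (simp add: y_apply blinfun.add_right blinfun.diff_right blinfun.scaleR_right xE EE[of \<mu> a])
  have form: "y \<xi> \<bullet> \<xi> = a * (E a \<xi> \<bullet> E a \<xi>) + x (\<xi> - E a \<xi>) \<bullet> (\<xi> - E a \<xi>)" for \<xi>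
    using orth_projection_split[OF proj yE, of \<xi> a]
    by (simp add: y_apply blinfun.diff_right blinfun.zero_right orth_projection_idem[OF proj])
  have rest: "E a (\<xi> - E a \<xi>) = 0" for \<xi>
    by (simp add: blinfun.diff_right orth_projection_idem[OF proj])
  show ?thesis
  proof (rule resolvesI)
    show "orth_projection (?F \<mu>)" for \<mu>
      by (simp add: proj orth_projection_0)
    show "y o\<^sub>L ?F \<mu> = ?F \<mu> o\<^sub>L y" for \<mu>
      by (simp add: yE)
    show "?F \<nu> (?F \<mu> \<xi>) = ?F \<mu> \<xi>" if "\<mu> \<le> \<nu>" for \<mu> \<nu> \<xi>
      using that by (auto simp: resolves_mono[OF E] blinfun.zero_right)
    show "((\<lambda>\<nu>. ?F \<nu> \<xi>) \<longlongrightarrow> ?F \<mu> \<xi>) (at_right \<mu>)" for \<mu> \<xi>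
    proof (cases "\<mu> < a")
      case True
      then have "eventually (\<lambda>\<nu>. ?F \<nu> \<xi> = ?F \<mu> \<xi>) (at_right \<mu>)"
        unfolding eventually_at_right_field by (intro exI[of _ a]) simp
      then show ?thesis by (rule tendsto_eventually)
    next
      case False
      have "eventually (\<lambda>\<nu>. E \<nu> \<xi> = ?F \<nu> \<xi>) (at_right \<mu>)"
        using eventually_at_right_less[of \<mu>] by eventually_elim (use False in simp)
      from Lim_transform_eventually[OF resolves_continuous[OF E] this] False
      show ?thesis by simp
    qed
    show "y \<xi> \<bullet> \<xi> \<le> \<mu> * (\<xi> \<bullet> \<xi>)" if \<xi>: "?F \<mu> \<xi> = \<xi>" for \<mu> \<xi>
    proof (cases "\<mu> < a")
      case True
      then show ?thesis using \<xi> by simp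
    next
      case False
      then have "E \<mu> (\<xi> - E a \<xi>) = \<xi> - E a \<xi>"
        using \<xi> by (simp add: blinfun.diff_right resolves_mono[OF E])
      moreover have "a * (E a \<xi> \<bullet> E a \<xi>) \<le> \<mu> * (E a \<xi> \<bullet> E a \<xi>)"
        using False by (intro mult_right_mono inner_ge_zero) simp
      ultimately show ?thesis
        using resolves_upper[OF E, of \<mu> "\<xi> - E a \<xi>"]
        unfolding form orth_projection_pythagoras[OF proj, of \<xi> a] distrib_left by linarith
    qed
    show "\<mu> * (\<xi> \<bullet> \<xi>) \<le> y \<xi> \<bullet> \<xi>" if \<xi>: "?F \<mu> \<xi> = 0" for \<mu> \<xi>
    proof (cases "\<mu> < a")
      case True
      then have "\<mu> * (\<xi> \<bullet> \<xi>) \<le> a * (\<xi> \<bullet> \<xi>)"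
        by (intro mult_right_mono inner_ge_zero) simp
      also have "\<dots> \<le> y \<xi> \<bullet> \<xi>"
        using resolves_lower[OF E rest[of \<xi>]]
        unfolding form orth_projection_pythagoras[OF proj, of \<xi> a] distrib_left by linarith
      finally show ?thesis .
    next
      case False
      then have "E \<mu> \<xi> = 0" using \<xi> by simp
      moreover from this have "E a \<xi> = 0"
        using False resolves_zero_mono[OF E, of a \<mu>] by simp
      ultimately show ?thesis
        using resolves_lower[OF E, of \<mu> \<xi>] by (simp add: y_apply)
    qed
  qed
qed

text \<open>
  Here \<open>y\<close> is \<open>min x b\<close>: it equals \<open>x\<close> on the range of \<open>E b\<close> and \<open>b\<close> on the complement.
\<close>

lemma resolves_upper_truncation:
  assumes E: "resolves x E" and y: "y = (E b o\<^sub>L x) + b *\<^sub>R (id_blinfun - E b)"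
  shows "resolves y (\<lambda>\<mu>. if \<mu> < b then E \<mu> else id_blinfun)"
proof -
  let ?F = "\<lambda>\<mu>. if \<mu> < b then E \<mu> else id_blinfun"
  note proj = resolves_projection[OF E]
  note xE = commute_apply[OF resolves_commute[OF E]]
  have EE: "E \<mu> (E \<nu> \<xi>) = E \<nu> (E \<mu> \<xi>)" for \<mu> \<nu> \<xi>
    by (cases "\<mu> \<le> \<nu>") (simp_all add: resolves_mono[OF E] resolves_mono'[OF E])
  have y_apply: "y \<xi> = x (E b \<xi>) + b *\<^sub>R (\<xi> - E b \<xi>)" for \<xi>
    by (simp add: y blinfun.add_left blinfun.diff_left blinfun.scaleR_left xE)
  have yE: "y o\<^sub>L E \<mu> = E \<mu> o\<^sub>L y" for \<mu>
    by (rule blinfun_eqI)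
      (simp add: y_apply blinfun.add_right blinfun.diff_right blinfun.scaleR_right xE EE[of \<mu> b])
  have form: "y \<xi> \<bullet> \<xi> = x (E b \<xi>) \<bullet> E b \<xi> + b * ((\<xi> - E b \<xi>) \<bullet> (\<xi> - E b \<xi>))" for \<xi>
    using orth_projection_split[OF proj yE, of \<xi> b]
    by (simp add: y_apply blinfun.diff_right blinfun.zero_right orth_projection_idem[OF proj])
  show ?thesis
  proof (rule resolvesI)
    show "orth_projection (?F \<mu>)" for \<mu>
      by (simp add: proj orth_projection_id)
    show "y o\<^sub>L ?F \<mu> = ?F \<mu> o\<^sub>L y" for \<mu>
      by (auto simp: yE intro: blinfun_eqI)
    show "?F \<nu> (?F \<mu> \<xi>) = ?F \<mu> \<xi>" if "\<mu> \<le> \<nu>" for \<mu> \<nu> \<xi>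
      using that by (auto simp: resolves_mono[OF E])
    show "((\<lambda>\<nu>. ?F \<nu> \<xi>) \<longlongrightarrow> ?F \<mu> \<xi>) (at_right \<mu>)" for \<mu> \<xi>
    proof (cases "\<mu> < b")
      case True
      then have "eventually (\<lambda>\<nu>. E \<nu> \<xi> = ?F \<nu> \<xi>) (at_right \<mu>)"
        unfolding eventually_at_right_field by (intro exI[of _ b]) simp
      from Lim_transform_eventually[OF resolves_continuous[OF E] this] True
      show ?thesis by simp
    next
      case False
      have "eventually (\<lambda>\<nu>. ?F \<nu> \<xi> = ?F \<mu> \<xi>) (at_right \<mu>)"
        using eventually_at_right_less[of \<mu>] by eventually_elim (use False in simp)
      then show ?thesis by (rule tendsto_eventually)
    qed
    show "y \<xi> \<bullet> \<xi> \<le> \<mu> * (\<xi> \<bullet> \<xi>)" if \<xi>: "?F \<mu> \<xi> = \<xi>" for \<mu> \<xi>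
    proof (cases "\<mu> < b")
      case True
      then have "E \<mu> \<xi> = \<xi>" using \<xi> by simp
      moreover from this have "E b \<xi> = \<xi>"
        using True resolves_fixed_mono[OF E, of \<mu> b] by simp
      ultimately show ?thesis
        using resolves_upper[OF E, of \<mu> \<xi>] by (simp add: y_apply)
    next
      case False
      have "y \<xi> \<bullet> \<xi> \<le> b * (\<xi> \<bullet> \<xi>)"
        using resolves_upper[OF E orth_projection_idem[OF proj], of b \<xi>]
        unfolding form orth_projection_pythagoras[OF proj, of \<xi> b] distrib_left by linarith
      also have "\<dots> \<le> \<mu> * (\<xi> \<bullet> \<xi>)"
        using False by (intro mult_right_mono inner_ge_zero) simp
      finally show ?thesis .
    qed
    show "\<mu> * (\<xi> \<bullet> \<xi>) \<le> y \<xi> \<bullet> \<xi>" if \<xi>: "?F \<mu> \<xi> = 0" for \<mu> \<xi>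
    proof (cases "\<mu> < b")
      case True
      then have "E \<mu> (E b \<xi>) = 0"
        using \<xi> by (simp add: EE[of \<mu> b] blinfun.zero_right)
      moreover have "\<mu> * ((\<xi> - E b \<xi>) \<bullet> (\<xi> - E b \<xi>)) \<le> b * ((\<xi> - E b \<xi>) \<bullet> (\<xi> - E b \<xi>))"
        using True by (intro mult_right_mono inner_ge_zero) simp
      ultimately show ?thesis
        using resolves_lower[OF E, of \<mu> "E b \<xi>"]
        unfolding form orth_projection_pythagoras[OF proj, of \<xi> b] distrib_left by linarith
    next
      case False
      then show ?thesis using \<xi> by simp
    qed
  qed
qed

lemma inner_self_le_zero_iff: "x \<bullet> x \<le> 0 \<longleftrightarrow> (x::'a::real_inner) = 0"
  using inner_gt_zero_iff[of x] by (auto simp: not_less[symmetric])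

section \<open>Von Neumann algebras as strongly closed algebras\<close>

lemma strong_operator_limit:
  fixes f :: "nat \<Rightarrow> 'a::real_normed_vector \<Rightarrow>\<^sub>L 'b::real_normed_vector"
  assumes M: "closedin strong_operator_topology M" and f: "\<And>n. f n \<in> M"
    and lim: "\<And>\<xi>. (\<lambda>n. f n \<xi>) \<longlonglongrightarrow> blinfun_apply a \<xi>"
  shows "a \<in> M"
proof (rule ccontr)
  assume "a \<notin> M"
  have "openin strong_operator_topology (- M)"
    using M by (simp add: closedin_def strong_operator_topology_topspace Compl_eq_Diff_UNIV)
  then obtain U where U: "open U" "- M = blinfun_apply -` U"
    by (auto simp: strong_operator_topology_def openin_pullback_topology)
  have "limitin (product_topology (\<lambda>_. euclidean) UNIV) (\<lambda>n. blinfun_apply (f n)) (blinfun_apply a)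
      sequentially"
    using lim by (simp add: limitin_componentwise)
  then have "(\<lambda>n. blinfun_apply (f n)) \<longlonglongrightarrow> blinfun_apply a"
    by (simp add: euclidean_product_topology)
  moreover have "blinfun_apply a \<in> U"
    using \<open>a \<notin> M\<close> U(2) by blast
  ultimately have "eventually (\<lambda>n. blinfun_apply (f n) \<in> U) sequentially"
    using U(1) by (simp add: tendsto_def)
  then obtain n where "blinfun_apply (f n) \<in> U"
    using eventually_happens by force
  then show False
    using f[of n] U(2) by blast
qed

lemma von_neumann_strong_algebra:
  fixes M :: "('a::complex_hilbert \<Rightarrow>\<^sub>L 'a) set"
  assumes "von_neumann_algebra M"
  shows "strong_algebra M"
proof (rule strong_algebraI)
  have M: "\<forall>a\<in>M. \<forall>b\<in>M. a + b \<in> M" "\<forall>c. \<forall>a\<in>M. scaleC_op c a \<in> M" "\<forall>a\<in>M. \<forall>b\<in>M. a o\<^sub>L b \<in> M"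
    and closed: "closedin strong_operator_topology M"
    using assms by (auto simp: von_neumann_algebra_def cstar_subalgebra_def)
  show "a + b \<in> M" "a o\<^sub>L b \<in> M" if "a \<in> M" "b \<in> M" for a b
    using M that by auto
  show "r *\<^sub>R a \<in> M" if "a \<in> M" for r a
  proof -
    have "r *\<^sub>R a = scaleC_op (complex_of_real r) a"
      by (rule blinfun_eqI) (simp add: scaleC_op_apply scaleC_of_real blinfun.scaleR_left)
    then show ?thesis using M(2) that by simp
  qed
  show "a \<in> M" if "\<And>n. f n \<in> M" "\<And>\<xi>. (\<lambda>n. f n \<xi>) \<longlonglongrightarrow> blinfun_apply a \<xi>"
    for f :: "nat \<Rightarrow> 'a \<Rightarrow>\<^sub>L 'a" and a
    by (rule strong_operator_limit[OF closed that])
qed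

lemma von_neumann_complex_linear: "von_neumann_algebra M \<Longrightarrow> a \<in> M \<Longrightarrow> complex_linear_op a"
  by (auto simp: von_neumann_algebra_def cstar_subalgebra_def)

lemma sa_part_iff:
  "von_neumann_algebra M \<Longrightarrow> a \<in> sa_part M \<longleftrightarrow> a \<in> M \<and> symmetric_op a"
  using von_neumann_complex_linear by (auto simp: sa_part_def selfadjoint_op_iff)

text \<open>
  The left multipliers of \<open>M\<close> form a unital strongly closed algebra containing \<open>M\<close>. This replaces an
  adjunction of the identity to \<open>M\<close>.
\<close>

lemma generated_algebra_multiplier:
  fixes x :: "'a::real_normed_vector \<Rightarrow>\<^sub>L 'a"
  assumes M: "strong_algebra M" and x: "x \<in> M" and y: "y \<in> generated_algebra x" and m: "m \<in> M"
  shows "y o\<^sub>L m \<in> M"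
proof -
  let ?L = "{y. \<forall>m\<in>M. y o\<^sub>L m \<in> M}"
  have "strong_algebra ?L"
  proof (rule strong_algebraI)
    fix a b assume ab: "a \<in> ?L" "b \<in> ?L"
    have "(a + b) o\<^sub>L m = (a o\<^sub>L m) + (b o\<^sub>L m)" "(a o\<^sub>L b) o\<^sub>L m = a o\<^sub>L (b o\<^sub>L m)"
      for m :: "'a \<Rightarrow>\<^sub>L 'a"
      by (auto intro!: blinfun_eqI simp: blinfun.add_left)
    then show "a + b \<in> ?L" "a o\<^sub>L b \<in> ?L"
      using ab strong_algebra_add[OF M] by simp_all
  next
    fix r a assume a: "a \<in> ?L"
    have "(r *\<^sub>R a) o\<^sub>L m = r *\<^sub>R (a o\<^sub>L m)" for m :: "'a \<Rightarrow>\<^sub>L 'a"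
      by (auto intro!: blinfun_eqI simp: blinfun.scaleR_left)
    then show "r *\<^sub>R a \<in> ?L"
      using a strong_algebra_scaleR[OF M] by simp
  next
    fix f :: "nat \<Rightarrow> 'a \<Rightarrow>\<^sub>L 'a" and a :: "'a \<Rightarrow>\<^sub>L 'a"
    assume f: "f n \<in> ?L" and lim: "(\<lambda>n. f n \<xi>) \<longlonglongrightarrow> a \<xi>" for n \<xi>
    have "a o\<^sub>L m \<in> M" if "m \<in> M" for m
    proof (rule strong_algebra_limit[OF M])
      show "f n o\<^sub>L m \<in> M" for n
        using f that by simp
      show "(\<lambda>n. (f n o\<^sub>L m) \<xi>) \<longlonglongrightarrow> (a o\<^sub>L m) \<xi>" for \<xi>
        using lim by simp
    qed
    then show "a \<in> ?L" by simp
  qed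
  moreover have "id_blinfun o\<^sub>L m = m" for m :: "'a \<Rightarrow>\<^sub>L 'a"
    by (rule blinfun_eqI) simp
  ultimately have "y \<in> ?L"
    using generated_algebra_least[of ?L x y] strong_algebra_compose[OF M x] y by simp
  then show ?thesis using m by simp
qed

text \<open>
  A projection with the same kernel as \<open>a\<close> is \<open>id\<close> minus the kernel projection of \<open>a\<close>.
\<close>

lemma range_projection_in_algebra:
  fixes a :: "'a::{real_inner,banach} \<Rightarrow>\<^sub>L 'a"
  assumes M: "strong_algebra M" "a \<in> M" and a: "symmetric_op a"
    and p: "orth_projection p" and ker: "\<And>\<xi>. p \<xi> = 0 \<longleftrightarrow> a \<xi> = 0"
  shows "p \<in> M"
proof -
  obtain q where q: "orth_projection q" "\<And>\<xi>. q \<xi> = \<xi> \<longleftrightarrow> a \<xi> = 0" "id_blinfun - q \<in> M"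
    using kernel_projection[OF a] M by metis
  have pq: "p (q \<xi>) = 0" for \<xi>
    unfolding ker q(2)[symmetric] by (rule orth_projection_idem[OF q(1)])
  have "q (p \<xi>) = 0" for \<xi>
  proof -
    have "q (p \<xi>) \<bullet> q (p \<xi>) = \<xi> \<bullet> p (q (q (p \<xi>)))"
      using p q(1) unfolding orth_projection_def symmetric_op_def by metis
    then show ?thesis by (simp add: pq)
  qed
  moreover have "q (\<xi> - p \<xi>) = \<xi> - p \<xi>" for \<xi>
    unfolding q(2) ker[symmetric] by (simp add: blinfun.diff_right orth_projection_idem[OF p])
  ultimately have "p = id_blinfun - q"
    by (intro blinfun_eqI) (simp add: blinfun.diff_left blinfun.diff_right algebra_simps)
  with q(3) show ?thesis by simp
qed

text \<open>
  For \<open>\<mu> < 0\<close> the form of \<open>x\<close> is strictly negative on the range of \<open>E \<mu>\<close>, so \<open>E \<mu>\<close> is the range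
  projection of \<open>E \<mu> x \<in> M\<close>. For \<open>\<mu> > 0\<close> the same reasoning applies to \<open>id - E \<mu>\<close> and
  \<open>(id - E \<mu>) x\<close>.
\<close>

lemma spectral_family_in_algebra:
  assumes M: "von_neumann_algebra M" and x: "x \<in> sa_part M"
  shows "\<mu> < 0 \<Longrightarrow> spectral_family x \<mu> \<in> M"
    and "0 < \<mu> \<Longrightarrow> id_blinfun - spectral_family x \<mu> \<in> M"
    and "spectral_family x \<mu> o\<^sub>L x \<in> M"
proof -
  have sa: "selfadjoint_op x" and sym: "symmetric_op x" and xM: "x \<in> M"
    using x by (auto simp: sa_part_def selfadjoint_op_iff)
  note MA = von_neumann_strong_algebra[OF M]
  note E = resolves_spectral_family[OF sa]
  note gen = spectral_family_generated[OF sa]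
  note proj = resolves_projection[OF E, of \<mu>]
  let ?E = "spectral_family x \<mu>"
  have Ex: "?E (x \<xi>) = x (?E \<xi>)" for \<xi>
    by (rule commute_apply[OF resolves_commute[OF E, symmetric]])
  show ExM: "?E o\<^sub>L x \<in> M"
    by (rule generated_algebra_multiplier[OF MA xM gen xM])
  show "?E \<in> M" if neg: "\<mu> < 0"
  proof (rule range_projection_in_algebra[OF MA ExM _ proj])
    show "symmetric_op (?E o\<^sub>L x)"
      by (rule generated_algebra_symmetric[OF sym])
        (intro strong_algebra_compose strong_algebra_generated gen generated_algebra_self)
    show "?E \<xi> = 0 \<longleftrightarrow> (?E o\<^sub>L x) \<xi> = 0" for \<xi>
    proof
      assume "(?E o\<^sub>L x) \<xi> = 0"
      then have "0 \<le> \<mu> * (?E \<xi> \<bullet> ?E \<xi>)"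
        using resolves_upper[OF E orth_projection_idem[OF proj], of \<xi>] by (simp add: Ex)
      then show "?E \<xi> = 0"
        using neg by (simp add: zero_le_mult_iff inner_self_le_zero_iff)
    qed (simp add: Ex blinfun.zero_right)
  qed
  show "id_blinfun - ?E \<in> M" if pos: "0 < \<mu>"
  proof (rule range_projection_in_algebra[OF MA _ _ orth_projection_complement[OF proj]])
    show "x - (?E o\<^sub>L x) \<in> M"
      by (rule strong_algebra_diff[OF MA xM ExM])
    show "symmetric_op (x - (?E o\<^sub>L x))"
      by (rule generated_algebra_symmetric[OF sym])
        (intro strong_algebra_diff strong_algebra_compose strong_algebra_generated gen
          generated_algebra_self)
    show "(id_blinfun - ?E) \<xi> = 0 \<longleftrightarrow> (x - (?E o\<^sub>L x)) \<xi> = 0" for \<xi>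
    proof
      let ?\<zeta> = "\<xi> - ?E \<xi>"
      assume "(x - (?E o\<^sub>L x)) \<xi> = 0"
      then have "x ?\<zeta> = 0"
        by (simp add: blinfun.diff_left blinfun.diff_right Ex)
      moreover have "?E ?\<zeta> = 0"
        by (simp add: blinfun.diff_right orth_projection_idem[OF proj])
      ultimately have "\<mu> * (?\<zeta> \<bullet> ?\<zeta>) \<le> 0"
        using resolves_lower[OF E, of \<mu> ?\<zeta>] by simp
      then show "(id_blinfun - ?E) \<xi> = 0"
        using pos by (simp add: mult_le_0_iff inner_self_le_zero_iff blinfun.diff_left)
    qed (simp add: Ex blinfun.diff_left)
  qed
qed

section \<open>Intervals in the spectral order\<close>

text \<open>
  The least element of the up-set \<open>A\<close> above \<open>u\<close> lies below every element of \<open>A \<inter> B\<close> above \<open>u\<close>, so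
  it belongs to the down-set \<open>B\<close> as soon as there is such an element; dually for \<open>B\<close>.
\<close>

lemma subtopology_spectral_interval:
  assumes antisym: "\<And>u v. u \<in> S \<Longrightarrow> v \<in> S \<Longrightarrow> spectral_le u v \<Longrightarrow> spectral_le v u \<Longrightarrow> u = v"
    and A: "A \<subseteq> S" "\<And>x u. x \<in> A \<Longrightarrow> u \<in> S \<Longrightarrow> spectral_le x u \<Longrightarrow> u \<in> A"
      "\<And>u. u \<in> S \<Longrightarrow> \<exists>v. least_above A u v"
    and B: "B \<subseteq> S" "\<And>x u. x \<in> B \<Longrightarrow> u \<in> S \<Longrightarrow> spectral_le u x \<Longrightarrow> u \<in> B"
      "\<And>u. u \<in> S \<Longrightarrow> \<exists>v. greatest_below B u v"
  shows "subtopology (\<tau>\<^sub>o S) (A \<inter> B) = \<tau>\<^sub>o (A \<inter> B)"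
proof (rule subtopology_spectral_order[OF _ antisym])
  show "A \<inter> B \<subseteq> S" using A(1) by blast
  show "\<exists>v. least_above (A \<inter> B) u v" if u: "u \<in> S" "x \<in> A \<inter> B" "spectral_le u x" for u x
  proof -
    obtain v where v: "v \<in> A" "spectral_le u v" "\<And>w. w \<in> A \<Longrightarrow> spectral_le u w \<Longrightarrow> spectral_le v w"
      using A(3)[OF u(1)] unfolding least_above_def by blast
    then have "v \<in> B"
      using B(2)[of x v] A(1) u by blast
    with v have "least_above (A \<inter> B) u v"
      unfolding least_above_def by blast
    then show ?thesis ..
  qed
  show "\<exists>v. greatest_below (A \<inter> B) u v" if u: "u \<in> S" "x \<in> A \<inter> B" "spectral_le x u" for u x
  proof -
    obtain v where v: "v \<in> B" "spectral_le v u" "\<And>w. w \<in> B \<Longrightarrow> spectral_le w u \<Longrightarrow> spectral_le w v"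
      using B(3)[OF u(1)] unfolding greatest_below_def by blast
    then have "v \<in> A"
      using A(2)[of x v] B(1) u by blast
    with v have "greatest_below (A \<inter> B) u v"
      unfolding greatest_below_def by blast
    then show ?thesis ..
  qed
qed

definition sa_above :: "real \<Rightarrow> ('a::complex_hilbert \<Rightarrow>\<^sub>L 'a) set \<Rightarrow> ('a \<Rightarrow>\<^sub>L 'a) set" where
  "sa_above a M = {x \<in> sa_part M. \<forall>\<xi>. a * (\<xi> \<bullet> \<xi>) \<le> x \<xi> \<bullet> \<xi>}"

definition sa_below :: "real \<Rightarrow> ('a::complex_hilbert \<Rightarrow>\<^sub>L 'a) set \<Rightarrow> ('a \<Rightarrow>\<^sub>L 'a) set" where
  "sa_below b M = {x \<in> sa_part M. \<forall>\<xi>. x \<xi> \<bullet> \<xi> \<le> b * (\<xi> \<bullet> \<xi>)}"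

lemma sa_part_selfadjoint: "x \<in> sa_part M \<Longrightarrow> selfadjoint_op x"
  by (simp add: sa_part_def)

lemma sa_above_upward: "x \<in> sa_above a M \<Longrightarrow> u \<in> sa_part M \<Longrightarrow> spectral_le x u \<Longrightarrow> u \<in> sa_above a M"
  using form_lower_bound_mono[of x u a] sa_part_selfadjoint[of x M] sa_part_selfadjoint[of u M]
  by (simp add: sa_above_def)

lemma sa_below_downward: "x \<in> sa_below b M \<Longrightarrow> u \<in> sa_part M \<Longrightarrow> spectral_le u x \<Longrightarrow> u \<in> sa_below b M"
  using form_upper_bound_mono[of u x b] sa_part_selfadjoint[of x M] sa_part_selfadjoint[of u M]
  by (simp add: sa_below_def)

text \<open>
  The truncation \<open>v = max u a\<close> lies in \<open>M\<close> because \<open>a *\<^sub>R E a\<close> does: \<open>E a\<close> is in \<open>M\<close> for \<open>a < 0\<close>, and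
  for \<open>a = 0\<close> the term vanishes. It is the least solution since every competitor \<open>w\<close> has spectral
  family \<open>0\<close> to the left of \<open>a\<close>.
\<close>

lemma least_in_sa_above:
  assumes M: "von_neumann_algebra M" and a: "a \<le> 0" and u: "u \<in> sa_part M"
  shows "\<exists>v. least_above (sa_above a M) u v"
proof -
  note sa = sa_part_selfadjoint[OF u]
  note MA = von_neumann_strong_algebra[OF M]
  define E where "E = spectral_family u"
  note E = resolves_spectral_family[OF sa, folded E_def]
  note gen = spectral_family_generated[OF sa, folded E_def]
  note inM = spectral_family_in_algebra[OF M u, folded E_def]
  define v where "v = u - (E a o\<^sub>L u) + a *\<^sub>R E a"
  have uM: "u \<in> M" and sym: "symmetric_op u"
    using u by (auto simp: sa_part_iff[OF M])
  have "a *\<^sub>R E a \<in> M"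
    using a inM(1)[of a] strong_algebra_scaleR[OF MA] strong_algebra_scaleR[OF MA uM, of 0]
    by (cases "a = 0") auto
  then have "v \<in> M"
    unfolding v_def by (intro strong_algebra_add strong_algebra_diff MA uM inM(3))
  moreover have "symmetric_op v"
    by (rule generated_algebra_symmetric[OF sym], unfold v_def)
      (intro strong_algebra_add strong_algebra_diff strong_algebra_compose strong_algebra_scaleR
        strong_algebra_generated gen generated_algebra_self)
  ultimately have v: "v \<in> sa_part M"
    by (simp add: sa_part_iff[OF M])
  note sav = sa_part_selfadjoint[OF v]
  have F: "spectral_family v = (\<lambda>\<mu>. if \<mu> < a then 0 else E \<mu>)"
    by (rule spectral_family_eqI[OF sav resolves_lower_truncation[OF E v_def]])
  have "v \<in> sa_above a M"
    using v form_lower_bound_iff[OF sav, of a] by (simp add: sa_above_def F)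
  moreover have "spectral_le u v"
    unfolding spectral_le_iff[OF sa sav] F
    by (auto simp: E_def blinfun.zero_right split: if_splits)
  moreover have "spectral_le v w" if w: "w \<in> sa_above a M" "spectral_le u w" for w
  proof -
    have saw: "selfadjoint_op w" and bound: "\<forall>\<xi>. a * (\<xi> \<bullet> \<xi>) \<le> w \<xi> \<bullet> \<xi>"
      using w(1) by (auto simp: sa_above_def sa_part_selfadjoint)
    have "\<mu> < a \<Longrightarrow> spectral_family w \<mu> = 0" for \<mu>
      using bound form_lower_bound_iff[OF saw, of a] by blast
    then show ?thesis
      using w(2) unfolding spectral_le_iff[OF sav saw] spectral_le_iff[OF sa saw] F
      by (simp add: E_def) 
  qed
  ultimately show ?thesis
    unfolding least_above_def by blast
qed

lemma greatest_in_sa_below: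
  assumes M: "von_neumann_algebra M" and b: "0 \<le> b" and u: "u \<in> sa_part M"
  shows "\<exists>v. greatest_below (sa_below b M) u v"
proof -
  note sa = sa_part_selfadjoint[OF u]
  note MA = von_neumann_strong_algebra[OF M]
  define E where "E = spectral_family u"
  note E = resolves_spectral_family[OF sa, folded E_def]
  note gen = spectral_family_generated[OF sa, folded E_def]
  note inM = spectral_family_in_algebra[OF M u, folded E_def]
  define v where "v = (E b o\<^sub>L u) + b *\<^sub>R (id_blinfun - E b)"
  have uM: "u \<in> M" and sym: "symmetric_op u"
    using u by (auto simp: sa_part_iff[OF M])
  have "b *\<^sub>R (id_blinfun - E b) \<in> M"
    using b inM(2)[of b] strong_algebra_scaleR[OF MA] strong_algebra_scaleR[OF MA uM, of 0]
    by (cases "b = 0") auto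
  then have "v \<in> M"
    unfolding v_def by (intro strong_algebra_add MA inM(3))
  moreover have "symmetric_op v"
    by (rule generated_algebra_symmetric[OF sym], unfold v_def)
      (intro strong_algebra_add strong_algebra_diff strong_algebra_compose strong_algebra_scaleR
        strong_algebra_generated gen generated_algebra_self generated_algebra_id)
  ultimately have v: "v \<in> sa_part M"
    by (simp add: sa_part_iff[OF M])
  note sav = sa_part_selfadjoint[OF v]
  have F: "spectral_family v = (\<lambda>\<mu>. if \<mu> < b then E \<mu> else id_blinfun)"
    by (rule spectral_family_eqI[OF sav resolves_upper_truncation[OF E v_def]])
  have "v \<in> sa_below b M"
    using v form_upper_bound_iff[OF sav, of b] by (simp add: sa_below_def F)
  moreover have "spectral_le v u"
    unfolding spectral_le_iff[OF sav sa] F by (simp add: E_def)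
  moreover have "spectral_le w v" if w: "w \<in> sa_below b M" "spectral_le w u" for w
  proof -
    have saw: "selfadjoint_op w" and bound: "\<forall>\<xi>. w \<xi> \<bullet> \<xi> \<le> b * (\<xi> \<bullet> \<xi>)"
      using w(1) by (auto simp: sa_below_def sa_part_selfadjoint)
    have "spectral_family w \<mu> = id_blinfun" if "\<not> \<mu> < b" for \<mu>
      using resolves_above[OF resolves_spectral_family[OF saw], of b \<mu>] bound that by simp
    then show ?thesis
      using w(2) unfolding spectral_le_iff[OF saw sav] spectral_le_iff[OF saw sa] F
      by (simp add: E_def)
  qed
  ultimately show ?thesis
    unfolding greatest_below_def by blast
qed

lemma pos_part_eq: "pos_part M = sa_above 0 M \<inter> sa_part M"
  by (auto simp: pos_part_def sa_above_def sa_part_def positive_op_iff)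

lemma sa_unit_ball_eq:
  "sa_unit_ball M = sa_above (- 1) M \<inter> sa_below 1 M"
proof -
  have "norm x \<le> 1 \<longleftrightarrow> (\<forall>\<xi>. - (\<xi> \<bullet> \<xi>) \<le> x \<xi> \<bullet> \<xi>) \<and> (\<forall>\<xi>. x \<xi> \<bullet> \<xi> \<le> \<xi> \<bullet> \<xi>)"
    if "x \<in> sa_part M" for x
  proof
    assume n: "norm x \<le> 1"
    have "\<bar>x \<xi> \<bullet> \<xi>\<bar> \<le> \<xi> \<bullet> \<xi>" for \<xi>
      using form_le_norm[of x \<xi>] mult_right_mono[OF n inner_ge_zero[of \<xi>]] by simp
    then show "(\<forall>\<xi>. - (\<xi> \<bullet> \<xi>) \<le> x \<xi> \<bullet> \<xi>) \<and> (\<forall>\<xi>. x \<xi> \<bullet> \<xi> \<le> \<xi> \<bullet> \<xi>)"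
      by (simp add: abs_le_iff minus_le_iff)
  next
    assume "(\<forall>\<xi>. - (\<xi> \<bullet> \<xi>) \<le> x \<xi> \<bullet> \<xi>) \<and> (\<forall>\<xi>. x \<xi> \<bullet> \<xi> \<le> \<xi> \<bullet> \<xi>)"
    then show "norm x \<le> 1"
      using sa_part_selfadjoint[OF that]
      by (intro norm_le_of_form_le) (auto simp: selfadjoint_op_iff abs_le_iff minus_le_iff)
  qed
  then show ?thesis
    by (auto simp: sa_unit_ball_def sa_above_def sa_below_def)
qed

lemma effects_eq: "effects M = sa_above 0 M \<inter> sa_below 1 M"
proof -
  have "sa_above 0 M \<subseteq> sa_above (- 1) M"
    by (auto simp: sa_above_def intro: order_trans[of _ 0])
  moreover have "sa_below 1 M \<subseteq> sa_part M"
    by (auto simp: sa_below_def)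
  ultimately show ?thesis
    unfolding effects_def pos_part_eq sa_unit_ball_eq by blast
qed

lemma subtopology_sa_interval:
  assumes M: "von_neumann_algebra M" and a: "a \<le> 0" and b: "0 \<le> b"
  shows "subtopology (\<tau>\<^sub>o (sa_part M)) (sa_above a M \<inter> sa_below b M) = \<tau>\<^sub>o (sa_above a M \<inter> sa_below b M)"
    and "subtopology (\<tau>\<^sub>o (sa_part M)) (sa_above a M \<inter> sa_part M) = \<tau>\<^sub>o (sa_above a M \<inter> sa_part M)"
proof -
  note antisym = spectral_le_antisym[OF sa_part_selfadjoint sa_part_selfadjoint]
  have sub: "sa_above a M \<subseteq> sa_part M" "sa_below b M \<subseteq> sa_part M"
    by (auto simp: sa_above_def sa_below_def)
  have triv: "\<exists>v. greatest_below (sa_part M) u v" if "u \<in> sa_part M" for u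
    using that spectral_le_refl by (intro exI[of _ u]) (simp add: greatest_below_def)
  show "subtopology (\<tau>\<^sub>o (sa_part M)) (sa_above a M \<inter> sa_below b M) = \<tau>\<^sub>o (sa_above a M \<inter> sa_below b M)"
    by (rule subtopology_spectral_interval[OF antisym sub(1) sa_above_upward
          least_in_sa_above[OF M a] sub(2) sa_below_downward greatest_in_sa_below[OF M b]])
  show "subtopology (\<tau>\<^sub>o (sa_part M)) (sa_above a M \<inter> sa_part M) = \<tau>\<^sub>o (sa_above a M \<inter> sa_part M)"
    by (rule subtopology_spectral_interval[OF antisym sub(1) sa_above_upward
          least_in_sa_above[OF M a] subset_refl _ triv])
qed

section \<open>Projections among the effects\<close>

lemma effects_selfadjoint: "u \<in> effects M \<Longrightarrow> selfadjoint_op u"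
  and effects_nonneg: "u \<in> effects M \<Longrightarrow> 0 \<le> u \<xi> \<bullet> \<xi>"
  and effects_le_one: "u \<in> effects M \<Longrightarrow> u \<xi> \<bullet> \<xi> \<le> \<xi> \<bullet> \<xi>"
  by (auto simp: effects_eq sa_above_def sa_below_def sa_part_def)

lemma projections_effects: "projections M \<subseteq> effects M"
proof
  fix p assume p: "p \<in> projections M"
  then have "orth_projection p" and "p \<in> sa_part M"
    by (simp_all add: projections_def projection_op_iff sa_part_def selfadjoint_op_iff
        orth_projection_def)
  then show "p \<in> effects M"
    using orth_projection_form_le[of p] by (simp add: effects_eq sa_above_def sa_below_def orth_projection_form)
qed

lemma effects_family_below: "u \<in> effects M \<Longrightarrow> \<mu> < 0 \<Longrightarrow> spectral_family u \<mu> = 0"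
  using resolves_below[OF resolves_spectral_family[OF effects_selfadjoint], of u M 0]
  by (simp add: effects_nonneg)

lemma effects_family_above: "u \<in> effects M \<Longrightarrow> 1 \<le> \<mu> \<Longrightarrow> spectral_family u \<mu> = id_blinfun"
  using resolves_above[OF resolves_spectral_family[OF effects_selfadjoint], of u M 1]
  by (simp add: effects_le_one)

text \<open>
  For an effect, \<open>spectral_family u 0\<close> is the projection onto the kernel.
\<close>

lemma effect_kernel:
  assumes u: "u \<in> effects M"
  shows "u \<xi> = 0 \<Longrightarrow> 0 \<le> \<mu> \<Longrightarrow> spectral_family u \<mu> \<xi> = \<xi>"
    and "spectral_family u 0 \<xi> = \<xi> \<Longrightarrow> u \<xi> = 0"
proof -
  note sa = effects_selfadjoint[OF u]
  note E = resolves_spectral_family[OF sa]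
  show "spectral_family u \<mu> \<xi> = \<xi>" if u0: "u \<xi> = 0" and "0 \<le> \<mu>"
  proof -
    have pos: "spectral_family u \<nu> \<xi> = \<xi>" if "0 < \<nu>" for \<nu>
    proof -
      let ?\<zeta> = "\<xi> - spectral_family u \<nu> \<xi>"
      have "u ?\<zeta> = 0"
        using commute_apply[OF resolves_commute[OF E], of \<nu> \<xi>]
        by (simp add: blinfun.diff_right u0 blinfun.zero_right)
      moreover have "spectral_family u \<nu> ?\<zeta> = 0"
        by (simp add: blinfun.diff_right orth_projection_idem[OF resolves_projection[OF E]])
      ultimately have "\<nu> * (?\<zeta> \<bullet> ?\<zeta>) \<le> 0"
        using resolves_lower[OF E, of \<nu> ?\<zeta>] by simp
      then show ?thesis
        using that by (simp add: mult_le_0_iff inner_self_le_zero_iff)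
    qed
    have "eventually (\<lambda>\<nu>. spectral_family u \<nu> \<xi> = \<xi>) (at_right \<mu>)"
      using eventually_at_right_less[of \<mu>] by eventually_elim (use pos \<open>0 \<le> \<mu>\<close> in auto)
    then show ?thesis
      using tendsto_unique[OF trivial_limit_at_right_real resolves_continuous[OF E] tendsto_eventually]
      by blast
  qed
  show "u \<xi> = 0" if "spectral_family u 0 \<xi> = \<xi>"
  proof (rule positive_form_kernel)
    show "symmetric_op u" using sa by (simp add: selfadjoint_op_iff)
    show "0 \<le> u \<eta> \<bullet> \<eta>" for \<eta> by (rule effects_nonneg[OF u])
    show "u \<xi> \<bullet> \<xi> = 0"
      using resolves_upper[OF E that] effects_nonneg[OF u, of \<xi>] by simp
  qed
qed

text \<open>
  The eigenspace of an effect for the eigenvalue \<open>1\<close> is orthogonal to all spectral projections at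
  levels below \<open>1\<close>, and it is exactly the space of vectors with this property.
\<close>

lemma effect_eigenvalue_one:
  assumes u: "u \<in> effects M"
  shows "u \<xi> = \<xi> \<Longrightarrow> \<mu> < 1 \<Longrightarrow> spectral_family u \<mu> \<xi> = 0"
    and "(\<And>\<mu>. \<mu> < 1 \<Longrightarrow> spectral_family u \<mu> \<xi> = 0) \<Longrightarrow> u \<xi> = \<xi>"
proof -
  note sa = effects_selfadjoint[OF u]
  note E = resolves_spectral_family[OF sa]
  show "spectral_family u \<mu> \<xi> = 0" if "u \<xi> = \<xi>" "\<mu> < 1"
  proof -
    let ?\<eta> = "spectral_family u \<mu> \<xi>"
    have "u ?\<eta> = ?\<eta>"
      using commute_apply[OF resolves_commute[OF E], of \<mu> \<xi>] that(1) by simp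
    then have "?\<eta> \<bullet> ?\<eta> \<le> \<mu> * (?\<eta> \<bullet> ?\<eta>)"
      using resolves_upper[OF E, of \<mu> ?\<eta>]
      by (simp add: orth_projection_idem[OF resolves_projection[OF E]])
    then have "(1 - \<mu>) * (?\<eta> \<bullet> ?\<eta>) \<le> 0"
      by (simp add: left_diff_distrib)
    then show ?thesis
      using that(2) by (simp add: mult_le_0_iff inner_self_le_zero_iff)
  qed
  show "u \<xi> = \<xi>" if zero: "\<And>\<mu>. \<mu> < 1 \<Longrightarrow> spectral_family u \<mu> \<xi> = 0"
  proof -
    have "\<xi> \<bullet> \<xi> - u \<xi> \<bullet> \<xi> \<le> \<epsilon> * (\<xi> \<bullet> \<xi>)" if "0 < \<epsilon>" for \<epsilon>
      using resolves_lower[OF E zero[of "1 - \<epsilon>"]] that by (simp add: left_diff_distrib)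
    then have "\<xi> \<bullet> \<xi> - u \<xi> \<bullet> \<xi> \<le> 0"
      by (rule nonpos_of_le_multiples) simp_all
    then have "(id_blinfun - u) \<xi> \<bullet> \<xi> = 0"
      using effects_le_one[OF u, of \<xi>] by (simp add: blinfun.diff_left inner_diff_left)
    then have "(id_blinfun - u) \<xi> = 0"
      using sa effects_le_one[OF u]
      by (intro positive_form_kernel)
        (auto simp: selfadjoint_op_iff blinfun.diff_left inner_diff_left
          intro: symmetric_op_diff symmetric_op_id)
    then show ?thesis by (simp add: blinfun.diff_left)
  qed
qed

text \<open>
  If \<open>\<xi>\<close> is in the range of the spectral projection of \<open>q\<close> at a level below \<open>1\<close>, then so is \<open>q \<xi>\<close>,
  which is an eigenvector for the eigenvalue \<open>1\<close> and hence zero.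
\<close>

lemma projection_family:
  assumes q: "q \<in> projections M" and \<mu>: "0 \<le> \<mu>" "\<mu> < 1"
  shows "spectral_family q \<mu> \<xi> = \<xi> \<longleftrightarrow> q \<xi> = 0"
proof
  have qe: "q \<in> effects M" and proj: "orth_projection q"
    using q projections_effects by (auto simp: projections_def projection_op_iff)
  note E = resolves_spectral_family[OF effects_selfadjoint[OF qe]]
  show "spectral_family q \<mu> \<xi> = \<xi>" if "q \<xi> = 0"
    using effect_kernel(1)[OF qe that \<mu>(1)] .
  assume "spectral_family q \<mu> \<xi> = \<xi>"
  then have "spectral_family q \<mu> (q \<xi>) = q \<xi>"
    using commute_apply[OF resolves_commute[OF E], of \<mu> \<xi>] by simp
  then show "q \<xi> = 0"
    using effect_eigenvalue_one(1)[OF qe orth_projection_idem[OF proj] \<mu>(2)] by simp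
qed

text \<open>
  The spectral family of a projection is constant on \<open>[0, 1)\<close>, where it is the kernel projection, so
  only the smallest spectral projection of \<open>u\<close> on that interval counts.
\<close>

lemma effect_le_projection_iff:
  assumes u: "u \<in> effects M" and q: "q \<in> projections M"
  shows "spectral_le u q \<longleftrightarrow> (\<forall>\<xi>. q \<xi> = 0 \<longrightarrow> u \<xi> = 0)"
proof -
  have qe: "q \<in> effects M"
    using q projections_effects by blast
  note le = spectral_le_iff[OF effects_selfadjoint[OF u] effects_selfadjoint[OF qe]]
  show ?thesis
  proof
    assume "spectral_le u q"
    then show "\<forall>\<xi>. q \<xi> = 0 \<longrightarrow> u \<xi> = 0"
      unfolding le using effect_kernel[OF u] effect_kernel[OF qe] by (meson order_refl)
  next
    assume ker: "\<forall>\<xi>. q \<xi> = 0 \<longrightarrow> u \<xi> = 0"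
    show "spectral_le u q"
      unfolding le
    proof (intro allI impI)
      fix \<mu> \<xi> assume fixed: "spectral_family q \<mu> \<xi> = \<xi>"
      consider "\<mu> < 0" | "0 \<le> \<mu>" "\<mu> < 1" | "1 \<le> \<mu>" by linarith
      then show "spectral_family u \<mu> \<xi> = \<xi>"
      proof cases
        case 1
        then show ?thesis
          using fixed effects_family_below[OF qe] by (simp add: blinfun.zero_right)
      next
        case 2
        then show ?thesis
          using fixed ker projection_family[OF q] effect_kernel(1)[OF u] by blast
      next
        case 3
        then show ?thesis by (simp add: effects_family_above[OF u])
      qed
    qed
  qed
qed

text \<open>
  Dually to the preceding lemma, all spectral projections of \<open>u\<close> at levels below \<open>1\<close> have to be
  orthogonal to \<open>q\<close>.
\<close>

lemma projection_le_effect_iff: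
  assumes u: "u \<in> effects M" and q: "q \<in> projections M"
  shows "spectral_le q u \<longleftrightarrow> (\<forall>\<xi>. q \<xi> = \<xi> \<longrightarrow> u \<xi> = \<xi>)"
proof -
  have qe: "q \<in> effects M" and proj: "orth_projection q"
    using q projections_effects by (auto simp: projections_def projection_op_iff)
  note le = spectral_le_iff[OF effects_selfadjoint[OF qe] effects_selfadjoint[OF u]]
  have E: "orth_projection (spectral_family u \<mu>)" and F: "orth_projection (spectral_family q \<mu>)" for \<mu>
    using u qe by (auto intro: resolves_projection resolves_spectral_family effects_selfadjoint)
  have sym: "p \<eta> \<bullet> \<zeta> = \<eta> \<bullet> p \<zeta>" if "orth_projection p" for p :: "'a \<Rightarrow>\<^sub>L 'a" and \<eta> \<zeta>
    using that unfolding orth_projection_def by (blast intro: symmetric_opD)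
  show ?thesis
  proof
    assume qu: "spectral_le q u"
    show "\<forall>\<xi>. q \<xi> = \<xi> \<longrightarrow> u \<xi> = \<xi>"
    proof (intro allI impI effect_eigenvalue_one(2)[OF u])
      fix \<xi> \<mu> assume \<xi>: "q \<xi> = \<xi>" and \<mu>: "\<mu> < (1::real)"
      let ?\<zeta> = "spectral_family u \<mu> \<xi>"
      have "spectral_family q \<mu> ?\<zeta> = ?\<zeta>"
        using qu orth_projection_idem[OF E] unfolding le by blast
      then have "\<xi> \<bullet> ?\<zeta> = spectral_family q \<mu> \<xi> \<bullet> ?\<zeta>"
        by (simp add: sym[OF F])
      also have "\<dots> = 0"
        by (simp add: effect_eigenvalue_one(1)[OF qe \<xi> \<mu>])
      finally show "?\<zeta> = 0"
        using orth_projection_form[OF E, of \<mu> \<xi>] by (simp add: inner_commute)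
    qed
  next
    assume eig: "\<forall>\<xi>. q \<xi> = \<xi> \<longrightarrow> u \<xi> = \<xi>"
    show "spectral_le q u"
      unfolding le
    proof (intro allI impI)
      fix \<mu> \<xi> assume fixed: "spectral_family u \<mu> \<xi> = \<xi>"
      consider "\<mu> < 0" | "0 \<le> \<mu>" "\<mu> < 1" | "1 \<le> \<mu>" by linarith
      then show "spectral_family q \<mu> \<xi> = \<xi>"
      proof cases
        case 1
        then show ?thesis
          using fixed effects_family_below[OF u] by (simp add: blinfun.zero_right)
      next
        case 2
        have "u (q \<xi>) = q \<xi>"
          using eig orth_projection_idem[OF proj] by blast
        then have "spectral_family u \<mu> (q \<xi>) = 0"
          using effect_eigenvalue_one(1)[OF u _ 2(2)] by blast
        then have "q \<xi> \<bullet> \<xi> = 0"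
          using sym[OF E, of \<mu> "q \<xi>" \<xi>] fixed by simp
        then have "q \<xi> = 0"
          using orth_projection_form[OF proj, of \<xi>] by simp
        then show ?thesis
          using projection_family[OF q 2] by blast
      next
        case 3
        then show ?thesis by (simp add: effects_family_above[OF qe])
      qed
    qed
  qed
qed

lemma effect_range_projection:
  assumes M: "von_neumann_algebra M" and u: "u \<in> effects M"
  shows "\<exists>r. least_above (projections M) u r"
proof -
  have uM: "u \<in> M" and sym: "symmetric_op u"
    using u by (auto simp: effects_def sa_unit_ball_def sa_part_def selfadjoint_op_iff)
  obtain p where p: "orth_projection p" "\<And>\<xi>. p \<xi> = \<xi> \<longleftrightarrow> u \<xi> = 0" "id_blinfun - p \<in> M"
    using kernel_projection[OF sym] von_neumann_strong_algebra[OF M] uM by metis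
  define r where "r = id_blinfun - p"
  have r: "r \<in> projections M"
    using orth_projection_complement[OF p(1)] p(3) von_neumann_complex_linear[OF M p(3)]
    by (simp add: r_def projections_def projection_op_iff)
  have ker: "r \<xi> = 0 \<longleftrightarrow> u \<xi> = 0" for \<xi>
    using p(2)[of \<xi>] by (auto simp: r_def blinfun.diff_left)
  have "least_above (projections M) u r"
    unfolding least_above_def
  proof (intro conjI ballI impI r)
    show "spectral_le u r"
      by (simp add: effect_le_projection_iff[OF u r] ker)
    fix q assume q: "q \<in> projections M" "spectral_le u q"
    then show "spectral_le r q"
      using effect_le_projection_iff[OF u q(1)]
        effect_le_projection_iff[OF subsetD[OF projections_effects r] q(1)] ker by simp
  qed
  then show ?thesis ..
qed

text \<open>
  The projection \<open>k\<close> onto the eigenspace satisfies \<open>k u = k\<close>, so it lies in \<open>M\<close> as a product of a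
  multiplier of \<open>M\<close> with an element of \<open>M\<close>.
\<close>

lemma effect_eigenprojection:
  assumes M: "von_neumann_algebra M" and u: "u \<in> effects M"
  shows "\<exists>k. greatest_below (projections M) u k"
proof -
  have uM: "u \<in> M" and sym: "symmetric_op u"
    using u by (auto simp: effects_def sa_unit_ball_def sa_part_def selfadjoint_op_iff)
  have gen: "id_blinfun - u \<in> generated_algebra u"
    by (intro strong_algebra_diff strong_algebra_generated generated_algebra_id generated_algebra_self)
  obtain k where k: "k \<in> generated_algebra (id_blinfun - u)" "orth_projection k"
    "\<And>\<xi>. k \<xi> = \<xi> \<longleftrightarrow> (id_blinfun - u) \<xi> = 0"
    using kernel_projection[OF generated_algebra_symmetric[OF sym gen]] by metis
  have fixed: "k \<xi> = \<xi> \<longleftrightarrow> u \<xi> = \<xi>" for \<xi>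
    unfolding k(3) by (auto simp: blinfun.diff_left)
  have k_gen: "k \<in> generated_algebra u"
    using generated_algebra_trans[OF gen k(1)] .
  have "k (u \<xi>) = k \<xi>" for \<xi>
  proof -
    have "k (u \<xi>) = u (k \<xi>)"
      by (intro commute_apply generated_algebra_commute_self[OF k_gen generated_algebra_self])
    also have "\<dots> = k \<xi>"
      using fixed orth_projection_idem[OF k(2)] by blast
    finally show ?thesis .
  qed
  then have "k o\<^sub>L u = k"
    by (intro blinfun_eqI) simp
  then have "k \<in> M"
    using generated_algebra_multiplier[OF von_neumann_strong_algebra[OF M] uM k_gen uM] by simp
  then have kp: "k \<in> projections M"
    using k(2) von_neumann_complex_linear[OF M] by (simp add: projections_def projection_op_iff)
  have "greatest_below (projections M) u k"
    unfolding greatest_below_def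
  proof (intro conjI ballI impI kp)
    show "spectral_le k u"
      by (simp add: projection_le_effect_iff[OF u kp] fixed)
    fix q assume q: "q \<in> projections M" "spectral_le q u"
    then show "spectral_le q k"
      using projection_le_effect_iff[OF u q(1)]
        projection_le_effect_iff[OF subsetD[OF projections_effects kp] q(1)] fixed by simp
  qed
  then show ?thesis ..
qed

lemma subtopology_projections:
  assumes M: "von_neumann_algebra M"
  shows "subtopology (\<tau>\<^sub>o (effects M)) (projections M) = \<tau>\<^sub>o (projections M)"
  by (rule subtopology_spectral_order[OF projections_effects])
    (auto intro: spectral_le_antisym effects_selfadjoint effect_range_projection[OF M]
      effect_eigenprojection[OF M])

theorem corollary3p4:
  fixes M :: "('a::complex_hilbert \<Rightarrow>\<^sub>L 'a) set"
  assumes "von_neumann_algebra M"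
  shows
   "(subtopology (\<tau>\<^sub>o (sa_part M)) (pos_part M) = \<tau>\<^sub>o (pos_part M))
    \<and>
    (subtopology (\<tau>\<^sub>o (sa_part M)) (sa_unit_ball M) = \<tau>\<^sub>o (sa_unit_ball M))
    \<and>
    (subtopology (\<tau>\<^sub>o (sa_part M)) (effects M) = subtopology (\<tau>\<^sub>o (pos_part M)) (effects M) \<and>
     subtopology (\<tau>\<^sub>o (pos_part M)) (effects M) = subtopology (\<tau>\<^sub>o (sa_unit_ball M)) (effects M) \<and>
     subtopology (\<tau>\<^sub>o (sa_unit_ball M)) (effects M) = \<tau>\<^sub>o (effects M))
    \<and>
    (subtopology (\<tau>\<^sub>o (sa_part M)) (projections M) = subtopology (\<tau>\<^sub>o (pos_part M)) (projections M) \<and>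
     subtopology (\<tau>\<^sub>o (pos_part M)) (projections M) = subtopology (\<tau>\<^sub>o (sa_unit_ball M)) (projections M) \<and>
     subtopology (\<tau>\<^sub>o (sa_unit_ball M)) (projections M) = subtopology (\<tau>\<^sub>o (effects M)) (projections M) \<and>
     subtopology (\<tau>\<^sub>o (effects M)) (projections M) = \<tau>\<^sub>o (projections M))"
proof -
  let ?T = "\<tau>\<^sub>o (sa_part M)"
  have pos: "\<tau>\<^sub>o (pos_part M) = subtopology ?T (pos_part M)"
    unfolding pos_part_eq by (rule subtopology_sa_interval(2)[OF assms, of 0 0, symmetric]) simp_all
  have ball: "\<tau>\<^sub>o (sa_unit_ball M) = subtopology ?T (sa_unit_ball M)"
    unfolding sa_unit_ball_eq by (rule subtopology_sa_interval(1)[OF assms, symmetric]) simp_all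
  have eff: "\<tau>\<^sub>o (effects M) = subtopology ?T (effects M)"
    unfolding effects_eq by (rule subtopology_sa_interval(1)[OF assms, symmetric]) simp_all
  have prj: "\<tau>\<^sub>o (projections M) = subtopology (\<tau>\<^sub>o (effects M)) (projections M)"
    by (rule subtopology_projections[OF assms, symmetric])
  have "pos_part M \<inter> effects M = effects M" "sa_unit_ball M \<inter> effects M = effects M"
    by (auto simp: effects_def)
  moreover have "pos_part M \<inter> projections M = projections M"
    "sa_unit_ball M \<inter> projections M = projections M" "effects M \<inter> projections M = projections M"
    using projections_effects[of M] by (auto simp: effects_def)
  ultimately show ?thesis
    by (simp add: prj eff pos ball subtopology_subtopology)
qed

end
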